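(* Let $\Phi$ be an admissible test class on $\mathbb{R}^d$ with constants $A_1,A_2,A_3$ (as defined in the context), and let $\mathrm{D}_\Phi$ be the associated integral probability metric. Then: (a) $\mathrm{D}_\Phi$ is a metric on $\mathcal{P}^1(\mathbb{R}^d)$. In addition, if $\mu,\mu'\in\mathcal{P}^2(\mathbb{R}^d)$, then $$\mathrm{D}_\Phi(\mu,\mu')\le A_1\,\mathcal{W}_1(\mu,\mu')\le A_1\,\mathcal{W}_2(\mu,\mu').$$ (b) Let $K\subset\mathbb{R}^d$ be compact and let $\{\mu_i\}_{i\ge1},\mu\in\mathcal{P}(\mathbb{R}^d)$ satisfy $\mu_i(K)=\mu(K)=1$ for all $i\ge 1$. Then $\mu_i$ converges weakly to $\mu$ if and only if $\lim_{i\to\infty}\mathrm{D}_\Phi(\mu_i,\mu)=0$. (c) Let $\mu\in\mathcal{P}^2(\mathbb{R}^d)$, let $X^1,\dots,X^n$ be i.i.d. random variables with distribution $\mu$, and let $\bar\mu^n=\frac1n\sum_{i=1}^n\delta_{X^i}$. Then $$\mathbb{E}\,\mathrm{D}_\Phi(\mu,\bar\mu^n)\le\frac{2A_3}{\sqrt n}\sqrt{\int_{\mathbb{R}^d}(\|x\|^2+1)\,\mathrm{d}\mu(x)},$$ $$\mathbb{E}[\mathrm{D}_\Phi^2(\mu,\bar\mu^n)]\le\frac{A_1^2}{n}\int_{\mathbb{R}^d}\|x\|^2\,\mathrm{d}\mu(x)+\frac{4A_3^2}{n}\int_{\mathbb{R}^d}(\|x\|^2+1)\,\mathrm{d}\mu(x).$$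 (d) Let $\mu$ and $\bar\mu^n$ be as in (c), and suppose in addition that $\mu$ satisfies the $\mathrm{T}_1$ inequality with constant $\kappa>0$: $\mathcal{W}_1^2(\mu,\tilde\mu)\le2\kappa^2\mathcal{H}(\tilde\mu|\mu)$ for all $\tilde\mu\ll\mu$. Then for every $a>0$, $$\mathbb{P}\left(\mathrm{D}_\Phi(\mu,\bar\mu^n)-\frac{2A_3}{\sqrt n}\sqrt{\int_{\mathbb{R}^d}(\|x\|^2+1)\,\mathrm{d}\mu(x)}\ge a\right)\le\exp\left(-\frac{na^2}{2A_1^2\kappa^2}\right).$$
   Context: $\|\cdot\|$ is the Euclidean norm; $\mathrm{Lip}(f)=\sup_{x\ne y}|f(x)-f(y)|/\|x-y\|$. $\mathcal{P}(\mathbb{R}^d)$ is the set of Borel probability measures on $\mathbb{R}^d$, and $\mathcal{P}^p(\mathbb{R}^d)$ the subset of those with finite $p$-th moment $\int\|x\|^p\mathrm{d}\mu<\infty$. Admissible test class: a class $\Phi$ of functions $f:\mathbb{R}^d\to\mathbb{R}$ is an admissible test class with constants $A_1,A_2,A_3$ if (a) whenever $\mu$ is a finite signed Borel measure on $\mathbb{R}^d$ with $\int\|x\|\,\mathrm{d}|\mu|<\infty$ and $\int f\,\mathrm{d}\mu=0$ for all $f\in\Phi$, then $\mu=0$; (b) $A_1=\sup_{f\in\Phi}\mathrm{Lip}(f)<\infty$ and $A_2=\sup_{f\in\Phi}|f(0)|<\infty$; (c) $A_3>0$ and for every $n\ge1$ and all points $x^1,\dots,x^n\in\mathbb{R}^d$,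 $$\frac1n\mathbb{E}\sup_{f\in\Phi}\Bigl|\sum_{i=1}^n\xi_if(x^i)\Bigr|\le\frac{A_3}{n}\sqrt{\sum_{i=1}^n(\|x^i\|^2+1)},$$ where $\xi_1,\dots,\xi_n$ are i.i.d. with $\mathbb{P}(\xi_i=1)=\mathbb{P}(\xi_i=-1)=\frac12$ (the left side is the empirical Rademacher complexity). Integral probability metric: for $\mu,\mu'\in\mathcal{P}^1(\mathbb{R}^d)$, $\mathrm{D}_\Phi(\mu,\mu')=\sup_{f\in\Phi}\left|\int_{\mathbb{R}^d}f\,\mathrm{d}(\mu-\mu')\right|$. $\mathcal{W}_p$ is the $p$-Wasserstein distance for the Euclidean norm. $\mathcal{H}(\mu|\mu')=\mathbb{E}^{\mu}[\log(\mathrm{d}\mu/\mathrm{d}\mu')]$ is the relative entropy. *)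

theory Defs
  imports "HOL-Probability.Probability" "HOL-Probability.Product_PMF"
begin

section \<open>Probability measures and finite signed measures\<close>

definition prob_measures :: "'a::euclidean_space measure set" where
  "prob_measures = {\<mu>. sets \<mu> = sets borel \<and> prob_space \<mu>}"

definition moment_measures :: "nat \<Rightarrow> 'a::euclidean_space measure set" where
  "moment_measures p = {\<mu> \<in> prob_measures. (\<integral>\<^sup>+x. ennreal (norm x ^ p) \<partial>\<mu>) < \<infinity>}"

text \<open>A finite signed Borel measure is a countably additive real-valued function on the Borel
  sets; its values on other sets are irrelevant.\<close>

definition signed_borel_measure :: "('a::euclidean_space set \<Rightarrow> real) \<Rightarrow> bool" where
  "signed_borel_measure \<sigma> \<longleftrightarrow> \<sigma> {} = 0 \<and>
     (\<forall>A :: nat \<Rightarrow> 'a set. range A \<subseteq> sets borel \<longrightarrow> disjoint_family A \<longrightarrow>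
        (\<lambda>i. \<sigma> (A i)) sums \<sigma> (\<Union>i. A i))"

text \<open>The positive part in the Jordan decomposition,
  \<open>\<sigma>\<^sup>+ A = sup {\<sigma> B | B \<subseteq> A}\<close>. Since \<open>ennreal\<close> sends negative numbers to 0 and
  \<open>B = {}\<close> is admitted, the truncation does not change the supremum. The negative part is
  the positive part of \<open>- \<sigma>\<close>.\<close>

definition positive_variation :: "('a::euclidean_space set \<Rightarrow> real) \<Rightarrow> 'a measure" where
  "positive_variation \<sigma> =
     measure_of UNIV (sets borel) (\<lambda>A. SUP B \<in> {B \<in> sets borel. B \<subseteq> A}. ennreal (\<sigma> B))"

definition negative_variation :: "('a::euclidean_space set \<Rightarrow> real) \<Rightarrow> 'a measure" where
  "negative_variation \<sigma> = positive_variation (\<lambda>A. - \<sigma> A)"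

definition total_variation :: "('a::euclidean_space set \<Rightarrow> real) \<Rightarrow> 'a measure" where
  "total_variation \<sigma> = measure_of UNIV (sets borel)
     (\<lambda>A. emeasure (positive_variation \<sigma>) A + emeasure (negative_variation \<sigma>) A)"

definition signed_integral :: "('a::euclidean_space set \<Rightarrow> real) \<Rightarrow> ('a \<Rightarrow> real) \<Rightarrow> real" where
  "signed_integral \<sigma> f =
     (\<integral>x. f x \<partial>positive_variation \<sigma>) - (\<integral>x. f x \<partial>negative_variation \<sigma>)"

section \<open>Admissible test classes and integral probability metrics\<close>

definition Lip :: "('a::euclidean_space \<Rightarrow> real) \<Rightarrow> ereal" where
  "Lip f = (SUP (x, y) \<in> {(x, y). x \<noteq> y}. ereal (\<bar>f x - f y\<bar> / norm (x - y)))"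

definition rademacher_complexity ::
    "('a::euclidean_space \<Rightarrow> real) set \<Rightarrow> nat \<Rightarrow> (nat \<Rightarrow> 'a) \<Rightarrow> real" where
  "rademacher_complexity \<Phi> n x = 1 / real n *
     measure_pmf.expectation (Pi_pmf {1..n} 0 (\<lambda>_. pmf_of_set {- 1, 1 :: real}))
       (\<lambda>\<xi>. SUP f\<in>\<Phi>. \<bar>\<Sum>i=1..n. \<xi> i * f (x i)\<bar>)"

text \<open>The suprema over \<open>\<Phi>\<close> defining \<open>A1\<close> and \<open>A2\<close> are taken in the extended reals, so
  equating them with real numbers includes their finiteness. The class \<open>\<Phi>\<close> is nonempty by the
  first condition, and by the finiteness of \<open>A1\<close> and \<open>A2\<close> the real suprema
  in \<open>rademacher_complexity\<close> are over bounded sets.\<close>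

definition admissible_test_class ::
    "('a::euclidean_space \<Rightarrow> real) set \<Rightarrow> real \<Rightarrow> real \<Rightarrow> real \<Rightarrow> bool" where
  "admissible_test_class \<Phi> A1 A2 A3 \<longleftrightarrow>
     (\<forall>\<sigma>. signed_borel_measure \<sigma> \<longrightarrow>
        (\<integral>\<^sup>+x. ennreal (norm x) \<partial>total_variation \<sigma>) < \<infinity> \<longrightarrow>
        (\<forall>f\<in>\<Phi>. signed_integral \<sigma> f = 0) \<longrightarrow>
        (\<forall>A\<in>sets borel. \<sigma> A = 0)) \<and>
     (SUP f\<in>\<Phi>. Lip f) = ereal A1 \<and>
     (SUP f\<in>\<Phi>. ereal \<bar>f 0\<bar>) = ereal A2 \<and>
     A3 > 0 \<and>
     (\<forall>n\<ge>1. \<forall>x. rademacher_complexity \<Phi> n x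
        \<le> A3 / real n * sqrt (\<Sum>i=1..n. ((norm (x i))\<^sup>2 + 1)))"

text \<open>The metric is defined on measures with finite first moment only; 0 elsewhere is a dummy
  value. On that domain the supremum is finite for admissible \<open>\<Phi>\<close>, being bounded by
  \<open>A1\<close> times the sum of the first moments.\<close>

definition ipm ::
    "('a::euclidean_space \<Rightarrow> real) set \<Rightarrow> 'a measure \<Rightarrow> 'a measure \<Rightarrow> real" where
  "ipm \<Phi> \<mu> \<mu>' =
     (if \<mu> \<in> moment_measures 1 \<and> \<mu>' \<in> moment_measures 1
      then SUP f\<in>\<Phi>. \<bar>(\<integral>x. f x \<partial>\<mu>) - (\<integral>x. f x \<partial>\<mu>')\<bar>
      else 0)"

section \<open>Wasserstein distance, relative entropy, weak convergence, empirical measures\<close>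

definition couplings ::
    "'a::euclidean_space measure \<Rightarrow> 'a measure \<Rightarrow> ('a \<times> 'a) measure set" where
  "couplings \<mu> \<nu> = {\<pi>. sets \<pi> = sets borel \<and> distr \<pi> borel fst = \<mu> \<and> distr \<pi> borel snd = \<nu>}"

definition wasserstein ::
    "nat \<Rightarrow> 'a::euclidean_space measure \<Rightarrow> 'a measure \<Rightarrow> ennreal" where
  "wasserstein p \<mu> \<nu> =
     (let c = (INF \<pi>\<in>couplings \<mu> \<nu>. \<integral>\<^sup>+z. ennreal (norm (fst z - snd z) ^ p) \<partial>\<pi>)
      in if c = \<infinity> then \<infinity> else ennreal (root p (enn2real c)))"

text \<open>\<open>relative_entropy \<nu> \<mu>\<close> is the entropy of \<open>\<nu>\<close> with respect to \<open>\<mu>\<close>; note that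
  \<open>KL_divergence\<close> and \<open>entropy_density\<close> take the reference measure first. The Bochner integral
  in \<open>KL_divergence\<close> is 0 for a nonintegrable log-density. The negative part of
  \<open>log (d\<nu>/d\<mu>)\<close> is always \<open>\<nu>\<close>-integrable, so in that case the entropy is infinite.\<close>

definition relative_entropy ::
    "'a::euclidean_space measure \<Rightarrow> 'a measure \<Rightarrow> ennreal" where
  "relative_entropy \<nu> \<mu> =
     (if absolutely_continuous \<mu> \<nu> \<and> integrable \<nu> (entropy_density (exp 1) \<mu> \<nu>)
      then ennreal (KL_divergence (exp 1) \<mu> \<nu>) else \<infinity>)"

definition T1_inequality :: "'a::euclidean_space measure \<Rightarrow> real \<Rightarrow> bool" where
  "T1_inequality \<mu> \<kappa> \<longleftrightarrow>
     (\<forall>\<nu>\<in>prob_measures. absolutely_continuous \<mu> \<nu> \<longrightarrow>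
        (wasserstein 1 \<mu> \<nu>)\<^sup>2 \<le> ennreal (2 * \<kappa>\<^sup>2) * relative_entropy \<nu> \<mu>)"

text \<open>The library's \<open>weak_conv_m\<close> is restricted to measures on the real line.\<close>

definition weakly_converges ::
    "(nat \<Rightarrow> 'a::euclidean_space measure) \<Rightarrow> 'a measure \<Rightarrow> bool" where
  "weakly_converges \<mu>s \<mu> \<longleftrightarrow>
     (\<forall>f :: 'a \<Rightarrow> real. continuous_on UNIV f \<longrightarrow> bounded (range f) \<longrightarrow>
        (\<lambda>i. \<integral>x. f x \<partial>\<mu>s i) \<longlonglongrightarrow> (\<integral>x. f x \<partial>\<mu>))"

definition empirical_measure :: "nat \<Rightarrow> (nat \<Rightarrow> 'a::euclidean_space) \<Rightarrow> 'a measure" where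
  "empirical_measure n x =
     measure_of UNIV (sets borel) (\<lambda>A. (\<Sum>i=1..n. emeasure (return borel (x i)) A) / of_nat n)"

end

theory Submission
  imports Defs
begin

text \<open>Part (a): two measures determine the signed measure \<open>\<mu> - \<nu>\<close>; with densities \<open>g, h\<close> with respect to
  \<open>\<mu> + \<nu>\<close>, its positive and negative variations have densities \<open>(g - h)\<^sup>+\<close> and \<open>(h - g)\<^sup>+\<close>, so the
  separation property of the test class applies.

  Part (b): both directions follow from one compactness statement. A uniformly bounded sequence of
  laws is transported to the line along a Borel right inverse of a space-filling curve; Helly's and
  Skorohod's theorems there give a subsequence represented by almost surely convergent bounded
  random variables, which converges weakly and in the metric at the same time. Limits are identified
  by the separation property in one direction and by uniqueness of weak limits in the other.

  Parts (c) and (d): the distance to the empirical measure is \<open>A1 / n\<close>-Lipschitz in every coordinate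
  of the sample. Its variance and its exponential moments are bounded by integrating out one coordinate
  at a time, its mean by symmetrization, and a single coordinate is controlled by testing the transport
  inequality on exponential tilts of \<open>\<mu>\<close>.\<close>

section \<open>Moments and Lipschitz test classes\<close>

lemma moment_measuresD:
  assumes "\<mu> \<in> moment_measures p"
  shows "prob_space \<mu>" "sets \<mu> = sets borel" "space \<mu> = UNIV"
    "integrable \<mu> (\<lambda>x. norm x ^ p)"
proof -
  show *: "prob_space \<mu>" and s: "sets \<mu> = sets borel"
    using assms by (auto simp: moment_measures_def prob_measures_def)
  note [measurable_cong] = s
  show "space \<mu> = UNIV" using sets_eq_imp_space_eq[OF s] by simp
  show "integrable \<mu> (\<lambda>x. norm x ^ p)"
    using assms by (intro integrableI_bounded) (auto simp: moment_measures_def)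
qed

lemma moment_measures_1D: "\<mu> \<in> moment_measures 1 \<Longrightarrow> integrable \<mu> norm"
  using moment_measuresD(4)[of \<mu> 1] by simp

lemma moment_measuresI:
  assumes "prob_space \<mu>" "sets \<mu> = sets borel" "integrable \<mu> (\<lambda>x. norm x ^ p)"
  shows "\<mu> \<in> moment_measures p"
  using assms by (auto simp: moment_measures_def prob_measures_def integrable_iff_bounded)

lemma moment_measures_2_1: "moment_measures 2 \<subseteq> moment_measures 1"
proof
  fix \<mu> :: "'a measure" assume \<mu>: "\<mu> \<in> moment_measures 2"
  note * = moment_measuresD[OF \<mu>]
  note [measurable_cong] = *(2)
  interpret prob_space \<mu> by (rule *)
  have "integrable \<mu> (\<lambda>x. 1 + norm x ^ 2)" using *(4) by simp
  then have "integrable \<mu> (\<lambda>x. norm x ^ 1)"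
  proof (rule Bochner_Integration.integrable_bound)
    show "(\<lambda>x. norm x ^ 1) \<in> borel_measurable \<mu>"
      by measurable
    have "norm x ^ 1 \<le> 1 + norm x ^ 2" for x :: 'a
    proof -
      have "0 \<le> (norm x - 1)\<^sup>2" by simp
      then have "2 * norm x \<le> 1 + norm x ^ 2" by (simp add: power2_diff)
      then show ?thesis using norm_ge_zero[of x] unfolding power_one_right by linarith
    qed
    then show "AE x in \<mu>. norm (norm x ^ 1) \<le> norm (1 + norm x ^ 2)"
      by (auto intro: order_trans)
  qed
  then show "\<mu> \<in> moment_measures 1" using * by (intro moment_measuresI) auto
qed

lemma bounded_support_moment_measures:
  assumes "prob_space \<mu>" "sets \<mu> = sets borel" "AE x in \<mu>. norm x \<le> R"
  shows "\<mu> \<in> moment_measures p"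
proof -
  note [measurable_cong] = assms(2)
  interpret prob_space \<mu> by fact
  have "integrable \<mu> (\<lambda>x. norm x ^ p)"
    using assms(3) by (intro integrable_const_bound[where B = "R ^ p"]) (auto intro: power_mono elim!: eventually_mono)
  then show ?thesis using assms by (intro moment_measuresI)
qed

locale lipschitz_class =
  fixes \<Phi> :: "('a::euclidean_space \<Rightarrow> real) set" and L B :: real
  assumes nonempty: "\<Phi> \<noteq> {}"
    and L_nonneg: "0 \<le> L"
    and lipschitz: "f \<in> \<Phi> \<Longrightarrow> \<bar>f x - f y\<bar> \<le> L * norm (x - y)"
    and origin: "f \<in> \<Phi> \<Longrightarrow> \<bar>f 0\<bar> \<le> B"
begin

lemma continuous: "f \<in> \<Phi> \<Longrightarrow> continuous_on UNIV f"
  using L_nonneg lipschitz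
  by (intro lipschitz_on_continuous_on[of L] lipschitz_onI) (auto simp: dist_norm)

lemma growth: "f \<in> \<Phi> \<Longrightarrow> \<bar>f x\<bar> \<le> B + L * norm x"
  using lipschitz[of f x 0] origin[of f] by simp

lemma measurable: "f \<in> \<Phi> \<Longrightarrow> f \<in> borel_measurable borel"
  using continuous by (rule borel_measurable_continuous_onI)

lemma integrable_test:
  assumes \<mu>: "\<mu> \<in> moment_measures 1" and f: "f \<in> \<Phi>"
  shows "integrable \<mu> f"
proof -
  note * = moment_measuresD[OF \<mu>]
  note [measurable_cong] = *(2)
  interpret prob_space \<mu> by (rule *)
  have "integrable \<mu> (\<lambda>x. B + L * norm x)"
    using moment_measures_1D[OF \<mu>] by simp
  then show ?thesis
  proof (rule Bochner_Integration.integrable_bound)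
    show "f \<in> borel_measurable \<mu>"
      using measurable[OF f] by measurable
    have "norm (f x) \<le> norm (B + L * norm x)" for x
      using growth[OF f, of x] by simp
    then show "AE x in \<mu>. norm (f x) \<le> norm (B + L * norm x)" by simp
  qed
qed

lemma integral_diff_le:
  assumes [measurable]: "Z \<in> borel_measurable M" "W \<in> borel_measurable M"
    and Z: "distr M borel Z \<in> moment_measures 1" and W: "distr M borel W \<in> moment_measures 1"
    and f: "f \<in> \<Phi>"
  shows "\<bar>(\<integral>x. f x \<partial>distr M borel Z) - (\<integral>x. f x \<partial>distr M borel W)\<bar>
    \<le> L * (\<integral>\<omega>. norm (Z \<omega> - W \<omega>) \<partial>M)"
proof -
  note [measurable] = measurable[OF f]
  have i: "integrable M (\<lambda>\<omega>. norm (Z \<omega> - W \<omega>))"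
    using moment_measures_1D[OF Z] moment_measures_1D[OF W]
    by (auto simp: integrable_distr_eq integrable_norm_iff)
  have fi: "integrable M (\<lambda>\<omega>. f (Z \<omega>))" "integrable M (\<lambda>\<omega>. f (W \<omega>))"
    using integrable_test[OF Z f] integrable_test[OF W f] by (auto simp: integrable_distr_eq)
  have "\<bar>(\<integral>x. f x \<partial>distr M borel Z) - (\<integral>x. f x \<partial>distr M borel W)\<bar>
      = \<bar>\<integral>\<omega>. f (Z \<omega>) - f (W \<omega>) \<partial>M\<bar>"
    using fi by (simp add: integral_distr)
  also have "\<dots> \<le> (\<integral>\<omega>. \<bar>f (Z \<omega>) - f (W \<omega>)\<bar> \<partial>M)"
    by (rule integral_abs_bound)
  also have "\<dots> \<le> (\<integral>\<omega>. L * norm (Z \<omega> - W \<omega>) \<partial>M)"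
    using i fi lipschitz[OF f] by (intro integral_mono) auto
  finally show ?thesis by simp
qed

lemma bdd_above_ipm:
  assumes \<mu>: "\<mu> \<in> moment_measures 1" and \<nu>: "\<nu> \<in> moment_measures 1"
  shows "bdd_above ((\<lambda>f. \<bar>(\<integral>x. f x \<partial>\<mu>) - (\<integral>x. f x \<partial>\<nu>)\<bar>) ` \<Phi>)"
proof (rule bdd_aboveI2)
  fix f assume f: "f \<in> \<Phi>"
  have *: "\<bar>\<integral>x. f x \<partial>\<rho>\<bar> \<le> (\<integral>x. B + L * norm x \<partial>\<rho>)" if \<rho>: "\<rho> \<in> moment_measures 1" for \<rho>
  proof -
    interpret prob_space \<rho> by (rule moment_measuresD[OF \<rho>])
    have "\<bar>\<integral>x. f x \<partial>\<rho>\<bar> \<le> (\<integral>x. \<bar>f x\<bar> \<partial>\<rho>)" by (rule integral_abs_bound)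
    also have "\<dots> \<le> (\<integral>x. B + L * norm x \<partial>\<rho>)"
      using integrable_test[OF \<rho> f] moment_measures_1D[OF \<rho>] growth[OF f]
      by (intro integral_mono) auto
    finally show ?thesis .
  qed
  show "\<bar>(\<integral>x. f x \<partial>\<mu>) - (\<integral>x. f x \<partial>\<nu>)\<bar> \<le> (\<integral>x. B + L * norm x \<partial>\<mu>) + (\<integral>x. B + L * norm x \<partial>\<nu>)"
    using *[OF \<mu>] *[OF \<nu>] by linarith
qed

lemma ipm_upper:
  assumes "\<mu> \<in> moment_measures 1" "\<nu> \<in> moment_measures 1" "f \<in> \<Phi>"
  shows "\<bar>(\<integral>x. f x \<partial>\<mu>) - (\<integral>x. f x \<partial>\<nu>)\<bar> \<le> ipm \<Phi> \<mu> \<nu>"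
  using cSUP_upper[OF assms(3) bdd_above_ipm[OF assms(1,2)]] assms by (simp add: ipm_def)

lemma ipm_least:
  assumes "\<mu> \<in> moment_measures 1" "\<nu> \<in> moment_measures 1"
    and "\<And>f. f \<in> \<Phi> \<Longrightarrow> \<bar>(\<integral>x. f x \<partial>\<mu>) - (\<integral>x. f x \<partial>\<nu>)\<bar> \<le> c"
  shows "ipm \<Phi> \<mu> \<nu> \<le> c"
  using assms nonempty by (auto simp: ipm_def intro!: cSUP_least)

lemma ipm_nonneg: "0 \<le> ipm \<Phi> \<mu> \<nu>"
proof (cases "\<mu> \<in> moment_measures 1 \<and> \<nu> \<in> moment_measures 1")
  case True
  obtain f where "f \<in> \<Phi>" using nonempty by auto
  then show ?thesis using True by (blast intro: order_trans[OF abs_ge_zero ipm_upper])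
qed (auto simp: ipm_def)

lemma ipm_commute: "ipm \<Phi> \<mu> \<nu> = ipm \<Phi> \<nu> \<mu>"
  by (simp add: ipm_def abs_minus_commute)

lemma ipm_triangle:
  assumes "\<mu> \<in> moment_measures 1" "\<nu> \<in> moment_measures 1" "\<rho> \<in> moment_measures 1"
  shows "ipm \<Phi> \<mu> \<rho> \<le> ipm \<Phi> \<mu> \<nu> + ipm \<Phi> \<nu> \<rho>"
proof (rule ipm_least)
  fix f assume "f \<in> \<Phi>"
  then show "\<bar>(\<integral>x. f x \<partial>\<mu>) - (\<integral>x. f x \<partial>\<rho>)\<bar> \<le> ipm \<Phi> \<mu> \<nu> + ipm \<Phi> \<nu> \<rho>"
    using ipm_upper[of \<mu> \<nu> f] ipm_upper[of \<nu> \<rho> f] assms by linarith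
qed (use assms in auto)

lemma ipm_distr_le:
  assumes "Z \<in> borel_measurable M" "W \<in> borel_measurable M"
    and "distr M borel Z \<in> moment_measures 1" "distr M borel W \<in> moment_measures 1"
  shows "ipm \<Phi> (distr M borel Z) (distr M borel W) \<le> L * (\<integral>\<omega>. norm (Z \<omega> - W \<omega>) \<partial>M)"
  using assms by (intro ipm_least integral_diff_le)

end

lemma Lip_leD:
  assumes "Lip f \<le> ereal L"
  shows "\<bar>f x - f y\<bar> \<le> L * norm (x - y)"
proof (cases "x = y")
  case False
  then have "ereal (\<bar>f x - f y\<bar> / norm (x - y)) \<le> Lip f"
    unfolding Lip_def by (intro SUP_upper2[of "(x, y)"]) auto
  then have "ereal (\<bar>f x - f y\<bar> / norm (x - y)) \<le> ereal L"
    using assms by (rule order_trans)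
  then show ?thesis using False by (simp add: field_simps)
qed simp

lemma admissible_imp_lipschitz_class:
  assumes "admissible_test_class \<Phi> A1 A2 A3"
  shows "lipschitz_class \<Phi> A1 A2"
proof
  have A1: "(SUP f\<in>\<Phi>. Lip f) = ereal A1" and A2: "(SUP f\<in>\<Phi>. ereal \<bar>f 0\<bar>) = ereal A2"
    using assms by (auto simp: admissible_test_class_def)
  show ne: "\<Phi> \<noteq> {}" using A1 by (auto simp: bot_ereal_def)
  show lip: "\<bar>f x - f y\<bar> \<le> A1 * norm (x - y)" if "f \<in> \<Phi>" for f x y
    using that A1 by (intro Lip_leD) (metis SUP_upper)
  show "\<bar>f 0\<bar> \<le> A2" if "f \<in> \<Phi>" for f
    using SUP_upper[OF that, of "\<lambda>f. ereal \<bar>f 0\<bar>"] A2 by simp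
  obtain f where f: "f \<in> \<Phi>" using ne by auto
  obtain b :: 'a where b: "b \<in> Basis" using nonempty_Basis by blast
  have "0 \<le> A1 * norm (b - 0)" using lip[OF f, of b 0] by linarith
  then show "0 \<le> A1" using b by simp
qed

section \<open>Variations of the difference of two measures\<close>

lemma measure_of_eqI_emeasure:
  assumes "sets N = sets borel" "\<And>A. A \<in> sets borel \<Longrightarrow> emeasure N A = F A"
  shows "measure_of UNIV (sets borel) F = (N :: 'a::euclidean_space measure)"
proof -
  have sp: "space N = UNIV" using sets_eq_imp_space_eq[OF assms(1)] by simp
  have "measure_of UNIV (sets borel) F = measure_of UNIV (sets borel) (emeasure N)"
  proof (rule measure_of_eq)
    fix A :: "'a set" assume "A \<in> sigma_sets UNIV (sets borel)"
    then have "A \<in> sets borel" using sets.sigma_sets_eq[of "borel :: 'a measure"] by simp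
    then show "F A = emeasure N A" using assms by simp
  qed auto
  also have "\<dots> = N"
    using measure_of_of_measure[of N] assms(1) sp by simp
  finally show ?thesis .
qed

lemma common_density:
  fixes \<mu> \<nu> :: "'a::euclidean_space measure"
  assumes "finite_measure \<mu>" "finite_measure \<nu>" and s: "sets \<mu> = sets borel" "sets \<nu> = sets borel"
  obtains \<rho> :: "'a measure" and g h :: "'a \<Rightarrow> real"
  where "finite_measure \<rho>" "sets \<rho> = sets borel"
    "g \<in> borel_measurable borel" "h \<in> borel_measurable borel" "\<And>x. 0 \<le> g x" "\<And>x. 0 \<le> h x"
    "\<mu> = density \<rho> (\<lambda>x. ennreal (g x))" "\<nu> = density \<rho> (\<lambda>x. ennreal (h x))"
proof -
  interpret \<mu>: finite_measure \<mu> by fact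
  interpret \<nu>: finite_measure \<nu> by fact
  define \<rho> where "\<rho> = measure_of UNIV (sets (borel :: 'a measure)) (\<lambda>A. emeasure \<mu> A + emeasure \<nu> A)"
  have s\<rho>: "sets \<rho> = sets borel" by (simp add: \<rho>_def sets.sigma_sets_eq[of borel, simplified])
  note [measurable_cong] = s\<rho>
  have sp: "space \<rho> = UNIV" using sets_eq_imp_space_eq[OF s\<rho>] by simp
  have e: "emeasure \<rho> A = emeasure \<mu> A + emeasure \<nu> A" if "A \<in> sets borel" for A
  proof (rule emeasure_measure_of[OF \<rho>_def])
    show "positive (sets \<rho>) (\<lambda>A. emeasure \<mu> A + emeasure \<nu> A)"
      by (simp add: positive_def)
    show "countably_additive (sets \<rho>) (\<lambda>A. emeasure \<mu> A + emeasure \<nu> A)"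
    proof (rule countably_additiveI)
      fix A :: "nat \<Rightarrow> 'a set" assume A: "range A \<subseteq> sets \<rho>" "disjoint_family A"
      then have "(\<Sum>i. emeasure \<mu> (A i)) = emeasure \<mu> (\<Union>i. A i)"
        "(\<Sum>i. emeasure \<nu> (A i)) = emeasure \<nu> (\<Union>i. A i)"
        by (auto intro!: suminf_emeasure simp: s\<rho> s)
      then show "(\<Sum>i. emeasure \<mu> (A i) + emeasure \<nu> (A i)) = emeasure \<mu> (\<Union>i. A i) + emeasure \<nu> (\<Union>i. A i)"
        by (subst suminf_add[symmetric]) auto
    qed
  qed (use that s\<rho> in auto)
  have fin: "finite_measure \<rho>"
    using \<mu>.emeasure_finite[of UNIV] \<nu>.emeasure_finite[of UNIV]
    by (intro finite_measureI) (simp add: sp e less_top[symmetric])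
  interpret \<rho>: finite_measure \<rho> by fact
  have *: "\<exists>g. g \<in> borel_measurable borel \<and> (\<forall>x. 0 \<le> g x) \<and> \<eta> = density \<rho> (\<lambda>x. ennreal (g x))"
    if \<eta>: "finite_measure \<eta>" "sets \<eta> = sets borel" "\<And>A. A \<in> sets borel \<Longrightarrow> emeasure \<eta> A \<le> emeasure \<rho> A" for \<eta>
  proof -
    interpret \<eta>: finite_measure \<eta> by fact
    have ac: "absolutely_continuous \<rho> \<eta>"
      unfolding absolutely_continuous_def using \<eta>(2,3) by (auto simp: null_sets_def s\<rho>) (metis le_zero_eq)
    have m: "RN_deriv \<rho> \<eta> \<in> borel_measurable borel"
      using borel_measurable_RN_deriv[of \<rho> \<eta>] measurable_cong_sets[OF s\<rho> refl] by metis
    have "AE x in \<rho>. RN_deriv \<rho> \<eta> x \<noteq> \<infinity>"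
      using \<rho>.RN_deriv_finite[OF \<eta>.sigma_finite_measure_axioms ac] \<eta>(2) s\<rho> by simp
    then have "density \<rho> (RN_deriv \<rho> \<eta>) = density \<rho> (\<lambda>x. ennreal (enn2real (RN_deriv \<rho> \<eta> x)))"
      using m by (intro density_cong) (auto elim!: eventually_mono simp: top.not_eq_extremum)
    then show ?thesis
      using \<rho>.density_RN_deriv[OF ac] \<eta>(2) s\<rho> m
      by (intro exI[of _ "\<lambda>x. enn2real (RN_deriv \<rho> \<eta> x)"]) auto
  qed
  from *[OF assms(1,3)] *[OF assms(2,4)] show ?thesis
    using that[OF fin s\<rho>] e by auto
qed

lemma positive_variation_density:
  fixes k :: "'a::euclidean_space \<Rightarrow> real"
  assumes s: "sets \<rho> = sets borel" and k: "integrable \<rho> k"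
  shows "positive_variation (\<lambda>A. \<integral>x. indicator A x * k x \<partial>\<rho>) = density \<rho> (\<lambda>x. ennreal (k x))"
  unfolding positive_variation_def
proof (rule measure_of_eqI_emeasure)
  have [measurable]: "k \<in> borel_measurable \<rho>" using k by simp
  have ki: "integrable \<rho> (\<lambda>x. indicator A x * k x)" if "A \<in> sets borel" for A
    using integrable_mult_indicator[OF _ k, of A] that s by simp
  show "sets (density \<rho> (\<lambda>x. ennreal (k x))) = sets borel" using s by simp
  fix A :: "'a set" assume A: "A \<in> sets borel"
  have P: "{x. 0 \<le> k x} \<in> sets borel"
    using k s sets_eq_imp_space_eq[OF s] by (auto dest!: borel_measurable_integrable simp: borel_measurable_iff_ge)
  show "emeasure (density \<rho> (\<lambda>x. ennreal (k x))) A
      = (SUP B\<in>{B \<in> sets borel. B \<subseteq> A}. ennreal (\<integral>x. indicator B x * k x \<partial>\<rho>))"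
    (is "?l = ?r")
  proof (rule antisym)
    let ?B = "A \<inter> {x. 0 \<le> k x}"
    have B: "?B \<in> sets borel" using A P by auto
    have "?l = (\<integral>\<^sup>+x. ennreal (k x) * indicator A x \<partial>\<rho>)"
      using A s by (simp add: emeasure_density)
    also have "\<dots> = (\<integral>\<^sup>+x. ennreal (indicator ?B x * k x) \<partial>\<rho>)"
      by (intro nn_integral_cong) (auto simp: indicator_def ennreal_neg)
    also have "\<dots> = ennreal (\<integral>x. indicator ?B x * k x \<partial>\<rho>)"
      using ki[OF B] by (intro nn_integral_eq_integral) (auto simp: indicator_def)
    also have "\<dots> \<le> ?r"
      using B by (intro SUP_upper) auto
    finally show "?l \<le> ?r" .
    show "?r \<le> ?l"
    proof (rule SUP_least)
      have max_eq: "max 0 (indicator A x * k x) = indicator A x * max 0 (k x)" for x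
        by (simp add: indicator_def)
      have ki': "integrable \<rho> (\<lambda>x. indicator A x * max 0 (k x))"
        using integrable_max[OF integrable_zero ki[OF A]] by (simp add: max_eq)
      fix B assume "B \<in> {B \<in> sets borel. B \<subseteq> A}"
      then have B: "B \<in> sets borel" "B \<subseteq> A" by auto
      have "ennreal (\<integral>x. indicator B x * k x \<partial>\<rho>) \<le> ennreal (\<integral>x. indicator A x * max 0 (k x) \<partial>\<rho>)"
        using ki[OF B(1)] ki' B(2)
        by (intro ennreal_leI integral_mono) (auto simp: indicator_def)
      also have "\<dots> = (\<integral>\<^sup>+x. ennreal (indicator A x * max 0 (k x)) \<partial>\<rho>)"
        using ki' by (intro nn_integral_eq_integral[symmetric]) (auto simp: indicator_def)
      also have "\<dots> = (\<integral>\<^sup>+x. ennreal (k x) * indicator A x \<partial>\<rho>)"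
        by (intro nn_integral_cong) (auto simp: indicator_def ennreal_neg max_def)
      also have "\<dots> = ?l"
        using A s by (simp add: emeasure_density)
      finally show "ennreal (\<integral>x. indicator B x * k x \<partial>\<rho>) \<le> ?l" .
    qed
  qed
qed

lemma total_variation_density:
  fixes k :: "'a::euclidean_space \<Rightarrow> real"
  assumes s: "sets \<rho> = sets borel" and k: "integrable \<rho> k"
  shows "total_variation (\<lambda>A. \<integral>x. indicator A x * k x \<partial>\<rho>) = density \<rho> (\<lambda>x. ennreal \<bar>k x\<bar>)"
    and "negative_variation (\<lambda>A. \<integral>x. indicator A x * k x \<partial>\<rho>) = density \<rho> (\<lambda>x. ennreal (- k x))"
proof -
  have [measurable]: "k \<in> borel_measurable \<rho>" using k by simp
  show n: "negative_variation (\<lambda>A. \<integral>x. indicator A x * k x \<partial>\<rho>) = density \<rho> (\<lambda>x. ennreal (- k x))"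
    using positive_variation_density[OF s, of "\<lambda>x. - k x"] k
    by (simp add: negative_variation_def)
  show "total_variation (\<lambda>A. \<integral>x. indicator A x * k x \<partial>\<rho>) = density \<rho> (\<lambda>x. ennreal \<bar>k x\<bar>)"
    unfolding total_variation_def n positive_variation_density[OF assms]
  proof (rule measure_of_eqI_emeasure)
    fix A :: "'a set" assume A: "A \<in> sets borel"
    have "emeasure (density \<rho> (\<lambda>x. ennreal \<bar>k x\<bar>)) A
        = (\<integral>\<^sup>+x. ennreal (k x) * indicator A x + ennreal (- k x) * indicator A x \<partial>\<rho>)"
      using A s by (auto simp: emeasure_density indicator_def abs_real_def ennreal_neg intro!: nn_integral_cong)
    also have "\<dots> = emeasure (density \<rho> (\<lambda>x. ennreal (k x))) A + emeasure (density \<rho> (\<lambda>x. ennreal (- k x))) A"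
      using A s by (simp add: emeasure_density nn_integral_add)
    finally show "emeasure (density \<rho> (\<lambda>x. ennreal \<bar>k x\<bar>)) A = \<dots>" .
  qed (simp add: s)
qed

lemma admissible_separates:
  assumes \<Phi>: "admissible_test_class \<Phi> A1 A2 A3"
    and \<mu>: "\<mu> \<in> moment_measures 1" and \<nu>: "\<nu> \<in> moment_measures 1"
    and eq: "\<And>f. f \<in> \<Phi> \<Longrightarrow> (\<integral>x. f x \<partial>\<mu>) = (\<integral>x. f x \<partial>\<nu>)"
  shows "\<mu> = (\<nu> :: 'a::euclidean_space measure)"
proof -
  interpret lipschitz_class \<Phi> A1 A2 by (rule admissible_imp_lipschitz_class) fact
  note \<mu>' = moment_measuresD[OF \<mu>] and \<nu>' = moment_measuresD[OF \<nu>]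
  interpret \<mu>: prob_space \<mu> by (rule \<mu>')
  interpret \<nu>: prob_space \<nu> by (rule \<nu>')
  obtain \<rho> :: "'a measure" and g h :: "'a \<Rightarrow> real" where \<rho>: "finite_measure \<rho>" and s: "sets \<rho> = sets borel"
    and gh [measurable]: "g \<in> borel_measurable borel" "h \<in> borel_measurable borel"
    and nn: "\<And>x. 0 \<le> g x" "\<And>x. 0 \<le> h x"
    and d: "\<mu> = density \<rho> (\<lambda>x. ennreal (g x))" "\<nu> = density \<rho> (\<lambda>x. ennreal (h x))"
    using common_density[OF \<mu>.finite_measure_axioms \<nu>.finite_measure_axioms \<mu>'(2) \<nu>'(2)] by blast
  note [measurable_cong] = s
  define k where "k x = g x - h x" for x
  have [measurable]: "k \<in> borel_measurable borel" unfolding k_def by measurable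
  have int: "integrable \<rho> (\<lambda>x. g x * f x)" "(\<integral>x. f x \<partial>\<mu>) = (\<integral>x. g x * f x \<partial>\<rho>)"
    if [measurable]: "f \<in> borel_measurable borel" and "integrable \<mu> f" for f :: "'a \<Rightarrow> real"
    using that nn unfolding d by (simp_all add: integrable_real_density integral_real_density)
  have int': "integrable \<rho> (\<lambda>x. h x * f x)" "(\<integral>x. f x \<partial>\<nu>) = (\<integral>x. h x * f x \<partial>\<rho>)"
    if [measurable]: "f \<in> borel_measurable borel" and "integrable \<nu> f" for f :: "'a \<Rightarrow> real"
    using that nn unfolding d by (simp_all add: integrable_real_density integral_real_density)
  have "integrable \<rho> (\<lambda>x. g x * 1)" "integrable \<rho> (\<lambda>x. h x * 1)"
    by (rule int int'; simp)+
  then have "integrable \<rho> g" "integrable \<rho> h" by simp_all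
  then have k: "integrable \<rho> k" unfolding k_def by auto
  define \<sigma> where "\<sigma> A = (\<integral>x. indicator A x * k x \<partial>\<rho>)" for A
  have \<sigma>: "\<sigma> A = measure \<mu> A - measure \<nu> A" if A: "A \<in> sets borel" for A
  proof -
    have i: "integrable \<mu> (indicator A :: 'a \<Rightarrow> real)" "integrable \<nu> (indicator A :: 'a \<Rightarrow> real)"
      using A \<mu>' \<nu>' by (auto simp: less_top[symmetric])
    have "\<sigma> A = (\<integral>x. g x * indicator A x - h x * indicator A x \<partial>\<rho>)"
      by (auto simp: \<sigma>_def k_def algebra_simps)
    also have "\<dots> = (\<integral>x. indicator A x \<partial>\<mu>) - (\<integral>x. indicator A x \<partial>\<nu>)"
      using int[OF _ i(1)] int'[OF _ i(2)] A by simp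
    finally show ?thesis using A \<mu>' \<nu>' by simp
  qed
  have \<sigma>_eq: "\<sigma> = (\<lambda>A. \<integral>x. indicator A x * k x \<partial>\<rho>)"
    by (simp add: \<sigma>_def fun_eq_iff)
  have "signed_borel_measure \<sigma>"
    unfolding signed_borel_measure_def
  proof (intro conjI allI impI)
    show "\<sigma> {} = 0" by (simp add: \<sigma>)
    fix A :: "nat \<Rightarrow> 'a set" assume A: "range A \<subseteq> sets borel" "disjoint_family A"
    then have "(\<lambda>i. measure \<mu> (A i) - measure \<nu> (A i)) sums (measure \<mu> (\<Union>i. A i) - measure \<nu> (\<Union>i. A i))"
      using \<mu>' \<nu>' by (intro sums_diff \<mu>.finite_measure_UNION \<nu>.finite_measure_UNION) auto
    then show "(\<lambda>i. \<sigma> (A i)) sums \<sigma> (\<Union>i. A i)"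
      using A by (simp add: \<sigma> range_subsetD sets.countable_nat_UN)
  qed
  moreover have "(\<integral>\<^sup>+x. ennreal (norm x) \<partial>total_variation \<sigma>) < \<infinity>"
  proof -
    have n: "integrable \<rho> (\<lambda>x. g x * norm x)" "integrable \<rho> (\<lambda>x. h x * norm x)"
      using int(1)[OF _ moment_measures_1D[OF \<mu>]] int'(1)[OF _ moment_measures_1D[OF \<nu>]] by simp_all
    have "(\<integral>\<^sup>+x. ennreal (norm x) \<partial>total_variation \<sigma>) = (\<integral>\<^sup>+x. ennreal \<bar>k x\<bar> * ennreal (norm x) \<partial>\<rho>)"
      unfolding \<sigma>_eq total_variation_density(1)[OF s k] by (simp add: nn_integral_density)
    also have "\<dots> \<le> (\<integral>\<^sup>+x. ennreal (g x * norm x + h x * norm x) \<partial>\<rho>)"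
    proof (intro nn_integral_mono)
      fix x
      have "\<bar>k x\<bar> * norm x \<le> (g x + h x) * norm x"
        using nn[of x] by (intro mult_right_mono) (auto simp: k_def)
      then show "ennreal \<bar>k x\<bar> * ennreal (norm x) \<le> ennreal (g x * norm x + h x * norm x)"
        by (simp add: ennreal_mult[symmetric] algebra_simps ennreal_leI)
    qed
    also have "\<dots> = ennreal (\<integral>x. g x * norm x + h x * norm x \<partial>\<rho>)"
      using n nn by (intro nn_integral_eq_integral) auto
    finally show ?thesis by (auto intro: le_less_trans)
  qed
  moreover have "signed_integral \<sigma> f = 0" if f: "f \<in> \<Phi>" for f
  proof -
    note [measurable] = measurable[OF f]
    note i = int[OF measurable[OF f] integrable_test[OF \<mu> f]]
      and i' = int'[OF measurable[OF f] integrable_test[OF \<nu> f]]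
    have bnd: "integrable \<rho> (\<lambda>x. max 0 (c * k x) * f x)" if "c = 1 \<or> c = -1" for c
    proof (rule Bochner_Integration.integrable_bound)
      show "integrable \<rho> (\<lambda>x. \<bar>g x * f x\<bar> + \<bar>h x * f x\<bar>)" using i(1) i'(1) by auto
      have "\<bar>max 0 (c * k x)\<bar> * \<bar>f x\<bar> \<le> (g x + h x) * \<bar>f x\<bar>" for x
        using nn[of x] that by (intro mult_right_mono) (auto simp: k_def)
      then show "AE x in \<rho>. norm (max 0 (c * k x) * f x) \<le> norm (\<bar>g x * f x\<bar> + \<bar>h x * f x\<bar>)"
        using nn by (auto simp: abs_mult algebra_simps)
    qed auto
    have dens: "(\<integral>x. f x \<partial>density \<rho> (\<lambda>x. ennreal (c * k x))) = (\<integral>x. max 0 (c * k x) * f x \<partial>\<rho>)" for c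
    proof -
      have *: "density \<rho> (\<lambda>x. ennreal (c * k x)) = density \<rho> (\<lambda>x. ennreal (max 0 (c * k x)))"
        by (intro density_cong) (auto simp: ennreal_neg max_def)
      show ?thesis unfolding * by (intro integral_real_density) auto
    qed
    have "signed_integral \<sigma> f = (\<integral>x. max 0 (1 * k x) * f x \<partial>\<rho>) - (\<integral>x. max 0 (-1 * k x) * f x \<partial>\<rho>)"
      unfolding signed_integral_def \<sigma>_eq total_variation_density(2)[OF s k] positive_variation_density[OF s k]
      using dens[of 1] dens[of "-1"] by simp
    also have "\<dots> = (\<integral>x. max 0 (1 * k x) * f x - max 0 (-1 * k x) * f x \<partial>\<rho>)"
      using bnd[of 1] bnd[of "-1"] by (intro Bochner_Integration.integral_diff[symmetric]) auto
    also have "\<dots> = (\<integral>x. g x * f x - h x * f x \<partial>\<rho>)"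
      by (intro Bochner_Integration.integral_cong) (auto simp: k_def max_def algebra_simps)
    also have "\<dots> = 0"
      using i i' eq[OF f] by simp
    finally show ?thesis .
  qed
  ultimately have "\<forall>A\<in>sets borel. \<sigma> A = 0"
    using \<Phi> unfolding admissible_test_class_def by blast
  then show ?thesis
    using \<mu>' \<nu>' by (intro measure_eqI) (auto simp: \<sigma> \<mu>.emeasure_eq_measure \<nu>.emeasure_eq_measure)
qed

lemma Metric_space_ipm:
  assumes "admissible_test_class \<Phi> A1 A2 A3"
  shows "Metric_space (moment_measures 1) (ipm \<Phi>)"
proof
  interpret lipschitz_class \<Phi> A1 A2 by (rule admissible_imp_lipschitz_class) fact
  fix \<mu> \<nu> \<rho> :: "'a measure"
  show "0 \<le> ipm \<Phi> \<mu> \<nu>" by (rule ipm_nonneg)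
  show "ipm \<Phi> \<mu> \<nu> = ipm \<Phi> \<nu> \<mu>" by (rule ipm_commute)
  assume 1: "\<mu> \<in> moment_measures 1" "\<nu> \<in> moment_measures 1"
  show "ipm \<Phi> \<mu> \<nu> = 0 \<longleftrightarrow> \<mu> = \<nu>"
  proof
    assume "ipm \<Phi> \<mu> \<nu> = 0"
    then show "\<mu> = \<nu>"
      using ipm_upper[OF 1] by (intro admissible_separates[OF assms 1]) force
  next
    assume "\<mu> = \<nu>"
    then show "ipm \<Phi> \<mu> \<nu> = 0"
      using 1 ipm_least[of \<mu> \<nu> 0] ipm_nonneg[of \<mu> \<nu>] by auto
  qed
  assume "\<rho> \<in> moment_measures 1"
  with 1 show "ipm \<Phi> \<mu> \<rho> \<le> ipm \<Phi> \<mu> \<nu> + ipm \<Phi> \<nu> \<rho>" by (rule ipm_triangle)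
qed

section \<open>Wasserstein distances\<close>

lemma wasserstein_1: "wasserstein 1 \<mu> \<nu> = (INF \<pi>\<in>couplings \<mu> \<nu>. \<integral>\<^sup>+z. ennreal (norm (fst z - snd z)) \<partial>\<pi>)"
proof -
  have "ennreal (enn2real c) = c" if "c \<noteq> \<infinity>" for c
    using that by (simp add: less_top)
  then show ?thesis by (simp add: wasserstein_def Let_def)
qed

context lipschitz_class begin

lemma integral_diff_le_wasserstein:
  assumes \<mu>: "\<mu> \<in> moment_measures 1" and \<nu>: "\<nu> \<in> moment_measures 1" and f: "f \<in> \<Phi>"
  shows "ennreal \<bar>(\<integral>x. f x \<partial>\<mu>) - (\<integral>x. f x \<partial>\<nu>)\<bar> \<le> ennreal L * wasserstein 1 \<mu> \<nu>"
proof -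
  let ?d = "\<bar>(\<integral>x. f x \<partial>\<mu>) - (\<integral>x. f x \<partial>\<nu>)\<bar>"
  have *: "?d \<le> L * (\<integral>z. norm (fst z - snd z) \<partial>\<pi>)" if "\<pi> \<in> couplings \<mu> \<nu>" for \<pi>
  proof -
    have s[measurable_cong]: "sets \<pi> = sets (borel \<Otimes>\<^sub>M borel)"
      and d: "distr \<pi> borel fst = \<mu>" "distr \<pi> borel snd = \<nu>"
      using that unfolding couplings_def borel_prod by simp_all
    have "fst \<in> borel_measurable \<pi>" "snd \<in> borel_measurable \<pi>"
      by measurable
    from integral_diff_le[OF this, unfolded d, OF \<mu> \<nu> f] show ?thesis .
  qed
  show ?thesis
  proof (cases "L = 0")
    case True
    then have "f x = f 0" for x using lipschitz[OF f, of x 0] by simp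
    then have c: "f = (\<lambda>_. f 0)" by (rule ext)
    have "(\<integral>x. f x \<partial>\<eta>) = f 0" if "\<eta> \<in> moment_measures 1" for \<eta>
      using moment_measuresD(1)[OF that] arg_cong[OF c, of "integral\<^sup>L \<eta>"] by (simp add: prob_space.prob_space)
    from this[OF \<mu>] this[OF \<nu>] have "?d = 0" by simp
    then show ?thesis by simp
  next
    case False
    with L_nonneg have L: "0 < L" by simp
    have "ennreal (?d / L) \<le> wasserstein 1 \<mu> \<nu>"
      unfolding wasserstein_1
    proof (rule INF_greatest)
      fix \<pi> assume "\<pi> \<in> couplings \<mu> \<nu>"
      from *[OF this] L have "?d / L \<le> (\<integral>z. norm (fst z - snd z) \<partial>\<pi>)" by (simp add: field_simps)
      then have "ennreal (?d / L) \<le> ennreal (\<integral>z. norm (fst z - snd z) \<partial>\<pi>)" by (rule ennreal_leI)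
      also have "\<dots> \<le> (\<integral>\<^sup>+z. ennreal (norm (fst z - snd z)) \<partial>\<pi>)"
        using integral_norm_bound_ennreal[of \<pi> "\<lambda>z. norm (fst z - snd z)"]
        by (cases "integrable \<pi> (\<lambda>z. norm (fst z - snd z))") (auto simp: not_integrable_integral_eq)
      finally show "ennreal (?d / L) \<le> (\<integral>\<^sup>+z. ennreal (norm (fst z - snd z)) \<partial>\<pi>)" .
    qed
    then have "ennreal L * ennreal (?d / L) \<le> ennreal L * wasserstein 1 \<mu> \<nu>"
      by (rule mult_left_mono) simp
    then show ?thesis using L by (simp add: ennreal_mult[symmetric])
  qed
qed

lemma ipm_le_wasserstein:
  assumes \<mu>: "\<mu> \<in> moment_measures 1" and \<nu>: "\<nu> \<in> moment_measures 1"
  shows "ennreal (ipm \<Phi> \<mu> \<nu>) \<le> ennreal L * wasserstein 1 \<mu> \<nu>"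
proof (cases "ennreal L * wasserstein 1 \<mu> \<nu>")
  case (real r)
  have "ipm \<Phi> \<mu> \<nu> \<le> r"
    using integral_diff_le_wasserstein[OF \<mu> \<nu>] real by (intro ipm_least \<mu> \<nu>) simp
  then show ?thesis using real by simp
qed simp

end

lemma wasserstein_1_le_2:
  assumes \<mu>: "prob_space \<mu>"
  shows "wasserstein 1 \<mu> \<nu> \<le> wasserstein 2 \<mu> \<nu>"
proof -
  let ?c = "INF \<pi>\<in>couplings \<mu> \<nu>. \<integral>\<^sup>+z. ennreal (norm (fst z - snd z) ^ 2) \<partial>\<pi>"
  let ?w = "wasserstein 1 \<mu> \<nu>"
  have le: "?w\<^sup>2 \<le> ?c"
  proof (rule INF_greatest)
    fix \<pi> assume \<pi>: "\<pi> \<in> couplings \<mu> \<nu>"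
    then have s[measurable_cong]: "sets \<pi> = sets (borel \<Otimes>\<^sub>M borel)" and d: "distr \<pi> borel fst = \<mu>"
      unfolding couplings_def borel_prod by simp_all
    have "prob_space (distr \<pi> borel fst)" using \<mu> d by simp
    then interpret prob_space \<pi> by (rule prob_space_distrD[rotated]) simp
    let ?n = "\<lambda>z. norm (fst z - snd z)"
    show "?w\<^sup>2 \<le> (\<integral>\<^sup>+z. ennreal (?n z ^ 2) \<partial>\<pi>)"
    proof (cases "integrable \<pi> (\<lambda>z. ?n z ^ 2)")
      case True
      then have i: "integrable \<pi> ?n" by (rule square_integrable_imp_integrable[rotated]) simp
      have "0 \<le> variance ?n" by simp
      then have "(expectation ?n)\<^sup>2 \<le> expectation (\<lambda>z. ?n z ^ 2)"
        using variance_eq[OF i True] by simp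
      moreover have "?w \<le> ennreal (expectation ?n)"
        unfolding wasserstein_1 using \<pi> i by (intro INF_lower2[OF \<pi>]) (simp add: nn_integral_eq_integral)
      then have "?w\<^sup>2 \<le> (ennreal (expectation ?n))\<^sup>2" by (intro power_mono) auto
      ultimately show ?thesis
        using True by (simp add: nn_integral_eq_integral ennreal_power order_trans[OF _ ennreal_leI])
    next
      case False
      then have "(\<integral>\<^sup>+z. ennreal (?n z ^ 2) \<partial>\<pi>) = \<infinity>"
        by (subst (asm) integrable_iff_bounded) (auto simp: less_top[symmetric])
      then show ?thesis by simp
    qed
  qed
  show ?thesis
  proof (cases ?c)
    case (real c)
    then have "?w \<noteq> \<infinity>" using le by (auto simp: top_unique power_eq_top_ennreal)
    then obtain w where w: "?w = ennreal w" "0 \<le> w" by (cases ?w) auto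
    have "w\<^sup>2 \<le> c" using le real w by (simp add: ennreal_power)
    then have "w \<le> sqrt c" by (rule real_le_rsqrt)
    then show ?thesis using real w by (simp add: wasserstein_def[of 2] Let_def sqrt_def)
  next
    case top
    then show ?thesis by (simp add: wasserstein_def[of 2] Let_def)
  qed
qed

section \<open>Skorohod subsequences for bounded supports\<close>

text \<open>The wave has period 2, vanishes on \<open>[0, 1/3]\<close> and equals 1 on \<open>[2/3, 1]\<close>, so its value at
  \<open>3 ^ m * t\<close> reads off the \<open>m\<close>-th digit of a ternary expansion of \<open>t\<close> with digits 0 and 2. Schoenberg's
  curve distributes these digits over the binary expansions of the coordinates.\<close>

definition schoenberg_wave :: "real \<Rightarrow> real" where
  "schoenberg_wave t = max 0 (min 1 (1 / 2 - cos (pi * t)))"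

lemma schoenberg_wave_bounds: "0 \<le> schoenberg_wave t" "schoenberg_wave t \<le> 1"
  by (auto simp: schoenberg_wave_def)

lemma schoenberg_wave_periodic: "schoenberg_wave (2 * real n + t) = schoenberg_wave t"
proof -
  have "cos (pi * (2 * real n + t)) = cos (pi * t + real n * (2 * pi))"
    by (simp add: algebra_simps)
  also have "\<dots> = cos (pi * t)"
    by (induction n) (simp_all add: algebra_simps cos_add sin_add)
  finally show ?thesis by (simp add: schoenberg_wave_def)
qed

lemma schoenberg_wave_thirds:
  "0 \<le> t \<Longrightarrow> t \<le> 1 / 3 \<Longrightarrow> schoenberg_wave t = 0"
  "2 / 3 \<le> t \<Longrightarrow> t \<le> 1 \<Longrightarrow> schoenberg_wave t = 1"
proof -
  assume t: "0 \<le> t" "t \<le> 1 / 3"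
  have "cos (pi / 3) \<le> cos (pi * t)"
    using t by (intro cos_monotone_0_pi_le) auto
  then show "schoenberg_wave t = 0" by (simp add: schoenberg_wave_def cos_60)
next
  assume t: "2 / 3 \<le> t" "t \<le> 1"
  have "cos (pi * t) \<le> cos (pi * (2 / 3))"
    using t by (intro cos_monotone_0_pi_le) auto
  then show "schoenberg_wave t = 1"
    using cos_120 by (simp add: schoenberg_wave_def mult.commute)
qed

definition ternary :: "(nat \<Rightarrow> nat) \<Rightarrow> real" where
  "ternary a = (\<Sum>m. 2 * real (a m) * (1 / 3) ^ Suc m)"

lemma ternary_summable:
  assumes "\<And>m. a m \<le> 1"
  shows "summable (\<lambda>m. 2 * real (a m) * (1 / 3) ^ Suc m)"
proof (rule summable_comparison_test')
  show "summable (\<lambda>m. 2 * (1 / 3 :: real) ^ Suc m)"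
    by (intro summable_mult) (simp add: summable_geometric)
  show "norm (2 * real (a m) * (1 / 3) ^ Suc m) \<le> 2 * (1 / 3) ^ Suc m" for m
    using assms[of m] by (simp add: field_simps)
qed

lemma ternary_bounds:
  assumes "\<And>m. a m \<le> 1"
  shows "0 \<le> ternary a" "ternary a \<le> 1"
proof -
  show "0 \<le> ternary a"
    unfolding ternary_def by (intro suminf_nonneg ternary_summable assms) auto
  have s: "(\<lambda>m. 2 / 3 * (1 / 3 :: real) ^ m) sums (2 / 3 * (1 / (1 - 1 / 3)))"
    by (intro sums_mult geometric_sums) auto
  have "ternary a \<le> (\<Sum>m. 2 / 3 * (1 / 3 :: real) ^ m)"
    unfolding ternary_def
  proof (rule suminf_le)
    show "2 * real (a m) * (1 / 3) ^ Suc m \<le> 2 / 3 * (1 / 3) ^ m" for m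
      using assms[of m] by (simp add: field_simps)
    show "summable (\<lambda>m. 2 * real (a m) * (1 / 3) ^ Suc m)"
      by (intro ternary_summable assms)
  qed (use s in \<open>simp add: sums_iff\<close>)
  also have "\<dots> = 1" using s by (simp add: sums_iff)
  finally show "ternary a \<le> 1" .
qed

lemma ternary_shift:
  assumes "\<And>m. a m \<le> 1"
  shows "3 * ternary a = 2 * real (a 0) + ternary (a \<circ> Suc)"
proof -
  let ?f = "\<lambda>a m. 2 * real (a m) * (1 / 3 :: real) ^ Suc m"
  have "ternary a = (\<Sum>m. ?f a (Suc m)) + ?f a 0"
    unfolding ternary_def by (subst suminf_split_head[OF ternary_summable[OF assms]]) simp
  also have "(\<Sum>m. ?f a (Suc m)) = (\<Sum>m. 1 / 3 * ?f (a \<circ> Suc) m)"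
    by (intro suminf_cong) simp
  also have "\<dots> = 1 / 3 * ternary (a \<circ> Suc)"
    unfolding ternary_def using assms by (intro suminf_mult ternary_summable) auto
  finally show ?thesis by simp
qed

lemma schoenberg_wave_ternary:
  "(\<And>m. a m \<le> 1) \<Longrightarrow> schoenberg_wave (3 ^ m * ternary a) = real (a m)"
proof (induction m arbitrary: a)
  case 0
  have t: "ternary a = (2 * real (a 0) + ternary (a \<circ> Suc)) / 3"
    using ternary_shift[of a] 0 by simp
  have b: "0 \<le> ternary (a \<circ> Suc)" "ternary (a \<circ> Suc) \<le> 1"
    using ternary_bounds[of "a \<circ> Suc"] 0 by auto
  from 0[of 0] consider "a 0 = 0" | "a 0 = 1" by linarith
  then show ?case
    using b by cases (simp_all add: t schoenberg_wave_thirds field_simps)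
next
  case (Suc m)
  have "3 ^ Suc m * ternary a = 3 ^ m * (3 * ternary a)" by simp
  also have "\<dots> = 2 * real (3 ^ m * a 0) + 3 ^ m * ternary (a \<circ> Suc)"
    using ternary_shift[of a] Suc.prems by (simp add: algebra_simps)
  finally have "schoenberg_wave (3 ^ Suc m * ternary a) = schoenberg_wave (3 ^ m * ternary (a \<circ> Suc))"
    by (simp only: schoenberg_wave_periodic)
  also have "\<dots> = real ((a \<circ> Suc) m)" using Suc.prems by (intro Suc.IH) auto
  finally show ?case by simp
qed

lemma binary_expansion:
  fixes x :: real
  assumes "0 \<le> x" "x < 1"
  obtains d :: "nat \<Rightarrow> nat" where "\<And>k. d k \<le> 1" "(\<lambda>k. real (d k) * (1 / 2) ^ Suc k) sums x"
proof -
  define d where "d k = nat (\<lfloor>2 ^ Suc k * x\<rfloor> - 2 * \<lfloor>2 ^ k * x\<rfloor>)" for k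
  have *: "0 \<le> \<lfloor>2 ^ Suc k * x\<rfloor> - 2 * \<lfloor>2 ^ k * x\<rfloor> \<and> \<lfloor>2 ^ Suc k * x\<rfloor> - 2 * \<lfloor>2 ^ k * x\<rfloor> \<le> 1" for k
  proof -
    have "\<lfloor>2 * y\<rfloor> - 2 * \<lfloor>y\<rfloor> \<in> {0..1}" for y :: real
      by (simp add: le_floor_iff floor_le_iff) linarith
    from this[of "2 ^ k * x"] show ?thesis by (simp add: mult.assoc)
  qed
  define F where "F k = \<lfloor>2 ^ k * x\<rfloor> / 2 ^ k" for k
  have "F \<longlonglongrightarrow> x"
  proof (rule real_tendsto_sandwich)
    show "\<forall>\<^sub>F k in sequentially. x - (1 / 2) ^ k \<le> F k"
    proof (intro always_eventually allI)
      fix k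
      have "2 ^ k * x - 1 \<le> \<lfloor>2 ^ k * x\<rfloor>" by linarith
      then have "(2 ^ k * x - 1) / 2 ^ k \<le> F k" unfolding F_def by (rule divide_right_mono) simp
      then show "x - (1 / 2) ^ k \<le> F k" by (simp add: diff_divide_distrib power_one_over)
    qed
    show "\<forall>\<^sub>F k in sequentially. F k \<le> x"
      by (intro always_eventually allI) (simp add: F_def divide_le_eq mult.commute)
    show "(\<lambda>k. x - (1 / 2) ^ k) \<longlonglongrightarrow> x"
      using tendsto_diff[OF tendsto_const LIMSEQ_power_zero[of "1 / 2 :: real"], of x] by simp
  qed simp
  then have "(\<lambda>k. F (Suc k) - F k) sums (x - F 0)" by (rule telescope_sums)
  moreover have "F 0 = 0" using assms by (simp add: F_def floor_eq_iff)
  moreover have "F (Suc k) - F k = real (d k) * (1 / 2) ^ Suc k" for k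
  proof -
    have "real (d k) = of_int (\<lfloor>2 ^ Suc k * x\<rfloor> - 2 * \<lfloor>2 ^ k * x\<rfloor>)"
      unfolding d_def using *[of k] by (intro of_nat_nat) auto
    then show ?thesis by (simp add: F_def field_simps)
  qed
  moreover have "d k \<le> 1" for k using *[of k] unfolding d_def by linarith
  ultimately show ?thesis using that[of d] by simp
qed

definition schoenberg :: "nat \<Rightarrow> real \<Rightarrow> real" where
  "schoenberg j t = (\<Sum>k. schoenberg_wave (3 ^ prod_encode (j, k) * t) * (1 / 2) ^ Suc k)"

lemma half_powers_sums: "(\<lambda>k. (1 / 2 :: real) ^ Suc k) sums 1"
  using power_half_series by (simp add: power_Suc)

lemma schoenberg_bounds: "0 \<le> schoenberg j t" "schoenberg j t \<le> 1"
proof -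
  have le: "schoenberg_wave s * (1 / 2) ^ Suc k \<le> (1 / 2) ^ Suc k" for s k
    by (rule mult_left_le_one_le) (simp_all add: schoenberg_wave_bounds)
  have s: "summable (\<lambda>k. schoenberg_wave (3 ^ prod_encode (j, k) * t) * (1 / 2) ^ Suc k)"
  proof (rule summable_comparison_test')
    show "summable (\<lambda>k. (1 / 2 :: real) ^ Suc k)" using half_powers_sums by (rule sums_summable)
    show "norm (schoenberg_wave (3 ^ prod_encode (j, k) * t) * (1 / 2) ^ Suc k) \<le> (1 / 2) ^ Suc k" for k
      using le[of "3 ^ prod_encode (j, k) * t" k] schoenberg_wave_bounds(1)[of "3 ^ prod_encode (j, k) * t"]
      unfolding real_norm_def abs_mult by simp
  qed
  show "0 \<le> schoenberg j t"
    unfolding schoenberg_def using schoenberg_wave_bounds(1) by (intro suminf_nonneg s) simp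
  have "schoenberg j t \<le> (\<Sum>k. (1 / 2 :: real) ^ Suc k)"
    unfolding schoenberg_def using half_powers_sums le s by (intro suminf_le) (auto simp: sums_iff)
  then show "schoenberg j t \<le> 1" using half_powers_sums by (simp add: sums_iff)
qed

lemma continuous_on_schoenberg: "continuous_on UNIV (schoenberg j)"
proof -
  have "uniform_limit UNIV (\<lambda>n t. \<Sum>k<n. schoenberg_wave (3 ^ prod_encode (j, k) * t) * (1 / 2) ^ Suc k)
      (\<lambda>t. \<Sum>k. schoenberg_wave (3 ^ prod_encode (j, k) * t) * (1 / 2) ^ Suc k) sequentially"
    using half_powers_sums schoenberg_wave_bounds
    by (intro Weierstrass_m_test[where M = "\<lambda>k. (1 / 2) ^ Suc k"])
       (auto simp: sums_iff abs_mult intro!: mult_left_le_one_le)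
  then show ?thesis
    unfolding schoenberg_def[abs_def]
    by (rule uniform_limit_theorem[rotated])
       (auto simp: schoenberg_wave_def intro!: always_eventually continuous_intros)
qed

lemma schoenberg_surj:
  assumes "\<And>j. 0 \<le> x j" "\<And>j. x j < (1 :: real)"
  obtains t where "0 \<le> t" "t \<le> 1" "\<And>j. schoenberg j t = x j"
proof -
  have "\<exists>d :: nat \<Rightarrow> nat. (\<forall>k. d k \<le> 1) \<and> (\<lambda>k. real (d k) * (1 / 2) ^ Suc k) sums x j" for j
    using binary_expansion[OF assms(1,2)[of j]] by metis
  then obtain d :: "nat \<Rightarrow> nat \<Rightarrow> nat"
    where d: "\<And>j k. d j k \<le> 1" "\<And>j. (\<lambda>k. real (d j k) * (1 / 2) ^ Suc k) sums x j"
    by metis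
  define a where "a m = (case prod_decode m of (j, k) \<Rightarrow> d j k)" for m
  have a: "a m \<le> 1" for m unfolding a_def using d(1) by (auto split: prod.split)
  have "schoenberg j (ternary a) = x j" for j
    using d(2)[of j] by (simp add: schoenberg_def schoenberg_wave_ternary[OF a] sums_iff) (simp add: a_def)
  with ternary_bounds[of a] a show ?thesis using that by blast
qed

lemma continuous_bounded_covering_curve:
  obtains \<psi> :: "real \<Rightarrow> 'a::euclidean_space"
  where "continuous_on UNIV \<psi>" "bounded (range \<psi>)" "cball 0 R \<subseteq> \<psi> ` {0..1}"
proof -
  define S where "S = \<bar>R\<bar> + 1"
  define \<psi> :: "real \<Rightarrow> 'a"
    where "\<psi> t = (\<Sum>b\<in>Basis. (2 * S * schoenberg (to_nat_on Basis b) t - S) *\<^sub>R b)" for t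
  have S: "0 < S" by (simp add: S_def)
  have "continuous_on UNIV \<psi>"
    unfolding \<psi>_def
    by (intro continuous_intros continuous_on_compose2[OF continuous_on_schoenberg]) auto
  moreover have "bounded (range \<psi>)"
  proof (rule boundedI)
    fix y assume "y \<in> range \<psi>"
    then obtain t where y: "y = \<psi> t" by auto
    have "norm (\<psi> t) \<le> (\<Sum>b\<in>(Basis::'a set). S)"
      unfolding \<psi>_def
    proof (rule sum_norm_le)
      fix b :: 'a assume "b \<in> Basis"
      have "0 \<le> S * schoenberg (to_nat_on Basis b) t" "S * schoenberg (to_nat_on Basis b) t \<le> S"
        using S schoenberg_bounds by (auto intro: mult_left_le)
      then show "norm ((2 * S * schoenberg (to_nat_on Basis b) t - S) *\<^sub>R b) \<le> S"
        using \<open>b \<in> Basis\<close> by (auto simp: abs_le_iff)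
    qed
    then show "norm y \<le> (\<Sum>b\<in>(Basis::'a set). S)" using y by simp
  qed
  moreover have "cball 0 R \<subseteq> \<psi> ` {0..1}"
  proof
    fix y :: 'a assume y: "y \<in> cball 0 R"
    define x where "x j = (if j \<in> to_nat_on Basis ` (Basis :: 'a set)
      then ((y \<bullet> from_nat_into Basis j) + S) / (2 * S) else 0)" for j
    have nb: "\<bar>y \<bullet> b\<bar> < S" if "b \<in> Basis" for b
      using Basis_le_norm[OF that, of y] y by (simp add: S_def)
    have fn: "from_nat_into Basis (to_nat_on Basis b) = b" if "b \<in> Basis" for b :: 'a
      using that by (simp add: countable_finite)
    have x: "0 \<le> x j" "x j < 1" for j
      using S nb fn by (auto simp: x_def field_simps abs_less_iff) (smt (verit))+
    obtain t where t: "0 \<le> t" "t \<le> 1" "\<And>j. schoenberg j t = x j"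
      using schoenberg_surj[of x] x by blast
    have "\<psi> t = (\<Sum>b\<in>Basis. (y \<bullet> b) *\<^sub>R b)"
      unfolding \<psi>_def t using S fn by (intro sum.cong) (auto simp: x_def)
    then have "\<psi> t = y" by (simp add: euclidean_representation)
    with t show "y \<in> \<psi> ` {0..1}" by force
  qed
  ultimately show ?thesis using that by blast
qed

lemma borel_right_inverse:
  fixes \<psi> :: "real \<Rightarrow> 'a::euclidean_space"
  assumes \<psi>: "continuous_on UNIV \<psi>"
  obtains \<phi> where "\<phi> \<in> borel_measurable borel" "\<And>x. \<phi> x \<in> {0..1}"
    "\<And>x. x \<in> \<psi> ` {0..1} \<Longrightarrow> \<psi> (\<phi> x) = x"
proof -
  define T where "T x = insert 1 {t \<in> {0..1}. \<psi> t = x}" for x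
  define \<phi> where "\<phi> x = Inf (T x)" for x
  have "closed {t. \<psi> t = x}" for x
    using \<psi> by (intro closed_Collect_eq) (auto intro: continuous_intros)
  then have "compact ({0..1} \<inter> {t. \<psi> t = x})" for x by (intro compact_Int_closed) auto
  moreover have "T x = insert 1 ({0..1} \<inter> {t. \<psi> t = x})" for x by (auto simp: T_def)
  ultimately have c: "compact (T x)" for x by simp
  have ne: "T x \<noteq> {}" and bb: "bdd_below (T x)" for x by (auto simp: T_def intro!: bdd_belowI[of _ 0])
  have in_T: "\<phi> x \<in> T x" for x
    unfolding \<phi>_def using c by (intro closed_contains_Inf ne bb compact_imp_closed)
  have lower: "\<phi> x \<le> t" if "t \<in> T x" for x t
    unfolding \<phi>_def using that by (intro cInf_lower bb)
  show ?thesis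
  proof
    show "\<phi> x \<in> {0..1}" for x using in_T[of x] by (auto simp: T_def)
    show "\<psi> (\<phi> x) = x" if x: "x \<in> \<psi> ` {0..1}" for x
    proof -
      obtain t where t: "t \<in> {0..1}" "\<psi> t = x" using x by auto
      have "\<phi> x \<le> t" using t by (intro lower) (auto simp: T_def)
      then have "\<phi> x = 1 \<Longrightarrow> t = 1" using t by simp
      moreover have "\<phi> x = 1 \<or> \<psi> (\<phi> x) = x" using in_T[of x] unfolding T_def by blast
      ultimately show ?thesis using t(2) by metis
    qed
    show "\<phi> \<in> borel_measurable borel"
    proof (rule borel_measurableI_le)
      fix a :: real
      have "{x. \<phi> x \<le> a} = (if 1 \<le> a then UNIV else \<psi> ` {0..a})"
      proof (cases "1 \<le> a")
        case True
        have "\<phi> x \<le> a" for x using lower[of 1 x] True by (auto simp: T_def)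
        then show ?thesis using True by auto
      next
        case False
        have "x \<in> \<psi> ` {0..a}" if "\<phi> x \<le> a" for x
          using in_T[of x] that False by (auto simp: T_def intro!: image_eqI[of _ _ "\<phi> x"])
        moreover have "\<phi> (\<psi> t) \<le> a" if "t \<in> {0..a}" for t
          using lower[of t "\<psi> t"] that False by (auto simp: T_def)
        ultimately show ?thesis using False by auto
      qed
      moreover have "closed (\<psi> ` {0..a})"
        using \<psi> by (intro compact_imp_closed compact_continuous_image) (auto intro: continuous_on_subset)
      ultimately show "{x \<in> space borel. \<phi> x \<le> a} \<in> sets borel" by auto
    qed
  qed
qed

text \<open>Parametrising a ball by a space-filling curve reduces Prokhorov's theorem for uniformly
  bounded supports to Helly's selection theorem on the line, and Skorohod's theorem then supplies
  an almost surely convergent representation.\<close>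

lemma bounded_support_Skorohod_subsequence:
  fixes \<mu> :: "nat \<Rightarrow> 'a::euclidean_space measure"
  assumes p: "\<And>i. prob_space (\<mu> i)" and s: "\<And>i. sets (\<mu> i) = sets borel"
    and R: "\<And>i. AE x in \<mu> i. norm x \<le> R"
  obtains r :: "nat \<Rightarrow> nat" and \<Omega> :: "real measure" and Z :: "nat \<Rightarrow> real \<Rightarrow> 'a" and Y B
  where "strict_mono r" "prob_space \<Omega>" "\<And>i. Z i \<in> borel_measurable \<Omega>" "Y \<in> borel_measurable \<Omega>"
    "\<And>i. distr \<Omega> borel (Z i) = \<mu> (r i)" "\<And>\<omega>. \<omega> \<in> space \<Omega> \<Longrightarrow> (\<lambda>i. Z i \<omega>) \<longlonglongrightarrow> Y \<omega>"
    "\<And>i \<omega>. norm (Z i \<omega>) \<le> B" "\<And>\<omega>. norm (Y \<omega>) \<le> B"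
proof -
  note [measurable_cong] = s
  obtain \<psi> :: "real \<Rightarrow> 'a" where \<psi>: "continuous_on UNIV \<psi>" "bounded (range \<psi>)" "cball 0 R \<subseteq> \<psi> ` {0..1}"
    using continuous_bounded_covering_curve by blast
  obtain \<phi> where \<phi>: "\<phi> \<in> borel_measurable borel" "\<And>x. \<phi> x \<in> {0..1}"
    "\<And>x. x \<in> \<psi> ` {0..1} \<Longrightarrow> \<psi> (\<phi> x) = x"
    using borel_right_inverse[OF \<psi>(1)] by blast
  obtain B where B: "\<And>t. norm (\<psi> t) \<le> B" using \<psi>(2) by (auto simp: bounded_iff)
  have \<psi>_m [measurable]: "\<psi> \<in> borel_measurable borel"
    using \<psi>(1) by (rule borel_measurable_continuous_onI)
  note [measurable] = \<phi>(1)
  define P where "P i = distr (\<mu> i) borel \<phi>" for i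
  have P: "real_distribution (P i)" for i
    unfolding P_def real_distribution_def real_distribution_axioms_def
    by (auto intro!: prob_space.prob_space_distr p)
  have "tight P"
    unfolding tight_def
  proof (intro conjI allI impI)
    fix \<epsilon> :: real assume \<epsilon>: "0 < \<epsilon>"
    have "measure (P i) {-1<..1} = 1" for i
    proof -
      interpret prob_space "\<mu> i" by (rule p)
      have "\<phi> -` {-1<..1} \<inter> space (\<mu> i) = space (\<mu> i)"
        using \<phi>(2) by (force simp: less_le_trans[of "-1" 0])
      then show ?thesis by (simp add: P_def measure_distr prob_space)
    qed
    then show "\<exists>a b. a < b \<and> (\<forall>i. 1 - \<epsilon> < measure (P i) {a<..b})"
      using \<epsilon> by (intro exI[of _ "-1"] exI[of _ 1]) auto
  qed (rule P)
  from tight_imp_convergent_subsubsequence[OF this strict_mono_id]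
  obtain r Q where r: "strict_mono r" and Q: "real_distribution Q" "weak_conv_m (\<lambda>i. P (r i)) Q"
    by (auto simp: comp_def)
  obtain \<Omega> :: "real measure" and Y_seq Y where \<Omega>: "prob_space \<Omega>"
    and [measurable]: "\<And>n. Y_seq n \<in> borel_measurable \<Omega>" "Y \<in> borel_measurable \<Omega>"
    and d: "\<And>n. distr \<Omega> borel (Y_seq n) = P (r n)"
    and conv: "\<And>x. x \<in> space \<Omega> \<Longrightarrow> (\<lambda>n. Y_seq n x) \<longlonglongrightarrow> Y x"
    using Skorohod[OF P Q] unfolding measurable_lborel1 by blast
  show ?thesis
  proof (rule that[of r \<Omega> "\<lambda>i \<omega>. \<psi> (Y_seq i \<omega>)" "\<lambda>\<omega>. \<psi> (Y \<omega>)" B])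
    show "distr \<Omega> borel (\<lambda>\<omega>. \<psi> (Y_seq i \<omega>)) = \<mu> (r i)" for i
    proof -
      have "distr \<Omega> borel (\<lambda>\<omega>. \<psi> (Y_seq i \<omega>)) = distr (distr \<Omega> borel (Y_seq i)) borel \<psi>"
        by (simp add: distr_distr comp_def)
      also have "\<dots> = distr (\<mu> (r i)) borel (\<lambda>x. \<psi> (\<phi> x))"
        unfolding d P_def by (simp add: distr_distr comp_def)
      also have "\<dots> = distr (\<mu> (r i)) borel (\<lambda>x. x)"
        using R[of "r i"] \<psi>(3) \<phi>(3) by (intro distr_cong_AE) (auto elim!: eventually_mono)
      also have "\<dots> = \<mu> (r i)"
        using distr_id2[OF s[symmetric]] by simp
      finally show ?thesis .
    qed
    show "(\<lambda>i. \<psi> (Y_seq i \<omega>)) \<longlonglongrightarrow> \<psi> (Y \<omega>)" if "\<omega> \<in> space \<Omega>" for \<omega>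
      using conv[OF that] \<psi>(1)
      by (intro isCont_tendsto_compose[of _ \<psi>]) (auto simp: continuous_on_eq_continuous_at)
  qed (use r \<Omega> B in auto)
qed

section \<open>Weak convergence\<close>

lemma integral_bounded_continuous_determines:
  fixes \<mu> \<nu> :: "'a::euclidean_space measure"
  assumes \<mu>: "\<mu> \<in> prob_measures" and \<nu>: "\<nu> \<in> prob_measures"
    and eq: "\<And>f :: 'a \<Rightarrow> real. continuous_on UNIV f \<Longrightarrow> bounded (range f) \<Longrightarrow> (\<integral>x. f x \<partial>\<mu>) = (\<integral>x. f x \<partial>\<nu>)"
  shows "\<mu> = \<nu>"
proof -
  have closed_eq: "measure \<mu> C = measure \<nu> C" if C: "closed C" for C
  proof (cases "C = {}")
    case False
    define f where "f n x = max 0 (1 - real n * infdist x C)" for n :: nat and x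
    have f01: "0 \<le> f n x" "f n x \<le> 1" for n x
      using infdist_nonneg[of x C] by (auto simp: f_def)
    have f_cont: "continuous_on UNIV (f n)" for n
      unfolding f_def by (intro continuous_intros)
    have f_lim: "(\<lambda>n. f n x) \<longlonglongrightarrow> indicator C x" for x
    proof (cases "x \<in> C")
      case True
      then show ?thesis by (simp add: f_def)
    next
      case False
      then have "0 < infdist x C"
        using C \<open>C \<noteq> {}\<close> in_closed_iff_infdist_zero[of C x] infdist_nonneg[of x C] by linarith
      then obtain N where N: "1 < real N * infdist x C" using ex_less_of_nat_mult by blast
      have "f n x = indicator C x" if "N \<le> n" for n
      proof -
        have "1 < real n * infdist x C"
          using N mult_right_mono[of "real N" "real n" "infdist x C"] that infdist_nonneg[of x C] by simp
        then show ?thesis using False by (simp add: f_def)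
      qed
      then show ?thesis by (intro tendsto_eventually eventually_sequentiallyI)
    qed
    have lim: "(\<lambda>n. \<integral>x. f n x \<partial>\<eta>) \<longlonglongrightarrow> measure \<eta> C" if \<eta>: "\<eta> \<in> prob_measures" for \<eta>
    proof -
      have s[measurable_cong]: "sets \<eta> = sets borel" using \<eta> by (simp add: prob_measures_def)
      interpret prob_space \<eta> using \<eta> by (simp add: prob_measures_def)
      have [measurable]: "f n \<in> borel_measurable borel" "C \<in> sets borel" for n
        using f_cont C by (auto intro: borel_measurable_continuous_onI)
      have "(\<lambda>n. \<integral>x. f n x \<partial>\<eta>) \<longlonglongrightarrow> (\<integral>x. indicator C x \<partial>\<eta>)"
        using f_lim f01 by (intro integral_dominated_convergence[where w = "\<lambda>_. 1"]) auto
      then show ?thesis using C s by simp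
    qed
    have "bounded (range (f n))" for n using f01 by (intro boundedI[of _ 1]) auto
    then show ?thesis
      using lim[OF \<mu>] lim[OF \<nu>] eq[OF f_cont] LIMSEQ_unique by force
  qed simp
  have s: "sets \<mu> = sigma_sets UNIV (Collect closed)" "sets \<nu> = sigma_sets UNIV (Collect closed)"
    using \<mu> \<nu> by (simp_all add: prob_measures_def borel_eq_closed)
  interpret \<mu>: prob_space \<mu> using \<mu> by (simp add: prob_measures_def)
  interpret \<nu>: prob_space \<nu> using \<nu> by (simp add: prob_measures_def)
  show ?thesis
  proof (rule measure_eqI_generator_eq[OF _ _ _ s, of "\<lambda>_. UNIV"])
    show "Int_stable (Collect (closed :: 'a set \<Rightarrow> bool))" by (auto simp: Int_stable_def)
    show "emeasure \<mu> C = emeasure \<nu> C" if "C \<in> Collect closed" for C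
      using closed_eq that by (simp add: \<mu>.emeasure_eq_measure \<nu>.emeasure_eq_measure)
  qed auto
qed

lemma weakly_converges_subseq:
  assumes "weakly_converges \<mu>s \<mu>" "strict_mono r"
  shows "weakly_converges (\<lambda>i. \<mu>s (r i)) \<mu>"
  using assms LIMSEQ_subseq_LIMSEQ[OF _ assms(2)] unfolding weakly_converges_def comp_def by blast

lemma weakly_converges_unique:
  assumes "weakly_converges \<mu>s \<mu>" "weakly_converges \<mu>s \<nu>" "\<mu> \<in> prob_measures" "\<nu> \<in> prob_measures"
  shows "\<mu> = \<nu>"
  using assms LIMSEQ_unique unfolding weakly_converges_def
  by (intro integral_bounded_continuous_determines) blast+

lemma (in lipschitz_class) bounded_support_subsequence:
  fixes \<mu> :: "nat \<Rightarrow> 'a measure"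
  assumes \<mu>: "\<And>i. \<mu> i \<in> prob_measures" and R: "\<And>i. AE x in \<mu> i. norm x \<le> R"
  obtains r :: "nat \<Rightarrow> nat" and \<nu> where "strict_mono r" "\<nu> \<in> prob_measures" "\<nu> \<in> moment_measures 1"
    "weakly_converges (\<lambda>i. \<mu> (r i)) \<nu>" "(\<lambda>i. ipm \<Phi> (\<mu> (r i)) \<nu>) \<longlonglongrightarrow> 0"
proof -
  have p: "prob_space (\<mu> i)" "sets (\<mu> i) = sets borel" for i
    using \<mu> by (auto simp: prob_measures_def)
  obtain r :: "nat \<Rightarrow> nat" and \<Omega> :: "real measure" and Z :: "nat \<Rightarrow> real \<Rightarrow> 'a" and Y B
    where r: "strict_mono r" and \<Omega>: "prob_space \<Omega>"
      and Z [measurable]: "\<And>i. Z i \<in> borel_measurable \<Omega>" and Y [measurable]: "Y \<in> borel_measurable \<Omega>"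
      and d: "\<And>i. distr \<Omega> borel (Z i) = \<mu> (r i)"
      and lim: "\<And>\<omega>. \<omega> \<in> space \<Omega> \<Longrightarrow> (\<lambda>i. Z i \<omega>) \<longlonglongrightarrow> Y \<omega>"
      and B: "\<And>i \<omega>. norm (Z i \<omega>) \<le> B" "\<And>\<omega>. norm (Y \<omega>) \<le> B"
    by (rule bounded_support_Skorohod_subsequence[OF p R]) (rule that; assumption)
  interpret \<Omega>: prob_space \<Omega> by (rule \<Omega>)
  define \<nu> where "\<nu> = distr \<Omega> borel Y"
  have \<nu>: "prob_space \<nu>" "sets \<nu> = sets borel" unfolding \<nu>_def by (auto intro: \<Omega>.prob_space_distr)
  have \<nu>1: "\<nu> \<in> moment_measures 1"
  proof (rule bounded_support_moment_measures[OF \<nu>, of B])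
    show "AE x in \<nu>. norm x \<le> B" unfolding \<nu>_def using B(2) by (subst AE_distr_iff) auto
  qed
  have \<mu>1: "\<mu> i \<in> moment_measures 1" for i
    by (rule bounded_support_moment_measures[OF p R])
  have "weakly_converges (\<lambda>i. \<mu> (r i)) \<nu>"
    unfolding weakly_converges_def
  proof (intro allI impI)
    fix f :: "'a \<Rightarrow> real" assume f: "continuous_on UNIV f" "bounded (range f)"
    have [measurable]: "f \<in> borel_measurable borel" using f(1) by (rule borel_measurable_continuous_onI)
    obtain b where b: "\<And>x. norm (f x) \<le> b" using f(2) by (auto simp: bounded_iff)
    have "(\<lambda>i. \<integral>\<omega>. f (Z i \<omega>) \<partial>\<Omega>) \<longlonglongrightarrow> (\<integral>\<omega>. f (Y \<omega>) \<partial>\<Omega>)"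
    proof (rule integral_dominated_convergence[where w = "\<lambda>_. b"])
      show "AE \<omega> in \<Omega>. (\<lambda>i. f (Z i \<omega>)) \<longlonglongrightarrow> f (Y \<omega>)"
        using lim f(1) by (intro AE_I2 isCont_tendsto_compose[of _ f]) (auto simp: continuous_on_eq_continuous_at)
    qed (use b in auto)
    then show "(\<lambda>i. \<integral>x. f x \<partial>\<mu> (r i)) \<longlonglongrightarrow> (\<integral>x. f x \<partial>\<nu>)"
      by (simp add: \<nu>_def d[symmetric] integral_distr)
  qed
  moreover have "(\<lambda>i. ipm \<Phi> (\<mu> (r i)) \<nu>) \<longlonglongrightarrow> 0"
  proof (rule real_tendsto_sandwich[OF _ _ tendsto_const])
    have "(\<lambda>i. \<integral>\<omega>. norm (Z i \<omega> - Y \<omega>) \<partial>\<Omega>) \<longlonglongrightarrow> (\<integral>\<omega>. 0 \<partial>\<Omega>)"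
    proof (rule integral_dominated_convergence[where w = "\<lambda>_. 2 * B"])
      show "AE \<omega> in \<Omega>. (\<lambda>i. norm (Z i \<omega> - Y \<omega>)) \<longlonglongrightarrow> 0"
        using lim by (intro AE_I2 tendsto_norm_zero) (simp add: LIM_zero)
      show "AE \<omega> in \<Omega>. norm (norm (Z i \<omega> - Y \<omega>)) \<le> 2 * B" for i
      proof (rule AE_I2)
        show "norm (norm (Z i \<omega> - Y \<omega>)) \<le> 2 * B" for \<omega>
          using norm_triangle_ineq4[of "Z i \<omega>" "Y \<omega>"] B(1)[of i \<omega>] B(2)[of \<omega>] by simp
      qed
    qed auto
    then show "(\<lambda>i. L * (\<integral>\<omega>. norm (Z i \<omega> - Y \<omega>) \<partial>\<Omega>)) \<longlonglongrightarrow> 0"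
      by (auto intro: tendsto_mult_right_zero)
    show "\<forall>\<^sub>F i in sequentially. ipm \<Phi> (\<mu> (r i)) \<nu> \<le> L * (\<integral>\<omega>. norm (Z i \<omega> - Y \<omega>) \<partial>\<Omega>)"
      using ipm_distr_le[OF Z Y] \<mu>1 \<nu>1 unfolding d \<nu>_def by (intro always_eventually allI) blast
  qed (auto simp: ipm_nonneg)
  ultimately show ?thesis
    using that[OF r _ \<nu>1] \<nu> by (simp add: prob_measures_def)
qed

lemma weakly_converges_iff_ipm:
  fixes \<mu>s :: "nat \<Rightarrow> 'a::euclidean_space measure"
  assumes \<Phi>: "admissible_test_class \<Phi> A1 A2 A3" and K: "compact K"
    and \<mu>: "\<mu> \<in> prob_measures" "measure \<mu> K = 1"
    and \<mu>s: "\<And>i. \<mu>s i \<in> prob_measures" "\<And>i. measure (\<mu>s i) K = 1"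
  shows "weakly_converges \<mu>s \<mu> \<longleftrightarrow> (\<lambda>i. ipm \<Phi> (\<mu>s i) \<mu>) \<longlonglongrightarrow> 0"
proof -
  interpret lipschitz_class \<Phi> A1 A2 by (rule admissible_imp_lipschitz_class[OF \<Phi>])
  interpret ipm: Metric_space "moment_measures 1" "ipm \<Phi>" by (rule Metric_space_ipm[OF \<Phi>])
  obtain R where R: "K \<subseteq> cball 0 R" using compact_imp_bounded[OF K] by (auto simp: bounded_iff subset_iff)
  have AE_R: "AE x in \<eta>. norm x \<le> R" if \<eta>: "\<eta> \<in> prob_measures" "measure \<eta> K = 1" for \<eta>
  proof -
    interpret prob_space \<eta> using \<eta> by (simp add: prob_measures_def)
    have "AE x in \<eta>. x \<in> K"
      using \<eta> prob_eq_1[of K] compact_imp_closed[OF K] by (simp add: prob_measures_def)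
    then show ?thesis using R by (auto elim!: eventually_mono)
  qed
  have m1: "\<eta> \<in> moment_measures 1" if "\<eta> \<in> prob_measures" "measure \<eta> K = 1" for \<eta>
    using that AE_R[OF that] by (intro bounded_support_moment_measures) (auto simp: prob_measures_def)
  show ?thesis
  proof
    assume w: "weakly_converges \<mu>s \<mu>"
    show "(\<lambda>i. ipm \<Phi> (\<mu>s i) \<mu>) \<longlonglongrightarrow> 0"
    proof (rule ccontr)
      assume "\<not> (\<lambda>i. ipm \<Phi> (\<mu>s i) \<mu>) \<longlonglongrightarrow> 0"
      then obtain e where e: "0 < e" "\<not> (\<forall>\<^sub>F i in sequentially. dist (ipm \<Phi> (\<mu>s i) \<mu>) 0 < e)"
        unfolding tendsto_iff by auto
      then obtain r :: "nat \<Rightarrow> nat" where r: "strict_mono r" "\<And>i. \<not> dist (ipm \<Phi> (\<mu>s (r i)) \<mu>) 0 < e"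
        using not_eventually_sequentiallyD by blast
      obtain s :: "nat \<Rightarrow> nat" and \<nu> where s: "strict_mono s" "\<nu> \<in> prob_measures"
        "weakly_converges (\<lambda>i. \<mu>s (r (s i))) \<nu>" "(\<lambda>i. ipm \<Phi> (\<mu>s (r (s i))) \<nu>) \<longlonglongrightarrow> 0"
        by (rule bounded_support_subsequence[of "\<lambda>i. \<mu>s (r i)" R, OF \<mu>s(1) AE_R[OF \<mu>s]]) (rule that; assumption)
      have "weakly_converges (\<lambda>i. \<mu>s (r (s i))) \<mu>"
        using weakly_converges_subseq[OF weakly_converges_subseq[OF w r(1)] s(1)] .
      then have "\<nu> = \<mu>" using s \<mu> by (intro weakly_converges_unique[OF s(3)]) auto
      then have "\<forall>\<^sub>F i in sequentially. dist (ipm \<Phi> (\<mu>s (r (s i))) \<mu>) 0 < e"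
        using tendstoD[OF s(4) e(1)] by simp
      then show False using r(2) by (auto simp: eventually_sequentially)
    qed
  next
    assume c: "(\<lambda>i. ipm \<Phi> (\<mu>s i) \<mu>) \<longlonglongrightarrow> 0"
    show "weakly_converges \<mu>s \<mu>"
      unfolding weakly_converges_def
    proof (intro allI impI, rule ccontr)
      fix f :: "'a \<Rightarrow> real" assume f: "continuous_on UNIV f" "bounded (range f)"
      assume "\<not> (\<lambda>i. \<integral>x. f x \<partial>\<mu>s i) \<longlonglongrightarrow> (\<integral>x. f x \<partial>\<mu>)"
      then obtain e where e: "0 < e" "\<not> (\<forall>\<^sub>F i in sequentially. dist (\<integral>x. f x \<partial>\<mu>s i) (\<integral>x. f x \<partial>\<mu>) < e)"
        unfolding tendsto_iff by auto
      then obtain r :: "nat \<Rightarrow> nat" where r: "strict_mono r"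
        "\<And>i. \<not> dist (\<integral>x. f x \<partial>\<mu>s (r i)) (\<integral>x. f x \<partial>\<mu>) < e"
        using not_eventually_sequentiallyD by blast
      obtain s :: "nat \<Rightarrow> nat" and \<nu> where s: "strict_mono s" "\<nu> \<in> moment_measures 1"
        "weakly_converges (\<lambda>i. \<mu>s (r (s i))) \<nu>" "(\<lambda>i. ipm \<Phi> (\<mu>s (r (s i))) \<nu>) \<longlonglongrightarrow> 0"
        by (rule bounded_support_subsequence[of "\<lambda>i. \<mu>s (r i)" R, OF \<mu>s(1) AE_R[OF \<mu>s]]) (rule that; assumption)
      have c': "(\<lambda>i. ipm \<Phi> (\<mu>s (r (s i))) \<mu>) \<longlonglongrightarrow> 0"
        using LIMSEQ_subseq_LIMSEQ[OF LIMSEQ_subseq_LIMSEQ[OF c r(1)] s(1)] by (simp add: comp_def)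
      have "ipm \<Phi> \<nu> \<mu> \<le> 0"
      proof (rule tendsto_lowerbound)
        show "(\<lambda>i. ipm \<Phi> (\<mu>s (r (s i))) \<nu> + ipm \<Phi> (\<mu>s (r (s i))) \<mu>) \<longlonglongrightarrow> 0"
          using tendsto_add[OF s(4) c'] by simp
        show "\<forall>\<^sub>F i in sequentially. ipm \<Phi> \<nu> \<mu> \<le> ipm \<Phi> (\<mu>s (r (s i))) \<nu> + ipm \<Phi> (\<mu>s (r (s i))) \<mu>"
          using ipm.triangle[OF s(2) m1[OF \<mu>s] m1[OF \<mu>]] ipm.commute by (intro always_eventually allI) metis
      qed simp
      then have "ipm \<Phi> \<nu> \<mu> = 0" using ipm_nonneg[of \<nu> \<mu>] by linarith
      then have "\<nu> = \<mu>" using ipm.zero[OF s(2) m1[OF \<mu>]] by simp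
      then have "\<forall>\<^sub>F i in sequentially. dist (\<integral>x. f x \<partial>\<mu>s (r (s i))) (\<integral>x. f x \<partial>\<mu>) < e"
        using tendstoD[OF s(3)[unfolded weakly_converges_def, rule_format, OF f] e(1)] by simp
      then show False using r(2) by (auto simp: eventually_sequentially)
    qed
  qed
qed

section \<open>Lipschitz functions of independent coordinates\<close>

definition coord_lipschitz :: "nat set \<Rightarrow> real \<Rightarrow> ((nat \<Rightarrow> 'a::euclidean_space) \<Rightarrow> real) \<Rightarrow> bool" where
  "coord_lipschitz I L H \<longleftrightarrow> (\<forall>x y. \<bar>H x - H y\<bar> \<le> L * (\<Sum>i\<in>I. norm (x i - y i)))"

lemma coord_lipschitzD: "coord_lipschitz I L H \<Longrightarrow> \<bar>H x - H y\<bar> \<le> L * (\<Sum>i\<in>I. norm (x i - y i))"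
  by (simp add: coord_lipschitz_def)

lemma measurable_PiM_of_borel:
  fixes H :: "(nat \<Rightarrow> 'a::euclidean_space) \<Rightarrow> 'b"
  assumes H: "H \<in> measurable borel N" and s: "sets \<mu> = sets (borel :: 'a measure)"
    and dep: "\<And>x y. (\<And>i. i \<in> I \<Longrightarrow> x i = y i) \<Longrightarrow> H x = H y"
  shows "H \<in> measurable (PiM I (\<lambda>_. \<mu>)) N"
proof -
  note [measurable_cong] = s
  let ?e = "\<lambda>x :: nat \<Rightarrow> 'a. (\<lambda>i. if i \<in> I then x i else 0)"
  have "?e \<in> measurable (PiM I (\<lambda>_. \<mu>)) (PiM UNIV (\<lambda>_. borel))"
  proof (rule measurable_PiM_single')
    show "(\<lambda>x. ?e x i) \<in> measurable (PiM I (\<lambda>_. \<mu>)) borel" for i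
      by (cases "i \<in> I") auto
  qed auto
  then have "?e \<in> measurable (PiM I (\<lambda>_. \<mu>)) borel"
    using measurable_cong_sets[OF refl sets_PiM_equal_borel] by blast
  from measurable_compose[OF this H] have "(\<lambda>x. H (?e x)) \<in> measurable (PiM I (\<lambda>_. \<mu>)) N" .
  also have "(\<lambda>x. H (?e x)) = H" by (intro ext dep) simp
  finally show ?thesis .
qed

lemma coord_lipschitz_continuous:
  assumes H: "coord_lipschitz I L H"
  shows "continuous_on UNIV H"
  unfolding continuous_on_eq_continuous_at[OF open_UNIV]
proof
  fix x :: "nat \<Rightarrow> 'a"
  let ?g = "\<lambda>y. L * (\<Sum>i\<in>I. norm (y i - x i))"
  have "continuous_on UNIV ?g"
    by (intro continuous_intros continuous_on_product_coordinates)
  then have "isCont ?g x" by (simp add: continuous_on_eq_continuous_at)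
  then have "?g \<midarrow>x\<rightarrow> 0" by (simp add: isCont_def)
  then have "(\<lambda>y. H y - H x) \<midarrow>x\<rightarrow> 0"
    by (rule Lim_null_comparison[rotated]) (simp add: coord_lipschitzD[OF H] eventuallyI)
  then show "isCont H x" by (simp add: isCont_def LIM_zero_iff)
qed

lemma measurable_coord_lipschitz:
  assumes H: "coord_lipschitz I L H" and s: "sets \<mu> = sets borel"
  shows "H \<in> borel_measurable (PiM I (\<lambda>_. \<mu>))"
proof (rule measurable_PiM_of_borel[OF _ s])
  show "H \<in> borel_measurable borel"
    using coord_lipschitz_continuous[OF H] by (rule borel_measurable_continuous_onI)
  show "H x = H y" if "\<And>i. i \<in> I \<Longrightarrow> x i = y i" for x y
    using coord_lipschitzD[OF H, of x y] that by simp
qed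

lemma coord_lipschitz_update:
  assumes H: "coord_lipschitz (insert i I) L H" and "finite I" "i \<notin> I"
  shows "\<bar>H (x(i := y)) - H (x'(i := y'))\<bar> \<le> L * (norm (y - y') + (\<Sum>j\<in>I. norm (x j - x' j)))"
proof -
  have "(\<Sum>j\<in>insert i I. norm ((x(i := y)) j - (x'(i := y')) j)) = norm (y - y') + (\<Sum>j\<in>I. norm (x j - x' j))"
    using assms by (auto intro!: sum.cong)
  then show ?thesis using coord_lipschitzD[OF H, of "x(i := y)" "x'(i := y')"] by simp
qed

lemma integrable_lipschitz:
  fixes F :: "'a::euclidean_space \<Rightarrow> real"
  assumes \<mu>: "\<mu> \<in> moment_measures 1" and F: "\<And>x y. \<bar>F x - F y\<bar> \<le> L * norm (x - y)"
  shows "integrable \<mu> F"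
proof -
  have "0 \<le> L * norm (SOME b :: 'a. b \<in> Basis)" using F[of "SOME b :: 'a. b \<in> Basis" 0] by simp
  moreover have "norm (SOME b :: 'a. b \<in> Basis) = 1" using SOME_Basis by (rule norm_Basis)
  ultimately have "0 \<le> L" by simp
  then interpret lipschitz_class "{F}" L "\<bar>F 0\<bar>" by unfold_locales (auto simp: F)
  show ?thesis using integrable_test[OF \<mu>] by simp
qed

lemma integrable_coord_lipschitz:
  assumes \<mu>: "\<mu> \<in> moment_measures 1" and "finite I" and H: "coord_lipschitz I L H"
  shows "integrable (PiM I (\<lambda>_. \<mu>)) H"
proof -
  note \<mu>' = moment_measuresD[OF \<mu>]
  interpret product_prob_space "\<lambda>_. \<mu>" by (intro product_prob_spaceI \<mu>')
  interpret P: prob_space "PiM I (\<lambda>_. \<mu>)" by (intro prob_space_PiM \<mu>')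
  have n: "integrable (PiM I (\<lambda>_. \<mu>)) (\<lambda>x. norm (x i))" if "i \<in> I" for i
  proof -
    have "integrable (distr (PiM I (\<lambda>_. \<mu>)) \<mu> (\<lambda>x. x i)) norm"
      using distr_PiM_component[OF \<mu>'(1) that] moment_measures_1D[OF \<mu>] by simp
    then show ?thesis using that by (subst (asm) integrable_distr_eq) (auto simp: measurable_cong_sets[OF \<mu>'(2) refl])
  qed
  have "integrable (PiM I (\<lambda>_. \<mu>)) (\<lambda>x. \<bar>H (\<lambda>_. 0)\<bar> + L * (\<Sum>i\<in>I. norm (x i)))"
    using n by (intro Bochner_Integration.integrable_add integrable_mult_right Bochner_Integration.integrable_sum) auto
  then show ?thesis
  proof (rule Bochner_Integration.integrable_bound)
    show "H \<in> borel_measurable (PiM I (\<lambda>_. \<mu>))" by (rule measurable_coord_lipschitz[OF H \<mu>'(2)])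
    have "norm (H x) \<le> norm (\<bar>H (\<lambda>_. 0)\<bar> + L * (\<Sum>i\<in>I. norm (x i)))" for x
      using coord_lipschitzD[OF H, of x "\<lambda>_. 0"] by simp
    then show "AE x in PiM I (\<lambda>_. \<mu>). norm (H x) \<le> norm (\<bar>H (\<lambda>_. 0)\<bar> + L * (\<Sum>i\<in>I. norm (x i)))" by simp
  qed
qed

lemma integral_coord_lipschitz_insert:
  assumes \<mu>: "\<mu> \<in> moment_measures 1" and I: "finite I" "i \<notin> I" and H: "coord_lipschitz (insert i I) L H"
  shows "\<And>x. integrable \<mu> (\<lambda>y. H (x(i := y)))"
    and "coord_lipschitz I L (\<lambda>x. \<integral>y. H (x(i := y)) \<partial>\<mu>)"
    and "(\<integral>x. H x \<partial>PiM (insert i I) (\<lambda>_. \<mu>)) = (\<integral>x. (\<integral>y. H (x(i := y)) \<partial>\<mu>) \<partial>PiM I (\<lambda>_. \<mu>))"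
proof -
  note \<mu>' = moment_measuresD[OF \<mu>]
  interpret product_prob_space "\<lambda>_. \<mu>" by (intro product_prob_spaceI \<mu>')
  show i: "integrable \<mu> (\<lambda>y. H (x(i := y)))" for x
    using coord_lipschitz_update[OF H I, of x _ x] by (intro integrable_lipschitz[OF \<mu>, of _ L]) simp
  show "coord_lipschitz I L (\<lambda>x. \<integral>y. H (x(i := y)) \<partial>\<mu>)"
    unfolding coord_lipschitz_def
  proof (intro allI)
    fix x x' :: "nat \<Rightarrow> 'a"
    have "\<bar>(\<integral>y. H (x(i := y)) \<partial>\<mu>) - (\<integral>y. H (x'(i := y)) \<partial>\<mu>)\<bar>
        = \<bar>\<integral>y. H (x(i := y)) - H (x'(i := y)) \<partial>\<mu>\<bar>"
      using i by simp
    also have "\<dots> \<le> (\<integral>y. \<bar>H (x(i := y)) - H (x'(i := y))\<bar> \<partial>\<mu>)" by (rule integral_abs_bound)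
    also have "\<dots> \<le> (\<integral>y. L * (\<Sum>j\<in>I. norm (x j - x' j)) \<partial>\<mu>)"
    proof (intro integral_mono)
      show "\<bar>H (x(i := y)) - H (x'(i := y))\<bar> \<le> L * (\<Sum>j\<in>I. norm (x j - x' j))" for y
        using coord_lipschitz_update[OF H I, of x y x' y] by simp
    qed (use i in auto)
    finally show "\<bar>(\<integral>y. H (x(i := y)) \<partial>\<mu>) - (\<integral>y. H (x'(i := y)) \<partial>\<mu>)\<bar> \<le> L * (\<Sum>j\<in>I. norm (x j - x' j))"
      by (simp add: prob_space.prob_space[OF \<mu>'(1)])
  qed
  show "(\<integral>x. H x \<partial>PiM (insert i I) (\<lambda>_. \<mu>)) = (\<integral>x. (\<integral>y. H (x(i := y)) \<partial>\<mu>) \<partial>PiM I (\<lambda>_. \<mu>))"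
    using I by (intro product_integral_insert integrable_coord_lipschitz[OF \<mu> _ H]) auto
qed

lemma nn_integral_square_lipschitz:
  fixes F :: "'a::euclidean_space \<Rightarrow> real"
  assumes \<mu>: "\<mu> \<in> moment_measures 2" and F: "\<And>x y. \<bar>F x - F y\<bar> \<le> L * norm (x - y)"
  shows "(\<integral>\<^sup>+x. ennreal ((F x)\<^sup>2) \<partial>\<mu>) \<le> ennreal ((\<integral>x. F x \<partial>\<mu>)\<^sup>2 + L\<^sup>2 * (\<integral>x. (norm x)\<^sup>2 \<partial>\<mu>))"
proof -
  note \<mu>' = moment_measuresD[OF \<mu>]
  interpret prob_space \<mu> by (rule \<mu>')
  let ?m = "\<integral>x. F x \<partial>\<mu>"
  have i: "integrable \<mu> F" using \<mu> moment_measures_2_1 by (intro integrable_lipschitz[OF _ F]) auto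
  have le: "(F x - F 0)\<^sup>2 \<le> L\<^sup>2 * (norm x)\<^sup>2" for x
    using power_mono[OF F[of x 0], of 2] by (simp add: power_mult_distrib)
  have i2: "integrable \<mu> (\<lambda>x. (F x - F 0)\<^sup>2)"
  proof (rule Bochner_Integration.integrable_bound)
    show "integrable \<mu> (\<lambda>x. L\<^sup>2 * (norm x)\<^sup>2)" using \<mu>'(4) by simp
    show "(\<lambda>x. (F x - F 0)\<^sup>2) \<in> borel_measurable \<mu>" using i by auto
  qed (use le in \<open>auto simp: abs_mult\<close>)
  have eq: "(\<lambda>x. (F x)\<^sup>2) = (\<lambda>x. (F x - F 0)\<^sup>2 + 2 * F 0 * F x - (F 0)\<^sup>2)"
    by (simp add: fun_eq_iff power2_eq_square algebra_simps)
  have i3: "integrable \<mu> (\<lambda>x. (F x)\<^sup>2)"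
    unfolding eq using i i2 by simp
  have "(\<integral>x. (F x)\<^sup>2 \<partial>\<mu>) = (\<integral>x. (F x - F 0)\<^sup>2 \<partial>\<mu>) + 2 * F 0 * ?m - (F 0)\<^sup>2"
    unfolding eq using i i2 by (simp add: prob_space)
  also have "\<dots> = (\<integral>x. (F x - F 0)\<^sup>2 \<partial>\<mu>) + ?m\<^sup>2 - (?m - F 0)\<^sup>2"
    by (simp add: power2_eq_square algebra_simps)
  also have "\<dots> \<le> (\<integral>x. (F x - F 0)\<^sup>2 \<partial>\<mu>) + ?m\<^sup>2" by simp
  also have "(\<integral>x. (F x - F 0)\<^sup>2 \<partial>\<mu>) \<le> (\<integral>x. L\<^sup>2 * (norm x)\<^sup>2 \<partial>\<mu>)"
    using i2 \<mu>'(4) le by (intro integral_mono) auto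
  finally show ?thesis using i3 by (simp add: nn_integral_eq_integral ennreal_leI add.commute del: ennreal_plus)
qed

text \<open>A form of the Efron--Stein inequality.\<close>

lemma nn_integral_square_coord_lipschitz:
  assumes \<mu>: "\<mu> \<in> moment_measures 2" and "finite I" and "coord_lipschitz I L H"
  shows "(\<integral>\<^sup>+x. ennreal ((H x)\<^sup>2) \<partial>PiM I (\<lambda>_. \<mu>))
    \<le> ennreal ((\<integral>x. H x \<partial>PiM I (\<lambda>_. \<mu>))\<^sup>2 + card I * (L\<^sup>2 * (\<integral>x. (norm x)\<^sup>2 \<partial>\<mu>)))"
proof -
  note \<mu>' = moment_measuresD[OF \<mu>]
  have \<mu>1: "\<mu> \<in> moment_measures 1" using \<mu> moment_measures_2_1 by auto
  interpret product_prob_space "\<lambda>_. \<mu>" by (intro product_prob_spaceI \<mu>')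
  let ?v = "L\<^sup>2 * (\<integral>x. (norm x)\<^sup>2 \<partial>\<mu>)"
  have v: "0 \<le> ?v" by simp
  from assms(2,3) show ?thesis
  proof (induction I arbitrary: H rule: finite_induct)
    case empty
    then show ?case
      by (simp add: PiM_empty lebesgue_integral_count_space_finite nn_integral_count_space_finite)
  next
    case (insert i I)
    have P1: "emeasure (PiM I (\<lambda>_. \<mu>)) (space (PiM I (\<lambda>_. \<mu>))) = 1"
      by (intro prob_space.emeasure_space_1 prob_space_PiM \<mu>')
    note ins = integral_coord_lipschitz_insert[OF \<mu>1 insert.hyps insert.prems]
    note [measurable] = measurable_coord_lipschitz[OF insert.prems \<mu>'(2)] measurable_coord_lipschitz[OF ins(2) \<mu>'(2)]
    let ?h = "\<lambda>x. \<integral>y. H (x(i := y)) \<partial>\<mu>"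
    have "(\<integral>\<^sup>+x. ennreal ((H x)\<^sup>2) \<partial>PiM (insert i I) (\<lambda>_. \<mu>))
        = (\<integral>\<^sup>+x. \<integral>\<^sup>+y. ennreal ((H (x(i := y)))\<^sup>2) \<partial>\<mu> \<partial>PiM I (\<lambda>_. \<mu>))"
      using insert.hyps by (intro product_nn_integral_insert) auto
    also have "\<dots> \<le> (\<integral>\<^sup>+x. ennreal ((?h x)\<^sup>2 + ?v) \<partial>PiM I (\<lambda>_. \<mu>))"
    proof (intro nn_integral_mono nn_integral_square_lipschitz[OF \<mu>])
      show "\<bar>H (x(i := y)) - H (x(i := z))\<bar> \<le> L * norm (y - z)" for x y z
        using coord_lipschitz_update[OF insert.prems insert.hyps, of x y x z]
        unfolding diff_self norm_zero sum.neutral_const add_0_right .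
    qed
    also have "\<dots> = (\<integral>\<^sup>+x. ennreal ((?h x)\<^sup>2) \<partial>PiM I (\<lambda>_. \<mu>)) + ennreal ?v"
      using v by (simp add: ennreal_plus nn_integral_add P1)
    also have "\<dots> \<le> ennreal ((\<integral>x. ?h x \<partial>PiM I (\<lambda>_. \<mu>))\<^sup>2 + card I * ?v) + ennreal ?v"
      by (intro add_right_mono insert.IH ins(2))
    also have "\<dots> = ennreal ((\<integral>x. ?h x \<partial>PiM I (\<lambda>_. \<mu>))\<^sup>2 + card (insert i I) * ?v)"
      using v insert.hyps by (subst ennreal_plus[symmetric]) (auto simp: algebra_simps)
    finally show ?case unfolding ins(3) .
  qed
qed

lemma nn_integral_exp_coord_lipschitz:
  fixes c :: real
  assumes \<mu>: "\<mu> \<in> moment_measures 1"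
    and step: "\<And>F. (\<And>x y. \<bar>F x - F y\<bar> \<le> L * norm (x - y)) \<Longrightarrow>
      (\<integral>\<^sup>+x. ennreal (exp (F x)) \<partial>\<mu>) \<le> ennreal (exp ((\<integral>x. F x \<partial>\<mu>) + c))"
    and "finite I" and "coord_lipschitz I L H"
  shows "(\<integral>\<^sup>+x. ennreal (exp (H x)) \<partial>PiM I (\<lambda>_. \<mu>)) \<le> ennreal (exp ((\<integral>x. H x \<partial>PiM I (\<lambda>_. \<mu>)) + card I * c))"
proof -
  note \<mu>' = moment_measuresD[OF \<mu>]
  interpret product_prob_space "\<lambda>_. \<mu>" by (intro product_prob_spaceI \<mu>')
  from assms(3,4) show ?thesis
  proof (induction I arbitrary: H rule: finite_induct)
    case empty
    then show ?case
      by (simp add: PiM_empty lebesgue_integral_count_space_finite nn_integral_count_space_finite)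
  next
    case (insert i I)
    note ins = integral_coord_lipschitz_insert[OF \<mu> insert.hyps insert.prems]
    note [measurable] = measurable_coord_lipschitz[OF insert.prems \<mu>'(2)] measurable_coord_lipschitz[OF ins(2) \<mu>'(2)]
    let ?h = "\<lambda>x. \<integral>y. H (x(i := y)) \<partial>\<mu>"
    have "(\<integral>\<^sup>+x. ennreal (exp (H x)) \<partial>PiM (insert i I) (\<lambda>_. \<mu>))
        = (\<integral>\<^sup>+x. \<integral>\<^sup>+y. ennreal (exp (H (x(i := y)))) \<partial>\<mu> \<partial>PiM I (\<lambda>_. \<mu>))"
      using insert.hyps by (intro product_nn_integral_insert) auto
    also have "\<dots> \<le> (\<integral>\<^sup>+x. ennreal (exp (?h x + c)) \<partial>PiM I (\<lambda>_. \<mu>))"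
    proof (intro nn_integral_mono step)
      show "\<bar>H (x(i := y)) - H (x(i := z))\<bar> \<le> L * norm (y - z)" for x y z
        using coord_lipschitz_update[OF insert.prems insert.hyps, of x y x z]
        unfolding diff_self norm_zero sum.neutral_const add_0_right .
    qed
    also have "\<dots> = ennreal (exp c) * (\<integral>\<^sup>+x. ennreal (exp (?h x)) \<partial>PiM I (\<lambda>_. \<mu>))"
      by (simp add: exp_add ennreal_mult' nn_integral_cmult mult.commute)
    also have "\<dots> \<le> ennreal (exp c) * ennreal (exp ((\<integral>x. ?h x \<partial>PiM I (\<lambda>_. \<mu>)) + card I * c))"
      by (intro mult_left_mono insert.IH ins(2)) simp
    also have "\<dots> = ennreal (exp ((\<integral>x. ?h x \<partial>PiM I (\<lambda>_. \<mu>)) + card (insert i I) * c))"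
      using insert.hyps by (simp add: ennreal_mult[symmetric] exp_add[symmetric] algebra_simps)
    finally show ?case unfolding ins(3) .
  qed
qed

section \<open>Exponential moments under the transport inequality\<close>

lemma relative_entropy_exp_tilt:
  fixes F :: "'a::euclidean_space \<Rightarrow> real"
  assumes \<mu>: "\<mu> \<in> prob_measures" and [measurable]: "F \<in> borel_measurable borel" and b: "\<And>x. \<bar>F x\<bar> \<le> b"
  defines "Z \<equiv> (\<integral>x. exp (F x) \<partial>\<mu>)"
  defines "\<nu> \<equiv> density \<mu> (\<lambda>x. ennreal (exp (F x) / Z))"
  shows "0 < Z" "prob_space \<nu>" "relative_entropy \<nu> \<mu> = ennreal ((\<integral>x. F x \<partial>\<nu>) - ln Z)"
    "0 \<le> (\<integral>x. F x \<partial>\<nu>) - ln Z"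
proof -
  have s[measurable_cong]: "sets \<mu> = sets borel" using \<mu> by (simp add: prob_measures_def)
  interpret prob_space \<mu> using \<mu> by (simp add: prob_measures_def)
  have F_int: "integrable \<mu> (\<lambda>x. g (F x))" if [measurable]: "g \<in> borel_measurable borel" and "\<And>x. \<bar>x\<bar> \<le> b \<Longrightarrow> \<bar>g x\<bar> \<le> B" for g :: "real \<Rightarrow> real" and B
    using that b by (intro integrable_const_bound[where B = B]) auto
  have eb: "\<bar>exp x\<bar> \<le> exp b" if "\<bar>x\<bar> \<le> b" for x :: real using that by auto
  have ei: "integrable \<mu> (\<lambda>x. exp (F x))" by (rule F_int[OF _ eb]) auto
  have "(\<integral>x. exp (- b) \<partial>\<mu>) \<le> Z"
    unfolding Z_def using ei b by (intro integral_mono) (auto simp: abs_le_iff minus_le_iff)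
  then show Z: "0 < Z" by (simp add: prob_space) (meson exp_gt_zero less_le_trans)
  define g where "g x = exp (F x) / Z" for x
  have g[measurable]: "g \<in> borel_measurable borel" and g0: "0 < g x" for x
    using Z by (auto simp: g_def[abs_def])
  have \<nu>: "\<nu> = density \<mu> (\<lambda>x. ennreal (g x))" by (simp add: \<nu>_def g_def)
  have "emeasure \<nu> (space \<nu>) = (\<integral>\<^sup>+x. ennreal (g x) \<partial>\<mu>)" by (simp add: \<nu> emeasure_density)
  also have "\<dots> = ennreal (\<integral>x. g x \<partial>\<mu>)"
    using ei g0 by (intro nn_integral_eq_integral) (auto simp: g_def less_imp_le)
  also have "(\<integral>x. g x \<partial>\<mu>) = 1" using Z by (simp add: g_def Z_def[symmetric])
  finally show p: "prob_space \<nu>" by (intro prob_spaceI) simp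
  then interpret \<nu>: prob_space \<nu> .
  have ln_g: "log (exp 1) (g x) = F x - ln Z" for x
    using Z by (simp add: g_def log_def ln_div)
  have ig: "integrable \<mu> (\<lambda>x. g x * log (exp 1) (g x))"
  proof -
    have "\<bar>exp x / Z * (x - ln Z)\<bar> \<le> exp b / Z * (b + \<bar>ln Z\<bar>)" if "\<bar>x\<bar> \<le> b" for x
      using that Z unfolding abs_mult by (intro mult_mono) (auto simp: divide_right_mono)
    then have "integrable \<mu> (\<lambda>x. exp (F x) / Z * (F x - ln Z))"
      by (rule F_int[rotated]) auto
    then show ?thesis
      unfolding ln_g by (simp add: g_def)
  qed
  have F\<nu>: "integrable \<nu> F" using b by (intro \<nu>.integrable_const_bound[where B = b]) (auto simp: \<nu>)
  have RN: "AE x in \<nu>. entropy_density (exp 1) \<mu> \<nu> x = F x - ln Z"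
  proof -
    have "density \<mu> (RN_deriv \<mu> \<nu>) = density \<mu> (\<lambda>x. ennreal (g x))"
      unfolding \<nu> by (intro density_RN_deriv_density) simp
    then have "AE x in \<mu>. RN_deriv \<mu> \<nu> x = ennreal (g x)"
      by (intro density_unique) auto
    then have "AE x in \<mu>. entropy_density (exp 1) \<mu> \<nu> x = F x - ln Z"
      using g0 by (auto elim!: eventually_mono simp: entropy_density_def ln_g less_imp_le)
    then show ?thesis unfolding \<nu> by (subst AE_density) auto
  qed
  have me: "entropy_density (exp 1) \<mu> \<nu> \<in> borel_measurable \<nu>"
    using measurable_entropy_density[of "exp 1" \<mu> \<nu>] by (simp add: \<nu>)
  have "integrable \<nu> (\<lambda>x. F x - ln Z)" using F\<nu> by simp
  then have "integrable \<nu> (entropy_density (exp 1) \<mu> \<nu>)"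
    using RN me by (subst integrable_cong_AE[OF me _ RN]) auto
  moreover have kl: "KL_divergence (exp 1) \<mu> \<nu> = (\<integral>x. F x \<partial>\<nu>) - ln Z"
  proof -
    have "KL_divergence (exp 1) \<mu> \<nu> = (\<integral>x. F x - ln Z \<partial>\<nu>)"
      unfolding KL_divergence_def using RN me F\<nu> by (intro integral_cong_AE) auto
    then show ?thesis using F\<nu> by (simp add: \<nu>.prob_space)
  qed
  moreover have "absolutely_continuous \<mu> \<nu>" unfolding \<nu> by (intro absolutely_continuousI_density) simp
  ultimately show "relative_entropy \<nu> \<mu> = ennreal ((\<integral>x. F x \<partial>\<nu>) - ln Z)"
    by (simp add: relative_entropy_def)
  interpret information_space \<mu> "exp 1" by unfold_locales auto
  have "0 \<le> KL_divergence (exp 1) \<mu> \<nu>"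
    unfolding \<nu> using p ig g0 by (intro KL_nonneg) (auto simp: \<nu> less_imp_le)
  then show "0 \<le> (\<integral>x. F x \<partial>\<nu>) - ln Z" using kl by simp
qed

text \<open>The easy half of the Bobkov--Goetze duality: test the transport inequality on the measure
  with density proportional to \<open>exp F\<close>.\<close>

lemma T1_nn_integral_exp_bounded:
  fixes F :: "'a::euclidean_space \<Rightarrow> real"
  assumes T1: "T1_inequality \<mu> \<kappa>" and \<kappa>: "0 < \<kappa>" and \<mu>: "\<mu> \<in> moment_measures 1"
    and F: "\<And>x y. \<bar>F x - F y\<bar> \<le> L * norm (x - y)" and L: "0 \<le> L" and b: "\<And>x. \<bar>F x\<bar> \<le> b"
  shows "(\<integral>\<^sup>+x. ennreal (exp (F x)) \<partial>\<mu>) \<le> ennreal (exp ((\<integral>x. F x \<partial>\<mu>) + L\<^sup>2 * \<kappa>\<^sup>2 / 2))"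
proof -
  interpret lipschitz_class "{F}" L "\<bar>F 0\<bar>" using F L by unfold_locales auto
  note \<mu>' = moment_measuresD[OF \<mu>]
  note [measurable_cong] = \<mu>'(2)
  interpret prob_space \<mu> by (rule \<mu>')
  have Fm [measurable]: "F \<in> borel_measurable borel" using measurable by simp
  have \<mu>p: "\<mu> \<in> prob_measures" using \<mu>' by (simp add: prob_measures_def)
  define Z where "Z = (\<integral>x. exp (F x) \<partial>\<mu>)"
  define \<nu> where "\<nu> = density \<mu> (\<lambda>x. ennreal (exp (F x) / Z))"
  define H where "H = (\<integral>x. F x \<partial>\<nu>) - ln Z"
  have Z: "0 < Z" and \<nu>: "prob_space \<nu>" and H: "relative_entropy \<nu> \<mu> = ennreal H" "0 \<le> H"
    using relative_entropy_exp_tilt[OF \<mu>p Fm b] unfolding Z_def[symmetric] \<nu>_def[symmetric] H_def by simp_all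
  have ei: "integrable \<mu> (\<lambda>x. exp (F x))"
    using b by (intro integrable_const_bound[where B = "exp b"]) (auto simp: abs_le_iff)
  have \<nu>1: "\<nu> \<in> moment_measures 1"
  proof (rule moment_measuresI[OF \<nu>])
    show "sets \<nu> = sets borel" using \<mu>' by (simp add: \<nu>_def)
    have "integrable \<mu> (\<lambda>x. exp (F x) / Z * norm x)"
    proof (rule Bochner_Integration.integrable_bound)
      show "integrable \<mu> (\<lambda>x. exp b / Z * norm x)" using moment_measures_1D[OF \<mu>] by simp
      have "exp (F x) / Z * norm x \<le> exp b / Z * norm x" for x
        using b[of x] Z by (intro mult_right_mono divide_right_mono) auto
      then show "AE x in \<mu>. norm (exp (F x) / Z * norm x) \<le> norm (exp b / Z * norm x)"
        using Z by (intro AE_I2) (simp add: abs_mult)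
    qed auto
    then show "integrable \<nu> (\<lambda>x. norm x ^ 1)"
      using Z by (simp add: \<nu>_def integrable_real_density)
  qed
  have ac: "absolutely_continuous \<mu> \<nu>" unfolding \<nu>_def by (intro absolutely_continuousI_density) auto
  let ?W = "wasserstein 1 \<mu> \<nu>"
  have "\<nu> \<in> prob_measures" using \<nu> \<mu>' by (simp add: prob_measures_def \<nu>_def)
  then have "?W\<^sup>2 \<le> ennreal (2 * \<kappa>\<^sup>2) * relative_entropy \<nu> \<mu>"
    using T1 ac unfolding T1_inequality_def by blast
  also have "\<dots> = ennreal (2 * \<kappa>\<^sup>2 * H)"
    unfolding H(1) using H(2) by (intro ennreal_mult[symmetric]) auto
  finally have W: "?W\<^sup>2 \<le> ennreal (2 * \<kappa>\<^sup>2 * H)" .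
  then have "?W \<noteq> \<infinity>" by (auto simp: power2_eq_square ennreal_top_mult top_unique)
  then obtain w where w: "?W = ennreal w" "0 \<le> w" by (cases ?W) auto
  have w2: "w\<^sup>2 \<le> 2 * \<kappa>\<^sup>2 * H" using W w H by (simp add: ennreal_power)
  have "ennreal \<bar>(\<integral>x. F x \<partial>\<mu>) - (\<integral>x. F x \<partial>\<nu>)\<bar> \<le> ennreal (L * w)"
    using integral_diff_le_wasserstein[OF \<mu> \<nu>1, of F] w L by (simp add: ennreal_mult)
  then have 1: "(\<integral>x. F x \<partial>\<nu>) \<le> (\<integral>x. F x \<partial>\<mu>) + L * w" using L w by simp
  have 2: "w\<^sup>2 / (2 * \<kappa>\<^sup>2) \<le> H" using w2 \<kappa> by (simp add: field_simps)
  have 3: "L * w \<le> w\<^sup>2 / (2 * \<kappa>\<^sup>2) + L\<^sup>2 * \<kappa>\<^sup>2 / 2"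
  proof -
    have "0 \<le> (w / \<kappa> - L * \<kappa>)\<^sup>2 / 2" by simp
    also have "\<dots> = w\<^sup>2 / (2 * \<kappa>\<^sup>2) + L\<^sup>2 * \<kappa>\<^sup>2 / 2 - L * w"
      using \<kappa> by (simp add: power2_eq_square field_simps)
    finally show ?thesis by simp
  qed
  have "ln Z \<le> (\<integral>x. F x \<partial>\<mu>) + L\<^sup>2 * \<kappa>\<^sup>2 / 2" using 1 2 3 by (simp add: H_def)
  then have "Z \<le> exp ((\<integral>x. F x \<partial>\<mu>) + L\<^sup>2 * \<kappa>\<^sup>2 / 2)" using Z by (metis exp_le_cancel_iff exp_ln)
  moreover have "(\<integral>\<^sup>+x. ennreal (exp (F x)) \<partial>\<mu>) = ennreal Z"
    unfolding Z_def using ei by (intro nn_integral_eq_integral) auto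
  ultimately show ?thesis by (simp add: ennreal_leI)
qed

lemma T1_nn_integral_exp:
  fixes F :: "'a::euclidean_space \<Rightarrow> real"
  assumes T1: "T1_inequality \<mu> \<kappa>" and \<kappa>: "0 < \<kappa>" and \<mu>: "\<mu> \<in> moment_measures 1"
    and F: "\<And>x y. \<bar>F x - F y\<bar> \<le> L * norm (x - y)" and L: "0 \<le> L"
  shows "(\<integral>\<^sup>+x. ennreal (exp (F x)) \<partial>\<mu>) \<le> ennreal (exp ((\<integral>x. F x \<partial>\<mu>) + L\<^sup>2 * \<kappa>\<^sup>2 / 2))"
proof -
  note \<mu>' = moment_measuresD[OF \<mu>]
  note [measurable_cong] = \<mu>'(2)
  let ?c = "L\<^sup>2 * \<kappa>\<^sup>2 / 2"
  define T where "T k x = max (- real k) (min (real k) (F x))" for k x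
  have i: "integrable \<mu> F" by (rule integrable_lipschitz[OF \<mu> F])
  then have [measurable]: "F \<in> borel_measurable \<mu>" by simp
  have [measurable]: "T k \<in> borel_measurable \<mu>" for k unfolding T_def by measurable
  have T_F: "\<forall>\<^sub>F k in sequentially. T k x = F x" for x
  proof -
    obtain N where "\<bar>F x\<bar> \<le> real N" using real_arch_simple by blast
    then show ?thesis by (intro eventually_sequentiallyI[of N]) (auto simp: T_def)
  qed
  have "(\<lambda>k. \<integral>x. T k x \<partial>\<mu>) \<longlonglongrightarrow> (\<integral>x. F x \<partial>\<mu>)"
  proof (rule integral_dominated_convergence[where w = "\<lambda>x. \<bar>F x\<bar>"])
    show "AE x in \<mu>. (\<lambda>k. T k x) \<longlonglongrightarrow> F x"
      using T_F by (intro AE_I2 tendsto_eventually)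
    show "AE x in \<mu>. norm (T k x) \<le> \<bar>F x\<bar>" for k by (intro AE_I2) (auto simp: T_def)
  qed (use i in auto)
  then have lim: "(\<lambda>k. ennreal (exp ((\<integral>x. T k x \<partial>\<mu>) + ?c))) \<longlonglongrightarrow> ennreal (exp ((\<integral>x. F x \<partial>\<mu>) + ?c))"
    by (intro tendsto_intros)
  have "(\<integral>\<^sup>+x. ennreal (exp (F x)) \<partial>\<mu>) = (\<integral>\<^sup>+x. liminf (\<lambda>k. ennreal (exp (T k x))) \<partial>\<mu>)"
  proof (intro nn_integral_cong)
    fix x
    have "(\<lambda>k. ennreal (exp (T k x))) \<longlonglongrightarrow> ennreal (exp (F x))"
      using T_F[of x] by (intro tendsto_eventually) (auto elim: eventually_mono)
    then show "ennreal (exp (F x)) = liminf (\<lambda>k. ennreal (exp (T k x)))"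
      by (intro lim_imp_Liminf[symmetric]) auto
  qed
  also have "\<dots> \<le> liminf (\<lambda>k. \<integral>\<^sup>+x. ennreal (exp (T k x)) \<partial>\<mu>)"
    by (intro nn_integral_liminf) measurable
  also have "\<dots> \<le> liminf (\<lambda>k. ennreal (exp ((\<integral>x. T k x \<partial>\<mu>) + ?c)))"
  proof (intro Liminf_mono always_eventually allI T1_nn_integral_exp_bounded[OF T1 \<kappa> \<mu> _ L])
    show "\<bar>T k x - T k y\<bar> \<le> L * norm (x - y)" for k x y
      using F[of x y] by (auto simp: T_def)
    show "\<bar>T k x\<bar> \<le> real k" for k x by (auto simp: T_def)
  qed
  also have "\<dots> = ennreal (exp ((\<integral>x. F x \<partial>\<mu>) + ?c))"
    using lim by (intro lim_imp_Liminf) auto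
  finally show ?thesis .
qed

section \<open>Symmetrization\<close>

lemma borel_measurable_SUP_abs:
  fixes g :: "'f \<Rightarrow> 'x::topological_space \<Rightarrow> real"
  assumes "\<And>f. f \<in> \<Phi> \<Longrightarrow> continuous_on UNIV (g f)"
  shows "(\<lambda>x. SUP f\<in>\<Phi>. ennreal \<bar>g f x\<bar>) \<in> borel_measurable borel"
proof (rule borel_measurableI_greater)
  fix a :: ennreal
  have "open (\<Union>f\<in>\<Phi>. {x. a < ennreal \<bar>g f x\<bar>})"
    using assms by (intro open_UN ballI open_Collect_less continuous_on_const continuous_on_ennreal continuous_intros) auto
  moreover have "{x. a < (SUP f\<in>\<Phi>. ennreal \<bar>g f x\<bar>)} = (\<Union>f\<in>\<Phi>. {x. a < ennreal \<bar>g f x\<bar>})"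
    by (auto simp: less_SUP_iff)
  ultimately show "{x \<in> space borel. a < (SUP f\<in>\<Phi>. ennreal \<bar>g f x\<bar>)} \<in> sets borel" by simp
qed

lemma nn_integral_pmf_swap:
  assumes p: "finite (set_pmf p)" and f: "\<And>a. a \<in> set_pmf p \<Longrightarrow> f a \<in> borel_measurable M"
  shows "(\<integral>\<^sup>+y. \<integral>\<^sup>+a. f a y \<partial>measure_pmf p \<partial>M) = (\<integral>\<^sup>+a. \<integral>\<^sup>+y. f a y \<partial>M \<partial>measure_pmf p)"
proof -
  have "(\<integral>\<^sup>+y. \<integral>\<^sup>+a. f a y \<partial>measure_pmf p \<partial>M) = (\<integral>\<^sup>+y. (\<Sum>a\<in>set_pmf p. f a y * ennreal (pmf p a)) \<partial>M)"
    by (simp add: nn_integral_measure_pmf_finite[OF p])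
  also have "\<dots> = (\<Sum>a\<in>set_pmf p. (\<integral>\<^sup>+y. f a y \<partial>M) * ennreal (pmf p a))"
    using f by (simp add: nn_integral_sum nn_integral_multc)
  also have "\<dots> = (\<integral>\<^sup>+a. \<integral>\<^sup>+y. f a y \<partial>M \<partial>measure_pmf p)"
    by (simp add: nn_integral_measure_pmf_finite[OF p])
  finally show ?thesis .
qed

abbreviation sign_pmf :: "nat set \<Rightarrow> (nat \<Rightarrow> real) pmf" where
  "sign_pmf I \<equiv> Pi_pmf I 0 (\<lambda>_. pmf_of_set {- 1, 1})"

lemma finite_set_sign_pmf: "finite I \<Longrightarrow> finite (set_pmf (sign_pmf I))"
  by (rule finite_subset[OF set_Pi_pmf_subset']) (auto intro!: finite_PiE_dflt)

lemma nn_integral_sign_pmf_insert: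
  assumes "finite I" "i \<notin> I"
  shows "(\<integral>\<^sup>+\<xi>. G \<xi> \<partial>sign_pmf (insert i I))
    = ((\<integral>\<^sup>+\<xi>. G (\<xi>(i := -1)) \<partial>sign_pmf I) + (\<integral>\<^sup>+\<xi>. G (\<xi>(i := 1)) \<partial>sign_pmf I)) / 2"
  using assms by (simp add: Pi_pmf_insert nn_integral_pair_pmf' nn_integral_pmf_of_set)

context lipschitz_class begin

lemma SUP_integral_le:
  assumes \<mu>: "\<mu> \<in> moment_measures 1"
  shows "(SUP f\<in>\<Phi>. ennreal \<bar>a f + (\<integral>z. f z \<partial>\<mu>) - f y\<bar>)
    \<le> ((\<integral>\<^sup>+z. (SUP f\<in>\<Phi>. ennreal \<bar>a f + 2 * f z\<bar>) \<partial>\<mu>) + (SUP f\<in>\<Phi>. ennreal \<bar>a f - 2 * f y\<bar>)) / 2"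
proof (rule SUP_least)
  fix f assume f: "f \<in> \<Phi>"
  interpret prob_space \<mu> by (rule moment_measuresD[OF \<mu>])
  note i = integrable_test[OF \<mu> f]
  let ?u = "a f + 2 * (\<integral>z. f z \<partial>\<mu>)" and ?v = "a f - 2 * f y"
  have "ennreal \<bar>?u\<bar> = ennreal \<bar>\<integral>z. a f + 2 * f z \<partial>\<mu>\<bar>" using i by (simp add: prob_space)
  also have "\<dots> \<le> (\<integral>\<^sup>+z. ennreal \<bar>a f + 2 * f z\<bar> \<partial>\<mu>)"
    using integral_norm_bound_ennreal[of \<mu> "\<lambda>z. a f + 2 * f z"] i by simp
  also have "\<dots> \<le> (\<integral>\<^sup>+z. (SUP f\<in>\<Phi>. ennreal \<bar>a f + 2 * f z\<bar>) \<partial>\<mu>)"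
    using f by (intro nn_integral_mono SUP_upper)
  finally have u: "ennreal \<bar>?u\<bar> \<le> \<dots>" .
  have v: "ennreal \<bar>?v\<bar> \<le> (SUP f\<in>\<Phi>. ennreal \<bar>a f - 2 * f y\<bar>)" using f by (rule SUP_upper)
  have "a f + (\<integral>z. f z \<partial>\<mu>) - f y = (?u + ?v) / 2" by (simp add: field_simps)
  then have "\<bar>a f + (\<integral>z. f z \<partial>\<mu>) - f y\<bar> = \<bar>?u + ?v\<bar> / 2"
    by (simp only: abs_divide abs_numeral)
  also have "\<dots> \<le> (\<bar>?u\<bar> + \<bar>?v\<bar>) / 2"
    by (intro divide_right_mono abs_triangle_ineq) simp
  finally have "\<bar>a f + (\<integral>z. f z \<partial>\<mu>) - f y\<bar> \<le> (\<bar>?u\<bar> + \<bar>?v\<bar>) / 2" .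
  then have "ennreal \<bar>a f + (\<integral>z. f z \<partial>\<mu>) - f y\<bar> \<le> ennreal ((\<bar>?u\<bar> + \<bar>?v\<bar>) / 2)" by (rule ennreal_leI)
  also have "\<dots> = (ennreal \<bar>?u\<bar> + ennreal \<bar>?v\<bar>) / 2"
    by (simp add: divide_ennreal[symmetric])
  also have "\<dots> \<le> ((\<integral>\<^sup>+z. (SUP f\<in>\<Phi>. ennreal \<bar>a f + 2 * f z\<bar>) \<partial>\<mu>) + (SUP f\<in>\<Phi>. ennreal \<bar>a f - 2 * f y\<bar>)) / 2"
    by (intro divide_right_mono_ennreal add_mono u v)
  finally show "ennreal \<bar>a f + (\<integral>z. f z \<partial>\<mu>) - f y\<bar>
    \<le> ((\<integral>\<^sup>+z. (SUP f\<in>\<Phi>. ennreal \<bar>a f + 2 * f z\<bar>) \<partial>\<mu>) + (SUP f\<in>\<Phi>. ennreal \<bar>a f - 2 * f y\<bar>)) / 2" .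
qed

lemma nn_integral_symmetrize_one:
  assumes \<mu>: "\<mu> \<in> moment_measures 1"
  shows "(\<integral>\<^sup>+y. (SUP f\<in>\<Phi>. ennreal \<bar>a f + (\<integral>z. f z \<partial>\<mu>) - f y\<bar>) \<partial>\<mu>)
    \<le> ((\<integral>\<^sup>+y. (SUP f\<in>\<Phi>. ennreal \<bar>a f + 2 * f y\<bar>) \<partial>\<mu>) + (\<integral>\<^sup>+y. (SUP f\<in>\<Phi>. ennreal \<bar>a f - 2 * f y\<bar>) \<partial>\<mu>)) / 2"
proof -
  note \<mu>' = moment_measuresD[OF \<mu>]
  note [measurable_cong] = \<mu>'(2)
  interpret prob_space \<mu> by (rule \<mu>')
  have [measurable]: "(\<lambda>y. SUP f\<in>\<Phi>. ennreal \<bar>a f - 2 * f y\<bar>) \<in> borel_measurable borel"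
    by (intro borel_measurable_SUP_abs continuous_intros continuous)
  have "(\<integral>\<^sup>+y. (SUP f\<in>\<Phi>. ennreal \<bar>a f + (\<integral>z. f z \<partial>\<mu>) - f y\<bar>) \<partial>\<mu>)
    \<le> (\<integral>\<^sup>+y. ((\<integral>\<^sup>+z. (SUP f\<in>\<Phi>. ennreal \<bar>a f + 2 * f z\<bar>) \<partial>\<mu>) + (SUP f\<in>\<Phi>. ennreal \<bar>a f - 2 * f y\<bar>)) / 2 \<partial>\<mu>)"
    by (intro nn_integral_mono SUP_integral_le \<mu>)
  also have "\<dots> = ((\<integral>\<^sup>+z. (SUP f\<in>\<Phi>. ennreal \<bar>a f + 2 * f z\<bar>) \<partial>\<mu>) + (\<integral>\<^sup>+y. (SUP f\<in>\<Phi>. ennreal \<bar>a f - 2 * f y\<bar>) \<partial>\<mu>)) / 2"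
    by (simp add: nn_integral_divide nn_integral_add emeasure_space_1)
  finally show ?thesis .
qed

lemma measurable_SUP_coord:
  fixes I J :: "nat set"
  assumes \<mu>: "sets \<mu> = sets borel" and "finite I" "J \<subseteq> I"
  shows "(\<lambda>x. SUP f\<in>\<Phi>. ennreal \<bar>c f + (\<Sum>i\<in>J. d i f + e i * f (x i))\<bar>) \<in> borel_measurable (PiM I (\<lambda>_. \<mu>))"
proof (rule measurable_PiM_of_borel[OF _ \<mu>])
  show "(\<lambda>x. SUP f\<in>\<Phi>. ennreal \<bar>c f + (\<Sum>i\<in>J. d i f + e i * f (x i))\<bar>) \<in> borel_measurable borel"
  proof (rule borel_measurable_SUP_abs)
    show "continuous_on UNIV (\<lambda>x. c f + (\<Sum>i\<in>J. d i f + e i * f (x i)))" if "f \<in> \<Phi>" for f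
      by (intro continuous_intros continuous_on_compose2[OF continuous[OF that]] continuous_on_product_coordinates) auto
  qed
  fix x y :: "nat \<Rightarrow> 'a"
  assume "\<And>i. i \<in> I \<Longrightarrow> x i = y i"
  then have "(\<Sum>i\<in>J. d i f + e i * f (x i)) = (\<Sum>i\<in>J. d i f + e i * f (y i))" for f
    using assms by (intro sum.cong) auto
  then show "(SUP f\<in>\<Phi>. ennreal \<bar>c f + (\<Sum>i\<in>J. d i f + e i * f (x i))\<bar>)
    = (SUP f\<in>\<Phi>. ennreal \<bar>c f + (\<Sum>i\<in>J. d i f + e i * f (y i))\<bar>)" by simp
qed

text \<open>Symmetrization without a ghost sample: the coordinates are replaced one at a time, using
  only the convexity of the supremum. The auxiliary shift \<open>c\<close> carries the coordinates that
  have already been replaced.\<close>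

lemma nn_integral_symmetrize:
  assumes \<mu>: "\<mu> \<in> moment_measures 1" and "finite I"
  shows "(\<integral>\<^sup>+x. (SUP f\<in>\<Phi>. ennreal \<bar>c f + (\<Sum>i\<in>I. (\<integral>z. f z \<partial>\<mu>) - f (x i))\<bar>) \<partial>PiM I (\<lambda>_. \<mu>))
    \<le> (\<integral>\<^sup>+\<xi>. \<integral>\<^sup>+x. (SUP f\<in>\<Phi>. ennreal \<bar>c f + (\<Sum>i\<in>I. 2 * (\<xi> i * f (x i)))\<bar>) \<partial>PiM I (\<lambda>_. \<mu>) \<partial>sign_pmf I)"
  using assms(2)
proof (induction I arbitrary: c rule: finite_induct)
  case empty
  interpret product_prob_space "\<lambda>_. \<mu>" by (intro product_prob_spaceI moment_measuresD[OF \<mu>])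
  show ?case by (simp add: nn_integral_empty)
next
  case (insert i I)
  note \<mu>' = moment_measuresD[OF \<mu>]
  note fin = \<open>finite I\<close> and ni = \<open>i \<notin> I\<close>
  interpret product_prob_space "\<lambda>_. \<mu>" by (intro product_prob_spaceI \<mu>')
  let ?P = "PiM I (\<lambda>_. \<mu>)" and ?P' = "PiM (insert i I) (\<lambda>_. \<mu>)"
  define m where "m f = (\<integral>z. f z \<partial>\<mu>)" for f :: "'a \<Rightarrow> real"
  define \<Psi> where "\<Psi> s x = (SUP f\<in>\<Phi>. ennreal \<bar>c f + 2 * s * f (x i) + (\<Sum>j\<in>I. m f - f (x j))\<bar>)"
    for s :: real and x :: "nat \<Rightarrow> 'a"
  define \<Theta> where "\<Theta> s \<xi> x = (SUP f\<in>\<Phi>. ennreal \<bar>c f + 2 * s * f (x i) + (\<Sum>j\<in>I. 2 * (\<xi> j * f (x j)))\<bar>)"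
    for s :: real and \<xi> :: "nat \<Rightarrow> real" and x :: "nat \<Rightarrow> 'a"
  have upd: "(\<Sum>j\<in>I. m f - f ((x(i := y)) j)) = (\<Sum>j\<in>I. m f - f (x j))"
    "(\<Sum>j\<in>I. 2 * (\<xi> j * f ((x(i := y)) j))) = (\<Sum>j\<in>I. 2 * (\<xi> j * f (x j)))"
    for f :: "'a \<Rightarrow> real" and \<xi> :: "nat \<Rightarrow> real" and x y
    using ni by (auto intro!: sum.cong)
  have [measurable]: "\<Psi> s \<in> borel_measurable ?P'" for s
  proof -
    have "\<Psi> s = (\<lambda>x. SUP f\<in>\<Phi>. ennreal \<bar>c f + (\<Sum>j\<in>insert i I. (if j = i then 0 else m f) + (if j = i then 2 * s else - 1) * f (x j))\<bar>)"
    proof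
      fix x :: "nat \<Rightarrow> 'a"
      have "(\<Sum>j\<in>I. (if j = i then 0 else m f) + (if j = i then 2 * s else - 1) * f (x j)) = (\<Sum>j\<in>I. m f - f (x j))" for f
        using ni by (intro sum.cong) auto
      then show "\<Psi> s x = (SUP f\<in>\<Phi>. ennreal \<bar>c f + (\<Sum>j\<in>insert i I. (if j = i then 0 else m f) + (if j = i then 2 * s else - 1) * f (x j))\<bar>)"
        using fin ni by (simp add: \<Psi>_def add.assoc)
    qed
    then show ?thesis using measurable_SUP_coord[OF \<mu>'(2), of "insert i I" "insert i I"] fin by simp
  qed
  have [measurable]: "\<Theta> s \<xi> \<in> borel_measurable ?P'" for s \<xi>
  proof -
    have "\<Theta> s \<xi> = (\<lambda>x. SUP f\<in>\<Phi>. ennreal \<bar>c f + (\<Sum>j\<in>insert i I. 0 + (if j = i then 2 * s else 2 * \<xi> j) * f (x j))\<bar>)"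
    proof
      fix x :: "nat \<Rightarrow> 'a"
      have "(\<Sum>j\<in>I. 0 + (if j = i then 2 * s else 2 * \<xi> j) * f (x j)) = (\<Sum>j\<in>I. 2 * (\<xi> j * f (x j)))" for f
        using ni by (intro sum.cong) auto
      then show "\<Theta> s \<xi> x = (SUP f\<in>\<Phi>. ennreal \<bar>c f + (\<Sum>j\<in>insert i I. 0 + (if j = i then 2 * s else 2 * \<xi> j) * f (x j))\<bar>)"
        using fin ni by (simp add: \<Theta>_def add.assoc)
    qed
    then show ?thesis using measurable_SUP_coord[OF \<mu>'(2), of "insert i I" "insert i I" c "\<lambda>_ _. 0"] fin by simp
  qed
  have step: "(\<integral>\<^sup>+x. \<Psi> s x \<partial>?P') \<le> (\<integral>\<^sup>+\<xi>. \<integral>\<^sup>+x. \<Theta> s \<xi> x \<partial>?P' \<partial>sign_pmf I)" for s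
  proof -
    have "(\<integral>\<^sup>+x. \<Psi> s x \<partial>?P') = (\<integral>\<^sup>+y. \<integral>\<^sup>+x. \<Psi> s (x(i := y)) \<partial>?P \<partial>\<mu>)"
      using fin ni by (intro product_nn_integral_insert_rev) auto
    also have "\<dots> \<le> (\<integral>\<^sup>+y. \<integral>\<^sup>+\<xi>. \<integral>\<^sup>+x. \<Theta> s \<xi> (x(i := y)) \<partial>?P \<partial>sign_pmf I \<partial>\<mu>)"
    proof (intro nn_integral_mono)
      fix y
      have "\<Psi> s (x(i := y)) = (SUP f\<in>\<Phi>. ennreal \<bar>(c f + 2 * s * f y) + (\<Sum>j\<in>I. (\<integral>z. f z \<partial>\<mu>) - f (x j))\<bar>)" for x
        unfolding \<Psi>_def fun_upd_same upd by (simp only: m_def)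
      moreover have "\<Theta> s \<xi> (x(i := y)) = (SUP f\<in>\<Phi>. ennreal \<bar>(c f + 2 * s * f y) + (\<Sum>j\<in>I. 2 * (\<xi> j * f (x j)))\<bar>)" for x \<xi>
        by (simp only: \<Theta>_def fun_upd_same upd)
      ultimately show "(\<integral>\<^sup>+x. \<Psi> s (x(i := y)) \<partial>?P) \<le> (\<integral>\<^sup>+\<xi>. \<integral>\<^sup>+x. \<Theta> s \<xi> (x(i := y)) \<partial>?P \<partial>sign_pmf I)"
        using insert.IH[of "\<lambda>f. c f + 2 * s * f y"] by simp
    qed
    also have "\<dots> = (\<integral>\<^sup>+\<xi>. \<integral>\<^sup>+y. \<integral>\<^sup>+x. \<Theta> s \<xi> (x(i := y)) \<partial>?P \<partial>\<mu> \<partial>sign_pmf I)"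
    proof (rule nn_integral_pmf_swap[OF finite_set_sign_pmf[OF fin]])
      interpret sigma_finite_measure ?P by (intro prob_space_imp_sigma_finite prob_space_PiM \<mu>')
      show "(\<lambda>y. \<integral>\<^sup>+x. \<Theta> s \<xi> (x(i := y)) \<partial>?P) \<in> borel_measurable \<mu>" for \<xi>
        by measurable
    qed
    also have "\<dots> = (\<integral>\<^sup>+\<xi>. \<integral>\<^sup>+x. \<Theta> s \<xi> x \<partial>?P' \<partial>sign_pmf I)"
      using fin ni by (subst product_nn_integral_insert_rev) auto
    finally show ?thesis .
  qed
  have "(\<integral>\<^sup>+x. (SUP f\<in>\<Phi>. ennreal \<bar>c f + (\<Sum>i\<in>insert i I. m f - f (x i))\<bar>) \<partial>?P')
      = (\<integral>\<^sup>+x. \<integral>\<^sup>+y. (SUP f\<in>\<Phi>. ennreal \<bar>(c f + (\<Sum>j\<in>I. m f - f (x j))) + (\<integral>z. f z \<partial>\<mu>) - f y\<bar>) \<partial>\<mu> \<partial>?P)"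
  proof (subst product_nn_integral_insert[OF fin ni])
    show "(\<lambda>x. SUP f\<in>\<Phi>. ennreal \<bar>c f + (\<Sum>i\<in>insert i I. m f - f (x i))\<bar>) \<in> borel_measurable ?P'"
      using measurable_SUP_coord[OF \<mu>'(2), of "insert i I" "insert i I" c "\<lambda>_. m" "\<lambda>_. - 1"] fin by simp
    have eq: "c f + (\<Sum>j\<in>insert i I. m f - f ((x(i := y)) j)) = (c f + (\<Sum>j\<in>I. m f - f (x j))) + (\<integral>z. f z \<partial>\<mu>) - f y" for f x y
      unfolding sum.insert[OF fin ni] fun_upd_same upd by (simp add: m_def)
    show "(\<integral>\<^sup>+x. \<integral>\<^sup>+y. (SUP f\<in>\<Phi>. ennreal \<bar>c f + (\<Sum>j\<in>insert i I. m f - f ((x(i := y)) j))\<bar>) \<partial>\<mu> \<partial>?P)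
      = (\<integral>\<^sup>+x. \<integral>\<^sup>+y. (SUP f\<in>\<Phi>. ennreal \<bar>(c f + (\<Sum>j\<in>I. m f - f (x j))) + (\<integral>z. f z \<partial>\<mu>) - f y\<bar>) \<partial>\<mu> \<partial>?P)"
      by (simp only: eq)
  qed
  also have "\<dots> \<le> (\<integral>\<^sup>+x. ((\<integral>\<^sup>+y. \<Psi> 1 (x(i := y)) \<partial>\<mu>) + (\<integral>\<^sup>+y. \<Psi> (- 1) (x(i := y)) \<partial>\<mu>)) / 2 \<partial>?P)"
  proof (intro nn_integral_mono)
    fix x :: "nat \<Rightarrow> 'a"
    have "\<Psi> 1 (x(i := y)) = (SUP f\<in>\<Phi>. ennreal \<bar>(c f + (\<Sum>j\<in>I. m f - f (x j))) + 2 * f y\<bar>)"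
      and "\<Psi> (- 1) (x(i := y)) = (SUP f\<in>\<Phi>. ennreal \<bar>(c f + (\<Sum>j\<in>I. m f - f (x j))) - 2 * f y\<bar>)" for y
      unfolding \<Psi>_def fun_upd_same upd by (simp_all add: algebra_simps)
    then show "(\<integral>\<^sup>+y. (SUP f\<in>\<Phi>. ennreal \<bar>(c f + (\<Sum>j\<in>I. m f - f (x j))) + (\<integral>z. f z \<partial>\<mu>) - f y\<bar>) \<partial>\<mu>)
      \<le> ((\<integral>\<^sup>+y. \<Psi> 1 (x(i := y)) \<partial>\<mu>) + (\<integral>\<^sup>+y. \<Psi> (- 1) (x(i := y)) \<partial>\<mu>)) / 2"
      using nn_integral_symmetrize_one[OF \<mu>, of "\<lambda>f. c f + (\<Sum>j\<in>I. m f - f (x j))"] by simp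
  qed
  also have "\<dots> = ((\<integral>\<^sup>+x. \<integral>\<^sup>+y. \<Psi> 1 (x(i := y)) \<partial>\<mu> \<partial>?P) + (\<integral>\<^sup>+x. \<integral>\<^sup>+y. \<Psi> (- 1) (x(i := y)) \<partial>\<mu> \<partial>?P)) / 2"
    by (subst nn_integral_divide, measurable, subst nn_integral_add, measurable)
  also have "\<dots> = ((\<integral>\<^sup>+x. \<Psi> 1 x \<partial>?P') + (\<integral>\<^sup>+x. \<Psi> (- 1) x \<partial>?P')) / 2"
    by (simp add: product_nn_integral_insert[OF fin ni])
  also have "\<dots> \<le> ((\<integral>\<^sup>+\<xi>. \<integral>\<^sup>+x. \<Theta> 1 \<xi> x \<partial>?P' \<partial>sign_pmf I) + (\<integral>\<^sup>+\<xi>. \<integral>\<^sup>+x. \<Theta> (- 1) \<xi> x \<partial>?P' \<partial>sign_pmf I)) / 2"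
    by (intro divide_right_mono_ennreal add_mono step)
  also have "\<dots> = (\<integral>\<^sup>+\<xi>. \<integral>\<^sup>+x. (SUP f\<in>\<Phi>. ennreal \<bar>c f + (\<Sum>j\<in>insert i I. 2 * (\<xi> j * f (x j)))\<bar>) \<partial>?P' \<partial>sign_pmf (insert i I))"
  proof -
    have se: "(\<Sum>j\<in>I. 2 * ((\<xi>(i := s)) j * f (x j))) = (\<Sum>j\<in>I. 2 * (\<xi> j * f (x j)))"
      for \<xi> :: "nat \<Rightarrow> real" and s and f :: "'a \<Rightarrow> real" and x :: "nat \<Rightarrow> 'a"
      using ni by (intro sum.cong) auto
    have "(SUP f\<in>\<Phi>. ennreal \<bar>c f + (\<Sum>j\<in>insert i I. 2 * ((\<xi>(i := s)) j * f (x j)))\<bar>) = \<Theta> s \<xi> x" for \<xi> s x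
      unfolding \<Theta>_def sum.insert[OF fin ni] fun_upd_same se by (simp add: add.assoc mult.assoc)
    then show ?thesis
      unfolding nn_integral_sign_pmf_insert[OF fin ni] by (simp add: add.commute)
  qed
  finally show ?case unfolding m_def .
qed

end

section \<open>Empirical measures\<close>

lemma empirical_measure_distr:
  fixes x :: "nat \<Rightarrow> 'a::euclidean_space"
  assumes n: "1 \<le> n"
  shows "empirical_measure n x = distr (measure_pmf (pmf_of_set {1..n})) borel x"
  unfolding empirical_measure_def
proof (rule measure_of_eqI_emeasure)
  fix A :: "'a set" assume A: "A \<in> sets borel"
  have "(\<Sum>i=1..n. emeasure (return borel (x i)) A) = (\<Sum>i=1..n. if i \<in> x -` A then 1 else 0)"
    using A by (intro sum.cong) (auto simp: indicator_def)
  also have "\<dots> = (\<Sum>i\<in>{1..n} \<inter> x -` A. 1)"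
    by (rule sum.inter_restrict[symmetric]) simp
  also have "\<dots> = of_nat (card ({1..n} \<inter> x -` A))" by simp
  finally show "emeasure (distr (measure_pmf (pmf_of_set {1..n})) borel x) A
      = (\<Sum>i=1..n. emeasure (return borel (x i)) A) / of_nat n"
    using A n by (simp add: emeasure_distr emeasure_pmf_of_set divide_ennreal ennreal_of_nat_eq_real_of_nat)
qed simp

lemma integral_empirical_measure:
  assumes "1 \<le> n" and "f \<in> borel_measurable borel"
  shows "(\<integral>y. f y \<partial>empirical_measure n x) = (\<Sum>i=1..n. f (x i)) / real n"
  using assms by (simp add: empirical_measure_distr integral_distr integral_pmf_of_set)

lemma empirical_measure_moment:
  assumes n: "1 \<le> n"
  shows "empirical_measure n x \<in> moment_measures p"
proof (rule moment_measuresI)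
  show "prob_space (empirical_measure n x)"
    unfolding empirical_measure_distr[OF n] by (intro measure_pmf.prob_space_distr) simp
  show "sets (empirical_measure n x) = sets borel"
    unfolding empirical_measure_distr[OF n] by simp
  show "integrable (empirical_measure n x) (\<lambda>y. norm y ^ p)"
    unfolding empirical_measure_distr[OF n] using n
    by (subst integrable_distr_eq) (auto intro!: integrable_measure_pmf_finite)
qed

context lipschitz_class begin

lemma coord_lipschitz_ipm_empirical:
  assumes \<mu>: "\<mu> \<in> moment_measures 1" and n: "1 \<le> n"
  shows "coord_lipschitz {1..n} (L / real n) (\<lambda>x. ipm \<Phi> \<mu> (empirical_measure n x))"
  unfolding coord_lipschitz_def
proof (intro allI)
  fix x y :: "nat \<Rightarrow> 'a"
  let ?e = "empirical_measure n"
  note e = empirical_measure_moment[OF n, of _ 1]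
  have "ipm \<Phi> (?e x) (?e y) \<le> L * (\<integral>i. norm (x i - y i) \<partial>measure_pmf (pmf_of_set {1..n}))"
    using e[of x] e[of y] unfolding empirical_measure_distr[OF n] by (intro ipm_distr_le) auto
  also have "\<dots> = L / real n * (\<Sum>i\<in>{1..n}. norm (x i - y i))"
    using n by (simp add: integral_pmf_of_set)
  finally have *: "ipm \<Phi> (?e x) (?e y) \<le> L / real n * (\<Sum>i\<in>{1..n}. norm (x i - y i))" .
  have "\<bar>ipm \<Phi> \<mu> (?e x) - ipm \<Phi> \<mu> (?e y)\<bar> \<le> ipm \<Phi> (?e x) (?e y)"
    using ipm_triangle[OF \<mu> e[of x] e[of y]] ipm_triangle[OF \<mu> e[of y] e[of x]] ipm_commute[of "?e x" "?e y"]
    by linarith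
  with * show "\<bar>ipm \<Phi> \<mu> (?e x) - ipm \<Phi> \<mu> (?e y)\<bar> \<le> L / real n * (\<Sum>i\<in>{1..n}. norm (x i - y i))"
    by linarith
qed

lemma ipm_empirical_le_SUP:
  assumes \<mu>: "\<mu> \<in> moment_measures 1" and n: "1 \<le> n"
  shows "ennreal (real n * ipm \<Phi> \<mu> (empirical_measure n x))
    \<le> (SUP f\<in>\<Phi>. ennreal \<bar>0 + (\<Sum>i\<in>{1..n}. (\<integral>z. f z \<partial>\<mu>) - f (x i))\<bar>)" (is "_ \<le> ?S")
proof (cases ?S)
  case (real s)
  have "ipm \<Phi> \<mu> (empirical_measure n x) \<le> s / real n"
  proof (rule ipm_least[OF \<mu> empirical_measure_moment[OF n]])
    fix f assume f: "f \<in> \<Phi>"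
    have "ennreal \<bar>\<Sum>i\<in>{1..n}. (\<integral>z. f z \<partial>\<mu>) - f (x i)\<bar> \<le> ennreal s"
      using SUP_upper[OF f, of "\<lambda>f. ennreal \<bar>0 + (\<Sum>i\<in>{1..n}. (\<integral>z. f z \<partial>\<mu>) - f (x i))\<bar>"] real by simp
    then have "\<bar>\<Sum>i\<in>{1..n}. (\<integral>z. f z \<partial>\<mu>) - f (x i)\<bar> \<le> s" using real by simp
    moreover have "(\<integral>z. f z \<partial>\<mu>) - (\<integral>z. f z \<partial>empirical_measure n x) = (\<Sum>i\<in>{1..n}. (\<integral>z. f z \<partial>\<mu>) - f (x i)) / real n"
      using n by (simp add: integral_empirical_measure measurable[OF f] sum_subtractf field_simps)
    ultimately show "\<bar>(\<integral>z. f z \<partial>\<mu>) - (\<integral>z. f z \<partial>empirical_measure n x)\<bar> \<le> s / real n"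
      by (simp add: divide_right_mono)
  qed
  then have "real n * ipm \<Phi> \<mu> (empirical_measure n x) \<le> s" using n by (simp add: field_simps)
  then show ?thesis unfolding real(2) by (rule ennreal_leI)
next
  case top
  show ?thesis unfolding top by (rule top_greatest)
qed

lemma bdd_above_signs:
  fixes x :: "nat \<Rightarrow> 'a"
  shows "bdd_above ((\<lambda>f. \<bar>\<Sum>i\<in>I. \<xi> i * f (x i)\<bar>) ` \<Phi>)"
proof (rule bdd_aboveI2)
  fix f assume f: "f \<in> \<Phi>"
  have "\<bar>\<Sum>i\<in>I. \<xi> i * f (x i)\<bar> \<le> (\<Sum>i\<in>I. \<bar>\<xi> i * f (x i)\<bar>)" by (rule sum_abs)
  also have "\<dots> \<le> (\<Sum>i\<in>I. \<bar>\<xi> i\<bar> * (B + L * norm (x i)))"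
    unfolding abs_mult by (intro sum_mono mult_left_mono growth f) auto
  finally show "\<bar>\<Sum>i\<in>I. \<xi> i * f (x i)\<bar> \<le> (\<Sum>i\<in>I. \<bar>\<xi> i\<bar> * (B + L * norm (x i)))" .
qed

lemma SUP_signs_le:
  fixes x :: "nat \<Rightarrow> 'a"
  shows "(SUP f\<in>\<Phi>. ennreal \<bar>0 + (\<Sum>i\<in>I. 2 * (\<xi> i * f (x i)))\<bar>) \<le> ennreal (2 * (SUP f\<in>\<Phi>. \<bar>\<Sum>i\<in>I. \<xi> i * f (x i)\<bar>))"
proof (rule SUP_least)
  fix f assume f: "f \<in> \<Phi>"
  from cSUP_upper[OF f bdd_above_signs] have "2 * \<bar>\<Sum>i\<in>I. \<xi> i * f (x i)\<bar> \<le> 2 * (SUP f\<in>\<Phi>. \<bar>\<Sum>i\<in>I. \<xi> i * f (x i)\<bar>)"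
    by simp
  then show "ennreal \<bar>0 + (\<Sum>i\<in>I. 2 * (\<xi> i * f (x i)))\<bar> \<le> ennreal (2 * (SUP f\<in>\<Phi>. \<bar>\<Sum>i\<in>I. \<xi> i * f (x i)\<bar>))"
    unfolding sum_distrib_left[symmetric] by (intro ennreal_leI) (simp add: abs_mult)
qed

lemma integral_ipm_empirical_le:
  assumes \<mu>: "\<mu> \<in> moment_measures 2" and n: "1 \<le> n" and A3: "0 \<le> A3"
    and rad: "\<And>x. rademacher_complexity \<Phi> n x \<le> A3 / real n * sqrt (\<Sum>i=1..n. ((norm (x i))\<^sup>2 + 1))"
  shows "(\<integral>x. ipm \<Phi> \<mu> (empirical_measure n x) \<partial>PiM {1..n} (\<lambda>_. \<mu>))
    \<le> 2 * A3 / sqrt (real n) * sqrt (\<integral>x. ((norm x)\<^sup>2 + 1) \<partial>\<mu>)"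
proof -
  note \<mu>' = moment_measuresD[OF \<mu>]
  note [measurable_cong] = \<mu>'(2)
  have \<mu>1: "\<mu> \<in> moment_measures 1" using \<mu> moment_measures_2_1 by auto
  define I where "I = {1..n}"
  define P where "P = PiM I (\<lambda>_::nat. \<mu>)"
  define G where "G x = ipm \<Phi> \<mu> (empirical_measure n x)" for x
  define q where "q x = (\<Sum>i\<in>I. ((norm (x i))\<^sup>2 + 1))" for x :: "nat \<Rightarrow> 'a"
  define m where "m = (\<integral>x. ((norm x)\<^sup>2 + 1) \<partial>\<mu>)"
  have fin: "finite I" by (simp add: I_def)
  interpret P: prob_space P unfolding P_def by (intro prob_space_PiM \<mu>')
  have comp: "distr P \<mu> (\<lambda>x. x i) = \<mu>" if "i \<in> I" for i
    unfolding P_def using that by (intro distr_PiM_component \<mu>')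
  have q1: "integrable P (\<lambda>x. (norm (x i))\<^sup>2 + 1)" "(\<integral>x. (norm (x i))\<^sup>2 + 1 \<partial>P) = m" if i: "i \<in> I" for i
  proof -
    have mi: "(\<lambda>x. x i) \<in> measurable P \<mu>" unfolding P_def using i by measurable
    have "integrable \<mu> (\<lambda>y. (norm y)\<^sup>2 + 1)"
      using \<mu>'(1,4) prob_space.finite_measure[OF \<mu>'(1)] by (auto intro!: finite_measure.integrable_const)
    then have "integrable (distr P \<mu> (\<lambda>x. x i)) (\<lambda>y. (norm y)\<^sup>2 + 1)" by (simp add: comp i)
    then show "integrable P (\<lambda>x. (norm (x i))\<^sup>2 + 1)" by (rule integrable_distr[OF mi])
    have "(\<integral>y. (norm y)\<^sup>2 + 1 \<partial>distr P \<mu> (\<lambda>x. x i)) = (\<integral>x. (norm (x i))\<^sup>2 + 1 \<partial>P)"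
      by (intro integral_distr[OF mi]) measurable
    then show "(\<integral>x. (norm (x i))\<^sup>2 + 1 \<partial>P) = m" by (simp add: comp i m_def)
  qed
  have qi: "integrable P q"
    unfolding q_def by (intro Bochner_Integration.integrable_sum q1(1))
  have "(\<integral>x. q x \<partial>P) = (\<Sum>i\<in>I. \<integral>x. (norm (x i))\<^sup>2 + 1 \<partial>P)"
    unfolding q_def by (intro Bochner_Integration.integral_sum q1(1))
  then have q_eq: "(\<integral>x. q x \<partial>P) = real n * m"
    by (simp add: q1(2)) (simp add: I_def)
  have q0: "0 \<le> q x" for x unfolding q_def by (intro sum_nonneg) simp
  have sq: "integrable P (\<lambda>x. sqrt (q x))"
  proof (rule P.square_integrable_imp_integrable)
    show "(\<lambda>x. sqrt (q x)) \<in> borel_measurable P"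
      using borel_measurable_integrable[OF qi] by (rule measurable_compose) simp
    show "integrable P (\<lambda>x. (sqrt (q x))\<^sup>2)" using qi q0 by simp
  qed
  have "0 \<le> P.variance (\<lambda>x. sqrt (q x))" by simp
  then have "(\<integral>x. sqrt (q x) \<partial>P)\<^sup>2 \<le> real n * m"
    using P.variance_eq[OF sq] qi q0 q_eq by simp
  then have sq_le: "(\<integral>x. sqrt (q x) \<partial>P) \<le> sqrt (real n * m)" by (rule real_le_rsqrt)

  have Gi: "integrable P G"
    unfolding P_def G_def I_def using coord_lipschitz_ipm_empirical[OF \<mu>1 n]
    by (intro integrable_coord_lipschitz[OF \<mu>1]) auto
  have G0: "0 \<le> G x" for x by (simp add: G_def ipm_nonneg)
  let ?S = "\<lambda>\<xi> x. SUP f\<in>\<Phi>. ennreal \<bar>0 + (\<Sum>i\<in>I. 2 * (\<xi> i * f (x i)))\<bar>"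
  have Sm: "?S \<xi> \<in> borel_measurable P" for \<xi>
    using measurable_SUP_coord[OF \<mu>'(2) fin subset_refl, of "\<lambda>_. 0" "\<lambda>_ _. 0" "\<lambda>i. 2 * \<xi> i"]
    by (simp add: P_def mult.assoc)
  have "ennreal (real n * (\<integral>x. G x \<partial>P)) = (\<integral>\<^sup>+x. ennreal (real n * G x) \<partial>P)"
    using Gi G0 by (subst nn_integral_eq_integral) auto
  also have "\<dots> \<le> (\<integral>\<^sup>+x. (SUP f\<in>\<Phi>. ennreal \<bar>0 + (\<Sum>i\<in>I. (\<integral>z. f z \<partial>\<mu>) - f (x i))\<bar>) \<partial>P)"
    unfolding G_def I_def by (intro nn_integral_mono ipm_empirical_le_SUP[OF \<mu>1 n])
  also have "\<dots> \<le> (\<integral>\<^sup>+\<xi>. \<integral>\<^sup>+x. ?S \<xi> x \<partial>P \<partial>sign_pmf I)"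
    unfolding P_def by (rule nn_integral_symmetrize[OF \<mu>1 fin])
  also have "\<dots> = (\<integral>\<^sup>+x. \<integral>\<^sup>+\<xi>. ?S \<xi> x \<partial>sign_pmf I \<partial>P)"
    by (rule nn_integral_pmf_swap[symmetric, OF finite_set_sign_pmf[OF fin] Sm])
  also have "\<dots> \<le> (\<integral>\<^sup>+x. ennreal (2 * A3 * sqrt (q x)) \<partial>P)"
  proof (rule nn_integral_mono)
    fix x :: "nat \<Rightarrow> 'a"
    let ?R = "\<lambda>\<xi>. SUP f\<in>\<Phi>. \<bar>\<Sum>i\<in>I. \<xi> i * f (x i)\<bar>"
    have R0: "0 \<le> 2 * ?R \<xi>" for \<xi>
    proof -
      obtain f where f: "f \<in> \<Phi>" using nonempty by blast
      have "0 \<le> \<bar>\<Sum>i\<in>I. \<xi> i * f (x i)\<bar>" by simp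
      also have "\<dots> \<le> ?R \<xi>" by (rule cSUP_upper[OF f bdd_above_signs])
      finally show ?thesis by simp
    qed
    have Ri: "integrable (sign_pmf I) (\<lambda>\<xi>. 2 * ?R \<xi>)"
      by (rule integrable_measure_pmf_finite[OF finite_set_sign_pmf[OF fin]])
    have "(\<integral>\<^sup>+\<xi>. ?S \<xi> x \<partial>sign_pmf I) \<le> (\<integral>\<^sup>+\<xi>. ennreal (2 * ?R \<xi>) \<partial>sign_pmf I)"
      by (intro nn_integral_mono SUP_signs_le)
    also have "\<dots> = ennreal (\<integral>\<xi>. 2 * ?R \<xi> \<partial>sign_pmf I)"
      using Ri R0 by (intro nn_integral_eq_integral) auto
    also have "(\<integral>\<xi>. 2 * ?R \<xi> \<partial>sign_pmf I) = 2 * real n * rademacher_complexity \<Phi> n x"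
      using n by (simp add: rademacher_complexity_def I_def)
    also have "ennreal \<dots> \<le> ennreal (2 * A3 * sqrt (q x))"
    proof (rule ennreal_leI)
      have "2 * real n * rademacher_complexity \<Phi> n x \<le> 2 * real n * (A3 / real n * sqrt (q x))"
        unfolding q_def I_def by (intro mult_left_mono rad) simp
      then show "2 * real n * rademacher_complexity \<Phi> n x \<le> 2 * A3 * sqrt (q x)" using n by simp
    qed
    finally show "(\<integral>\<^sup>+\<xi>. ?S \<xi> x \<partial>sign_pmf I) \<le> ennreal (2 * A3 * sqrt (q x))" .
  qed
  also have "\<dots> = ennreal (2 * A3 * (\<integral>x. sqrt (q x) \<partial>P))"
    using sq q0 A3 by (subst nn_integral_eq_integral) auto
  also have "\<dots> \<le> ennreal (2 * A3 * sqrt (real n * m))"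
    using A3 sq_le by (intro ennreal_leI mult_left_mono) auto
  finally have "real n * (\<integral>x. G x \<partial>P) \<le> 2 * A3 * sqrt (real n * m)"
    using A3 q_eq q0 P.prob_space by (subst (asm) ennreal_le_iff) (auto intro!: mult_nonneg_nonneg simp: m_def)
  then have "(\<integral>x. G x \<partial>P) \<le> 2 * A3 * sqrt (real n * m) / real n"
    using n by (simp add: field_simps)
  also have "\<dots> = 2 * A3 / sqrt (real n) * sqrt m"
    using n by (simp add: real_sqrt_mult field_simps)
  finally show ?thesis by (simp add: G_def P_def I_def m_def)
qed

end

lemma coord_lipschitz_cmult:
  assumes "coord_lipschitz I L H" "0 \<le> c"
  shows "coord_lipschitz I (c * L) (\<lambda>x. c * H x)"
  unfolding coord_lipschitz_def
proof (intro allI)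
  fix x y
  have "\<bar>c * H x - c * H y\<bar> = c * \<bar>H x - H y\<bar>"
    using assms(2) by (simp add: right_diff_distrib[symmetric] abs_mult)
  also have "\<dots> \<le> c * (L * (\<Sum>i\<in>I. norm (x i - y i)))"
    by (intro mult_left_mono coord_lipschitzD[OF assms(1)] assms(2))
  finally show "\<bar>c * H x - c * H y\<bar> \<le> c * L * (\<Sum>i\<in>I. norm (x i - y i))" by (simp add: mult.assoc)
qed

locale iid_sample = prob_space M for M :: "'b measure" +
  fixes X :: "nat \<Rightarrow> 'b \<Rightarrow> 'a::euclidean_space" and I :: "nat set" and \<mu> :: "'a measure"
  assumes finite_I: "finite I" and nonempty_I: "I \<noteq> {}"
    and moment: "\<mu> \<in> moment_measures 1"
    and indep: "indep_vars (\<lambda>_. borel) X I"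
    and law: "i \<in> I \<Longrightarrow> distr M borel (X i) = \<mu>"
begin

abbreviation P :: "(nat \<Rightarrow> 'a) measure" where "P \<equiv> PiM I (\<lambda>_. \<mu>)"

lemma sample_distr: "distr M P (\<lambda>\<omega>. \<lambda>i\<in>I. X i \<omega>) = P"
    and sample_measurable: "(\<lambda>\<omega>. \<lambda>i\<in>I. X i \<omega>) \<in> measurable M P"
proof -
  have rv: "X i \<in> borel_measurable M" if "i \<in> I" for i
    using indep that by (simp add: indep_vars_def)
  have s: "sets P = sets (PiM I (\<lambda>_. borel))"
    using moment_measuresD(2)[OF moment] by (intro sets_PiM_cong) auto
  have "(\<lambda>\<omega>. \<lambda>i\<in>I. X i \<omega>) \<in> measurable M (PiM I (\<lambda>_. borel))"
    using rv by (intro measurable_restrict) auto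
  then show "(\<lambda>\<omega>. \<lambda>i\<in>I. X i \<omega>) \<in> measurable M P"
    using measurable_cong_sets[OF refl s] by blast
  have "distr M P (\<lambda>\<omega>. \<lambda>i\<in>I. X i \<omega>) = distr M (PiM I (\<lambda>_. borel)) (\<lambda>\<omega>. \<lambda>i\<in>I. X i \<omega>)"
    using s by (intro distr_cong) auto
  also have "\<dots> = PiM I (\<lambda>i. distr M borel (X i))"
    using indep_vars_iff_distr_eq_PiM'[OF nonempty_I rv] indep by simp
  also have "\<dots> = P" using law by (intro PiM_cong) auto
  finally show "distr M P (\<lambda>\<omega>. \<lambda>i\<in>I. X i \<omega>) = P" .
qed

context
  fixes H :: "(nat \<Rightarrow> 'a) \<Rightarrow> real" and L :: real
  assumes H: "coord_lipschitz I L H"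
begin

lemma coord_lipschitz_restrict: "H (\<lambda>i. X i \<omega>) = H (\<lambda>i\<in>I. X i \<omega>)"
  using coord_lipschitzD[OF H, of "\<lambda>i. X i \<omega>" "\<lambda>i\<in>I. X i \<omega>"] by simp

lemma H_measurable: "H \<in> borel_measurable P"
  by (rule measurable_coord_lipschitz[OF H moment_measuresD(2)[OF moment]])

lemma sample_integrable: "integrable M (\<lambda>\<omega>. H (\<lambda>i. X i \<omega>))"
  unfolding coord_lipschitz_restrict
  using integrable_coord_lipschitz[OF moment finite_I H] sample_distr
  by (intro integrable_distr[OF sample_measurable]) simp

lemma sample_integral: "(\<integral>\<omega>. H (\<lambda>i. X i \<omega>) \<partial>M) = (\<integral>x. H x \<partial>P)"
  unfolding coord_lipschitz_restrict
  by (subst integral_distr[OF sample_measurable H_measurable, symmetric]) (simp add: sample_distr)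

lemma sample_nn_integral:
  assumes g: "g \<in> borel_measurable borel"
  shows "(\<integral>\<^sup>+\<omega>. g (H (\<lambda>i. X i \<omega>)) \<partial>M) = (\<integral>\<^sup>+x. g (H x) \<partial>P)"
proof -
  have "(\<integral>\<^sup>+x. g (H x) \<partial>distr M P (\<lambda>\<omega>. \<lambda>i\<in>I. X i \<omega>)) = (\<integral>\<^sup>+\<omega>. g (H (\<lambda>i\<in>I. X i \<omega>)) \<partial>M)"
    using measurable_compose[OF H_measurable g]
    by (intro nn_integral_distr[OF sample_measurable]) (simp add: sample_distr)
  then show ?thesis unfolding coord_lipschitz_restrict by (simp only: sample_distr)
qed

lemma sample_second_moment:
  assumes \<mu>: "\<mu> \<in> moment_measures 2"
  shows "integrable M (\<lambda>\<omega>. (H (\<lambda>i. X i \<omega>))\<^sup>2)"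
    and "(\<integral>\<omega>. (H (\<lambda>i. X i \<omega>))\<^sup>2 \<partial>M)
      \<le> (\<integral>\<omega>. H (\<lambda>i. X i \<omega>) \<partial>M)\<^sup>2 + card I * (L\<^sup>2 * (\<integral>x. (norm x)\<^sup>2 \<partial>\<mu>))" (is "_ \<le> ?b")
proof -
  have le: "(\<integral>\<^sup>+\<omega>. ennreal ((H (\<lambda>i. X i \<omega>))\<^sup>2) \<partial>M) \<le> ennreal ?b"
    using nn_integral_square_coord_lipschitz[OF \<mu> finite_I H]
    by (simp add: sample_nn_integral[of "\<lambda>h. ennreal (h\<^sup>2)"] sample_integral)
  have m: "(\<lambda>\<omega>. (H (\<lambda>i. X i \<omega>))\<^sup>2) \<in> borel_measurable M"
    using borel_measurable_integrable[OF sample_integrable] by (rule borel_measurable_power)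
  show i: "integrable M (\<lambda>\<omega>. (H (\<lambda>i. X i \<omega>))\<^sup>2)"
    using le m by (intro integrableI_bounded) (auto intro: le_less_trans)
  have "0 \<le> ?b" by (simp add: integral_nonneg_AE)
  then show "(\<integral>\<omega>. (H (\<lambda>i. X i \<omega>))\<^sup>2 \<partial>M) \<le> ?b"
    using le i by (subst (asm) nn_integral_eq_integral) (auto simp del: ennreal_plus)
qed

lemma sample_concentration:
  assumes T1: "T1_inequality \<mu> \<kappa>" and \<kappa>: "0 < \<kappa>" and L: "0 < L" and a: "0 < a"
    and b: "(\<integral>\<omega>. H (\<lambda>i. X i \<omega>) \<partial>M) \<le> b"
  shows "measure M {\<omega> \<in> space M. a \<le> H (\<lambda>i. X i \<omega>) - b} \<le> exp (- (a\<^sup>2 / (2 * card I * L\<^sup>2 * \<kappa>\<^sup>2)))"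
proof -
  define N where "N = real (card I)"
  have N: "0 < N" using finite_I nonempty_I by (simp add: N_def card_gt_0_iff)
  define t where "t = a / (N * L\<^sup>2 * \<kappa>\<^sup>2)"
  have t: "0 < t" using a N L \<kappa> by (simp add: t_def)
  let ?D = "\<lambda>\<omega>. H (\<lambda>i. X i \<omega>)"
  have Dm [measurable]: "?D \<in> borel_measurable M" using sample_integrable by (rule borel_measurable_integrable)
  have lip: "coord_lipschitz I (t * L) (\<lambda>x. t * H x)"
    using H t by (intro coord_lipschitz_cmult) auto
  have "(\<integral>\<^sup>+x. ennreal (exp (t * H x)) \<partial>P)
    \<le> ennreal (exp ((\<integral>x. t * H x \<partial>P) + card I * ((t * L)\<^sup>2 * \<kappa>\<^sup>2 / 2)))"
  proof (rule nn_integral_exp_coord_lipschitz[OF moment _ finite_I lip])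
    fix F :: "'a \<Rightarrow> real"
    assume "\<And>x y. \<bar>F x - F y\<bar> \<le> t * L * norm (x - y)"
    then show "(\<integral>\<^sup>+x. ennreal (exp (F x)) \<partial>\<mu>) \<le> ennreal (exp ((\<integral>x. F x \<partial>\<mu>) + (t * L)\<^sup>2 * \<kappa>\<^sup>2 / 2))"
      using t L by (intro T1_nn_integral_exp[OF T1 \<kappa> moment]) auto
  qed
  then have exp_le: "(\<integral>\<^sup>+x. ennreal (exp (t * H x)) \<partial>P)
    \<le> ennreal (exp (t * b + N * ((t * L)\<^sup>2 * \<kappa>\<^sup>2 / 2)))"
    using b t by (elim order_trans) (auto simp: sample_integral N_def intro!: ennreal_leI)
  have "emeasure M {\<omega> \<in> space M. a \<le> ?D \<omega> - b} = (\<integral>\<^sup>+\<omega>. indicator {\<omega> \<in> space M. a \<le> ?D \<omega> - b} \<omega> \<partial>M)"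
    by (intro nn_integral_indicator[symmetric]) measurable
  also have "\<dots> \<le> (\<integral>\<^sup>+\<omega>. ennreal (exp (- t * (a + b))) * ennreal (exp (t * ?D \<omega>)) \<partial>M)"
  proof (rule nn_integral_mono)
    fix \<omega> assume "\<omega> \<in> space M"
    have "1 \<le> exp (- t * (a + b)) * exp (t * ?D \<omega>)" if "a \<le> ?D \<omega> - b"
    proof -
      have "0 \<le> t * (?D \<omega> - b - a)" using t that by simp
      then show ?thesis by (simp add: exp_add[symmetric] algebra_simps)
    qed
    then show "indicator {\<omega> \<in> space M. a \<le> ?D \<omega> - b} \<omega> \<le> ennreal (exp (- t * (a + b))) * ennreal (exp (t * ?D \<omega>))"
      by (auto simp: indicator_def ennreal_mult[symmetric] simp del: mult_minus_left)
  qed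
  also have "\<dots> = ennreal (exp (- t * (a + b))) * (\<integral>\<^sup>+x. ennreal (exp (t * H x)) \<partial>P)"
    using sample_nn_integral[of "\<lambda>h. ennreal (exp (t * h))"] by (subst nn_integral_cmult) auto
  also have "\<dots> \<le> ennreal (exp (- t * (a + b))) * ennreal (exp (t * b + N * ((t * L)\<^sup>2 * \<kappa>\<^sup>2 / 2)))"
    by (intro mult_left_mono exp_le) simp
  also have "\<dots> = ennreal (exp (- t * (a + b) + (t * b + N * ((t * L)\<^sup>2 * \<kappa>\<^sup>2 / 2))))"
    unfolding exp_add[of "- t * (a + b)"] by (rule ennreal_mult[symmetric]) simp_all
  also have "- t * (a + b) + (t * b + N * ((t * L)\<^sup>2 * \<kappa>\<^sup>2 / 2)) = - (a\<^sup>2 / (2 * card I * L\<^sup>2 * \<kappa>\<^sup>2))"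
  proof -
    have "t * (N * L\<^sup>2 * \<kappa>\<^sup>2) = a" using N L \<kappa> by (simp add: t_def)
    then have "N * ((t * L)\<^sup>2 * \<kappa>\<^sup>2 / 2) = t * a / 2"
      by (simp add: power_mult_distrib power2_eq_square algebra_simps)
    moreover have "t * a = 2 * (a\<^sup>2 / (2 * card I * L\<^sup>2 * \<kappa>\<^sup>2))"
      using N by (simp add: t_def N_def power2_eq_square)
    ultimately show ?thesis by (simp add: algebra_simps)
  qed
  finally show ?thesis by (simp add: emeasure_eq_measure)
qed

end

end

theorem theorem2p7:
  fixes \<Phi> :: "(real ^ 'd \<Rightarrow> real) set" and A1 A2 A3 :: real
  assumes "admissible_test_class \<Phi> A1 A2 A3"
  shows
    "(Metric_space (moment_measures 1) (ipm \<Phi>) \<and>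
      (\<forall>\<mu>\<in>moment_measures 2. \<forall>\<mu>'\<in>moment_measures 2.
         ennreal (ipm \<Phi> \<mu> \<mu>') \<le> ennreal A1 * wasserstein 1 \<mu> \<mu>' \<and>
         ennreal A1 * wasserstein 1 \<mu> \<mu>' \<le> ennreal A1 * wasserstein 2 \<mu> \<mu>'))
   \<and> (\<forall>K \<mu>s \<mu>. compact K \<longrightarrow> \<mu> \<in> prob_measures \<longrightarrow> measure \<mu> K = 1 \<longrightarrow>
        (\<forall>i\<ge>1. \<mu>s i \<in> prob_measures \<and> measure (\<mu>s i) K = 1) \<longrightarrow>
        (weakly_converges \<mu>s \<mu> \<longleftrightarrow> (\<lambda>i. ipm \<Phi> (\<mu>s i) \<mu>) \<longlonglongrightarrow> 0))
   \<and> (\<forall>(M :: 'b measure) (X :: nat \<Rightarrow> 'b \<Rightarrow> real ^ 'd) n \<mu>.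
        \<mu> \<in> moment_measures 2 \<longrightarrow> n \<ge> 1 \<longrightarrow>
        prob_space M \<longrightarrow> prob_space.indep_vars M (\<lambda>_. borel) X {1..n} \<longrightarrow>
        (\<forall>i\<in>{1..n}. distr M borel (X i) = \<mu>) \<longrightarrow>
        (let D = (\<lambda>\<omega>. ipm \<Phi> \<mu> (empirical_measure n (\<lambda>i. X i \<omega>)));
             m = (\<integral>x. ((norm x)\<^sup>2 + 1) \<partial>\<mu>)
         in (integrable M D \<and>
             (\<integral>\<omega>. D \<omega> \<partial>M) \<le> 2 * A3 / sqrt (real n) * sqrt m \<and>
             integrable M (\<lambda>\<omega>. (D \<omega>)\<^sup>2) \<and>
             (\<integral>\<omega>. (D \<omega>)\<^sup>2 \<partial>M)
               \<le> A1\<^sup>2 / real n * (\<integral>x. (norm x)\<^sup>2 \<partial>\<mu>) + 4 * A3\<^sup>2 / real n * m)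
          \<and> (\<forall>\<kappa>>0. T1_inequality \<mu> \<kappa> \<longrightarrow>
               (\<forall>a>0. measure M {\<omega> \<in> space M. D \<omega> - 2 * A3 / sqrt (real n) * sqrt m \<ge> a}
                  \<le> exp (- (real n * a\<^sup>2 / (2 * A1\<^sup>2 * \<kappa>\<^sup>2)))))))"
proof -
  interpret lipschitz_class \<Phi> A1 A2 by (rule admissible_imp_lipschitz_class[OF assms])
  have A3: "0 < A3" and rad: "rademacher_complexity \<Phi> n x \<le> A3 / real n * sqrt (\<Sum>i=1..n. ((norm (x i))\<^sup>2 + 1))"
    if "1 \<le> n" for n x
    using assms that by (auto simp: admissible_test_class_def)
  show ?thesis
  proof (intro conjI ballI allI impI)
    show "Metric_space (moment_measures 1) (ipm \<Phi>)" by (rule Metric_space_ipm[OF assms])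
  next
    fix \<mu> \<mu>' :: "(real ^ 'd) measure" assume \<mu>: "\<mu> \<in> moment_measures 2" "\<mu>' \<in> moment_measures 2"
    show "ennreal (ipm \<Phi> \<mu> \<mu>') \<le> ennreal A1 * wasserstein 1 \<mu> \<mu>'"
      using \<mu> moment_measures_2_1 by (intro ipm_le_wasserstein) auto
    show "ennreal A1 * wasserstein 1 \<mu> \<mu>' \<le> ennreal A1 * wasserstein 2 \<mu> \<mu>'"
      by (intro mult_left_mono wasserstein_1_le_2 moment_measuresD(1)[OF \<mu>(1)]) simp
  next
    fix K :: "(real ^ 'd) set" and \<mu>s :: "nat \<Rightarrow> (real ^ 'd) measure" and \<mu> :: "(real ^ 'd) measure"
    assume K: "compact K" and \<mu>: "\<mu> \<in> prob_measures" "measure \<mu> K = 1"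
      and \<mu>s: "\<forall>i\<ge>1. \<mu>s i \<in> prob_measures \<and> measure (\<mu>s i) K = 1"
    have "weakly_converges \<mu>s \<mu> \<longleftrightarrow> weakly_converges (\<lambda>i. \<mu>s (Suc i)) \<mu>"
      unfolding weakly_converges_def by (subst filterlim_sequentially_Suc) (rule refl)
    also have "\<dots> \<longleftrightarrow> (\<lambda>i. ipm \<Phi> (\<mu>s (Suc i)) \<mu>) \<longlonglongrightarrow> 0"
      using \<mu>s by (intro weakly_converges_iff_ipm[OF assms K \<mu>]) auto
    also have "\<dots> \<longleftrightarrow> (\<lambda>i. ipm \<Phi> (\<mu>s i) \<mu>) \<longlonglongrightarrow> 0"
      by (rule filterlim_sequentially_Suc)
    finally show "weakly_converges \<mu>s \<mu> \<longleftrightarrow> (\<lambda>i. ipm \<Phi> (\<mu>s i) \<mu>) \<longlonglongrightarrow> 0" .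
  next
    fix M :: "'b measure" and X :: "nat \<Rightarrow> 'b \<Rightarrow> real ^ 'd" and n :: nat and \<mu>
    assume \<mu>: "\<mu> \<in> moment_measures 2" and n: "1 \<le> n" and M: "prob_space M"
      and indep: "prob_space.indep_vars M (\<lambda>_. borel) X {1..n}"
      and law: "\<forall>i\<in>{1..n}. distr M borel (X i) = \<mu>"
    have \<mu>1: "\<mu> \<in> moment_measures 1" using \<mu> moment_measures_2_1 by auto
    interpret prob_space M by (rule M)
    interpret iid_sample M X "{1..n}" \<mu>
      using n \<mu>1 indep law by unfold_locales auto
    let ?G = "\<lambda>x. ipm \<Phi> \<mu> (empirical_measure n x)"
    define m where "m = (\<integral>x. ((norm x)\<^sup>2 + 1) \<partial>\<mu>)"
    have m0: "0 \<le> m" by (simp add: m_def integral_nonneg_AE)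
    let ?b = "2 * A3 / sqrt (real n) * sqrt m"
    note G = coord_lipschitz_ipm_empirical[OF \<mu>1 n]
    have mean: "(\<integral>\<omega>. ?G (\<lambda>i. X i \<omega>) \<partial>M) \<le> ?b"
      unfolding sample_integral[OF G] m_def
      using A3[OF n] rad[OF n] by (intro integral_ipm_empirical_le[OF \<mu> n]) auto
    have mean0: "0 \<le> (\<integral>\<omega>. ?G (\<lambda>i. X i \<omega>) \<partial>M)" by (simp add: integral_nonneg_AE ipm_nonneg)
    have "?b\<^sup>2 = 4 * A3\<^sup>2 / real n * m"
      using m0 by (simp add: power_mult_distrib power_divide)
    with power_mono[OF mean mean0, of 2]
    have "(\<integral>\<omega>. ?G (\<lambda>i. X i \<omega>) \<partial>M)\<^sup>2 \<le> 4 * A3\<^sup>2 / real n * m" by simp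
    moreover have "real (card {1..n}) * ((A1 / real n)\<^sup>2 * (\<integral>x. (norm x)\<^sup>2 \<partial>\<mu>)) = A1\<^sup>2 / real n * (\<integral>x. (norm x)\<^sup>2 \<partial>\<mu>)"
      using n by (simp add: power_divide power2_eq_square)
    ultimately have second: "(\<integral>\<omega>. (?G (\<lambda>i. X i \<omega>))\<^sup>2 \<partial>M) \<le> A1\<^sup>2 / real n * (\<integral>x. (norm x)\<^sup>2 \<partial>\<mu>) + 4 * A3\<^sup>2 / real n * m"
      using sample_second_moment(2)[OF G \<mu>] by linarith
    have tail: "measure M {\<omega> \<in> space M. a \<le> ?G (\<lambda>i. X i \<omega>) - ?b} \<le> exp (- (real n * a\<^sup>2 / (2 * A1\<^sup>2 * \<kappa>\<^sup>2)))"
      if \<kappa>: "0 < \<kappa>" and T1: "T1_inequality \<mu> \<kappa>" and a: "0 < a" for \<kappa> a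
    proof (cases "A1 = 0")
      case True
      then show ?thesis by simp
    next
      case False
      then have "0 < A1 / real n" using L_nonneg n by simp
      from sample_concentration[OF G T1 \<kappa> this a mean]
      have "measure M {\<omega> \<in> space M. a \<le> ?G (\<lambda>i. X i \<omega>) - ?b} \<le> exp (- (a\<^sup>2 / (2 * real n * (A1 / real n)\<^sup>2 * \<kappa>\<^sup>2)))"
        by simp
      also have "a\<^sup>2 / (2 * real n * (A1 / real n)\<^sup>2 * \<kappa>\<^sup>2) = real n * a\<^sup>2 / (2 * A1\<^sup>2 * \<kappa>\<^sup>2)"
        using n by (simp add: power_divide power2_eq_square)
      finally show ?thesis .
    qed
    show "let D = (\<lambda>\<omega>. ipm \<Phi> \<mu> (empirical_measure n (\<lambda>i. X i \<omega>)));
             m = (\<integral>x. ((norm x)\<^sup>2 + 1) \<partial>\<mu>)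
         in (integrable M D \<and>
             (\<integral>\<omega>. D \<omega> \<partial>M) \<le> 2 * A3 / sqrt (real n) * sqrt m \<and>
             integrable M (\<lambda>\<omega>. (D \<omega>)\<^sup>2) \<and>
             (\<integral>\<omega>. (D \<omega>)\<^sup>2 \<partial>M)
               \<le> A1\<^sup>2 / real n * (\<integral>x. (norm x)\<^sup>2 \<partial>\<mu>) + 4 * A3\<^sup>2 / real n * m)
          \<and> (\<forall>\<kappa>>0. T1_inequality \<mu> \<kappa> \<longrightarrow>
               (\<forall>a>0. measure M {\<omega> \<in> space M. D \<omega> - 2 * A3 / sqrt (real n) * sqrt m \<ge> a}
                  \<le> exp (- (real n * a\<^sup>2 / (2 * A1\<^sup>2 * \<kappa>\<^sup>2)))))"
      using sample_integrable[OF G] mean sample_second_moment(1)[OF G \<mu>] second tail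
      unfolding Let_def m_def by blast
  qed
qed

end
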